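(* For a given player $i$, choose the parameters in the payoff-based algorithm of the context as $\gamma_t=O\left(\frac1{t^g}\right)$, $\sigma_t=O\left(\frac1{t^s}\right)$, $\epsilon_t=O\left(\frac1{t^e}\right)$, $\rho_t=O\left(\frac1{t^r}\right)$, with $0<g,s,r<1$, and (1) $r<s$; (2) $g-2s>0$. Let the other players choose their actions arbitrarily. Under Assumptions 1, 2 and 3 of the context and given an arbitrary $\boldsymbol\mu^i(0)$, the algorithm is no-regret for player $i$, with $$\mathbb E\,\frac{R^i(T,\boldsymbol a^i)}{T}=O\!\left(\frac1{T^{1-g}}+\frac1{T^{g-2s}}+\frac1{T^{2s}}+\frac1{T^{r}}\boldsymbol 1_{\boldsymbol a^i\in\partial\boldsymbol A^i}+\frac1{T^{e}}\right),$$ where the expectation is taken with respect to the sequence of stochastic vectors $\{\boldsymbol a^i(t)\}$.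
   Context: Game. There are $N$ players; player $i$ has action set $\boldsymbol A^i\subseteq\mathbb R^d$ and cost function $J^i$; $\boldsymbol A=\boldsymbol A^1\times\dots\times\boldsymbol A^N$ is the set of joint actions. A joint action is written $\boldsymbol a=(\boldsymbol a^i,\boldsymbol a^{-i})$, where $\boldsymbol a^{-i}$ collects the actions of the players other than $i$. The pseudo-gradient $\boldsymbol M:\mathbb R^{Nd}\to\mathbb R^{Nd}$ is $\boldsymbol M(\boldsymbol a)=(\nabla_{\boldsymbol a^i}J^i(\boldsymbol a^i,\boldsymbol a^{-i}))_{i=1}^N$. Assumption 1. For every $i$, $\boldsymbol A^i$ is convex and compact with nonempty interior; $J^i$ is defined on $\mathbb R^{Nd}$, is continuously differentiable in $\boldsymbol a$, and is convex in $\boldsymbol a^i$ for fixed $\boldsymbol a^{-i}$ on $\mathbb R^{Nd}$. Assumption 2. $\boldsymbol M$ is merely monotone on $\boldsymbol A$, i.e. monotone ($\langle\boldsymbol M(\boldsymbol y)-\boldsymbol M(\tilde{\boldsymbol y}),\boldsymbol y-\tilde{\boldsymbol y}\rangle\ge0$ for all $\boldsymbol y,\tilde{\boldsymbol y}\in\boldsymbol A$) but not strictly monotone (strict monotonicity means that the inequality is strict for all $\boldsymbol y\ne\tilde{\boldsymbol y}$). Assumption 3. (1) $\boldsymbol M$ is continuously differentiable over $\mathbb R^{Nd}$. (2) For each $i$, $J^i(\boldsymbol x)=O(\exp\{\|\boldsymbol x\|^{\alpha}\})$ as $\|\boldsymbol x\|\to\infty$, where $\alpha<2$. Notation. $f(x)$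 is $O(h(x))$ as $x\to a$ if $\lim_{x\to a}\frac{|f(x)|}{|h(x)|}\le K$ for some positive constant $K$. $\mathrm{Proj}_Y$ is Euclidean projection onto a convex closed set $Y$; $\partial Y$ is the boundary of $Y$; $(1-\rho)Y:=\{\boldsymbol x\in Y:\mathrm{dist}(\boldsymbol x,\partial Y)\ge\rho\}$; $\boldsymbol 1$ denotes an indicator. Algorithm of player $i$. Parameters: stepsize $\gamma_t$, sampling parameter $\sigma_t$, regularization parameters $\epsilon_t$ and $\rho_t\in[0,1)$; the initial iterate $\boldsymbol\mu^i(0)\in\mathbb R^d$ is an arbitrary finite value. At each $t=0,1,2,\dots$: sample $\boldsymbol\xi^i(t)$ from the normal distribution on $\mathbb R^d$ with density $\boldsymbol x^i\mapsto\frac1{(\sqrt{2\pi}\sigma_t)^d}\exp\left\{-\sum_{k=1}^d\frac{(x^i_k-\mu^i_k(t))^2}{2\sigma_t^2}\right\}$; play $\boldsymbol a^i(t)=\mathrm{Proj}_{\boldsymbol A^i}[\boldsymbol\xi^i(t)]$; receive the payoff $J^i(t)=J^i(\boldsymbol a^1(t),\dots,\boldsymbol a^N(t))$; set $\boldsymbol m^i(t)=J^i(t)\frac{\boldsymbol\xi^i(t)-\boldsymbol\mu^i(t)}{\sigma_t^2}$ and $\boldsymbol\mu^i(t+1)=\mathrm{Proj}_{(1-\rho_t)\boldsymbol A^i}[\boldsymbol\mu^i(t)-\gamma_t(\boldsymbol m^i(t)+\epsilon_t\boldsymbol\mu^i(t))]$. Regret. With $J^i_t(\cdot)=J^i(\cdot,\boldsymbol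 a^{-i}(t))$, the regret of player $i$'s algorithm until time $T$ with respect to any reference point $\boldsymbol a^i\in\boldsymbol A^i$ is $R^i(T,\boldsymbol a^i)=\sum_{t=1}^TJ^i_t(\boldsymbol a^i(t))-\sum_{t=1}^TJ^i_t(\boldsymbol a^i)$. No-regret means $\limsup_{T\to\infty}\frac{R^i(T,\boldsymbol a^i)}{T}\le0$.
   Formalization: The orders of γ_t, σ_t, ρ_t are taken as exact (bounded above and below by constant multiples), γ_t is eventually nonincreasing, e>0 is assumed, and the expected regret rate is an upper bound only (negative regret unrestricted); as literally stated, the claim fails. *)

theory Defs
  imports "HOL-Probability.Probability" "HOL-Library.Landau_Symbols"
begin

text \<open>
  The players are the elements of a finite type \<open>'n\<close>, an action is a vector in \<open>real ^ 'd\<close>, and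
  \<open>real ^ 'd ^ 'n\<close> with its Euclidean inner product is the space of joint actions.
\<close>

definition joint_actions :: "('n \<Rightarrow> (real ^ 'd) set) \<Rightarrow> (real ^ 'd ^ 'n) set" where
  "joint_actions A = {a. \<forall>j. a $ j \<in> A j}"

text \<open>The joint action in which player \<open>i\<close> plays \<open>x\<close> and everybody else plays as in \<open>a\<close>.\<close>

definition with_action :: "'n \<Rightarrow> real ^ 'd \<Rightarrow> real ^ 'd ^ 'n \<Rightarrow> real ^ 'd ^ 'n" where
  "with_action i x a = (\<chi> j. if j = i then x else a $ j)"

definition gradient :: "('a :: euclidean_space \<Rightarrow> real) \<Rightarrow> 'a \<Rightarrow> 'a" where
  "gradient f x = (THE D. GDERIV f x :> D)"

definition pseudo_gradient ::
    "('n \<Rightarrow> real ^ 'd ^ 'n \<Rightarrow> real) \<Rightarrow> real ^ 'd ^ 'n \<Rightarrow> real ^ 'd ^ 'n" where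
  "pseudo_gradient J a = (\<chi> i. gradient (\<lambda>x. J i (with_action i x a)) (a $ i))"

definition continuously_differentiable ::
    "('a :: real_normed_vector \<Rightarrow> 'b :: real_normed_vector) \<Rightarrow> bool" where
  "continuously_differentiable f \<longleftrightarrow>
     (\<exists>f' :: 'a \<Rightarrow> 'a \<Rightarrow>\<^sub>L 'b.
        (\<forall>x. (f has_derivative blinfun_apply (f' x)) (at x)) \<and> continuous_on UNIV f')"

definition monotone_map :: "'a :: real_inner set \<Rightarrow> ('a \<Rightarrow> 'a) \<Rightarrow> bool" where
  "monotone_map S f \<longleftrightarrow> (\<forall>x\<in>S. \<forall>y\<in>S. inner (f x - f y) (x - y) \<ge> 0)"

definition strictly_monotone_map :: "'a :: real_inner set \<Rightarrow> ('a \<Rightarrow> 'a) \<Rightarrow> bool" where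
  "strictly_monotone_map S f \<longleftrightarrow>
     (\<forall>x\<in>S. \<forall>y\<in>S. x \<noteq> y \<longrightarrow> inner (f x - f y) (x - y) > 0)"

definition convex_game ::
    "('n \<Rightarrow> (real ^ 'd) set) \<Rightarrow> ('n \<Rightarrow> real ^ 'd ^ 'n \<Rightarrow> real) \<Rightarrow> bool" where
  "convex_game A J \<longleftrightarrow>
     (\<forall>i. convex (A i) \<and> compact (A i) \<and> interior (A i) \<noteq> {} \<and>
          continuously_differentiable (J i) \<and>
          (\<forall>a. convex_on UNIV (\<lambda>x. J i (with_action i x a))))"

definition merely_monotone_game ::
    "('n \<Rightarrow> (real ^ 'd) set) \<Rightarrow> ('n \<Rightarrow> real ^ 'd ^ 'n \<Rightarrow> real) \<Rightarrow> bool" where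
  "merely_monotone_game A J \<longleftrightarrow>
     monotone_map (joint_actions A) (pseudo_gradient J) \<and>
     \<not> strictly_monotone_map (joint_actions A) (pseudo_gradient J)"

definition smooth_with_growth :: "('n \<Rightarrow> real ^ 'd ^ 'n \<Rightarrow> real) \<Rightarrow> bool" where
  "smooth_with_growth J \<longleftrightarrow>
     continuously_differentiable (pseudo_gradient J) \<and>
     (\<exists>\<alpha><2. \<forall>i. J i \<in> O[at_infinity](\<lambda>x. exp (norm x powr \<alpha>)))"

text \<open>
  The set usually written \<open>(1 - \<rho>) Y\<close> in this context; it is not the dilation of \<open>Y\<close> by the
  factor \<open>1 - \<rho>\<close>.
\<close>

definition shrunk :: "real \<Rightarrow> 'a :: metric_space set \<Rightarrow> 'a set" where
  "shrunk \<rho> Y = {x \<in> Y. infdist x (frontier Y) \<ge> \<rho>}"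

definition normal_vec :: "real ^ 'd \<Rightarrow> real \<Rightarrow> (real ^ 'd) measure" where
  "normal_vec m s = density lborel (\<lambda>x. ennreal
     (1 / (sqrt (2 * pi) * s) ^ CARD('d) * exp (- (\<Sum>k\<in>UNIV. (x $ k - m $ k)\<^sup>2 / (2 * s\<^sup>2)))))"

text \<open>
  \<open>F t\<close> is the information available just before player \<open>i\<close> draws its sample in round \<open>t\<close>. It
  contains the actions chosen by the other players in that round, since the players move
  simultaneously.
\<close>

definition information_flow :: "'w measure \<Rightarrow> (nat \<Rightarrow> 'w measure) \<Rightarrow> bool" where
  "information_flow M F \<longleftrightarrow> filtration (space M) F \<and> (\<forall>t. subalgebra M (F t))"

text \<open>
  Arbitrary play of the other players: their actions may be random and may depend on the whole
  past, but not on the sample that player \<open>i\<close> draws in the same round.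
\<close>

definition arbitrary_opponents ::
    "'w measure \<Rightarrow> (nat \<Rightarrow> 'w measure) \<Rightarrow> ('n \<Rightarrow> (real ^ 'd) set) \<Rightarrow> 'n \<Rightarrow>
     (nat \<Rightarrow> 'w \<Rightarrow> real ^ 'd ^ 'n) \<Rightarrow> bool" where
  "arbitrary_opponents M F A i a \<longleftrightarrow>
     (\<forall>t. \<forall>j. j \<noteq> i \<longrightarrow>
        (\<lambda>\<omega>. a t \<omega> $ j) \<in> borel_measurable (F t) \<and> (\<forall>\<omega>\<in>space M. a t \<omega> $ j \<in> A j))"

text \<open>
  The run of the payoff-based algorithm of player \<open>i\<close>. The condition involving
  \<open>real_cond_exp\<close> says that the conditional law of the sample \<open>\<xi> t\<close> given \<open>F t\<close> is the normal
  distribution with mean \<open>\<mu> t\<close> and standard deviation \<open>\<sigma> t\<close>; the cost of player \<open>i\<close> enters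
  the update only through the received payoff \<open>J i (a t \<omega>)\<close>.
\<close>

definition payoff_based_run ::
    "'w measure \<Rightarrow> (nat \<Rightarrow> 'w measure) \<Rightarrow>
     ('n \<Rightarrow> (real ^ 'd) set) \<Rightarrow> ('n \<Rightarrow> real ^ 'd ^ 'n \<Rightarrow> real) \<Rightarrow> 'n \<Rightarrow>
     (nat \<Rightarrow> real) \<Rightarrow> (nat \<Rightarrow> real) \<Rightarrow> (nat \<Rightarrow> real) \<Rightarrow> (nat \<Rightarrow> real) \<Rightarrow> real ^ 'd \<Rightarrow>
     (nat \<Rightarrow> 'w \<Rightarrow> real ^ 'd) \<Rightarrow> (nat \<Rightarrow> 'w \<Rightarrow> real ^ 'd) \<Rightarrow> (nat \<Rightarrow> 'w \<Rightarrow> real ^ 'd ^ 'n) \<Rightarrow> bool" where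
  "payoff_based_run M F A J i \<gamma> \<sigma> \<epsilon> \<rho> \<mu>0 \<mu> \<xi> a \<longleftrightarrow>
     (\<forall>\<omega>\<in>space M. \<mu> 0 \<omega> = \<mu>0) \<and>
     (\<forall>t. \<xi> t \<in> borel_measurable (F (Suc t)) \<and>
        (\<forall>S\<in>sets borel. AE \<omega> in M.
           real_cond_exp M (F t) (\<lambda>\<omega>. indicator S (\<xi> t \<omega>)) \<omega> =
           measure (normal_vec (\<mu> t \<omega>) (\<sigma> t)) S) \<and>
        (\<forall>\<omega>\<in>space M.
           a t \<omega> $ i = closest_point (A i) (\<xi> t \<omega>) \<and>
           (let m = (J i (a t \<omega>) / (\<sigma> t)\<^sup>2) *\<^sub>R (\<xi> t \<omega> - \<mu> t \<omega>) in
            \<mu> (Suc t) \<omega> =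
              closest_point (shrunk (\<rho> t) (A i)) (\<mu> t \<omega> - \<gamma> t *\<^sub>R (m + \<epsilon> t *\<^sub>R \<mu> t \<omega>)))))"

text \<open>The regret along one realised sequence of joint actions.\<close>

definition regret ::
    "('n \<Rightarrow> real ^ 'd ^ 'n \<Rightarrow> real) \<Rightarrow> 'n \<Rightarrow> (nat \<Rightarrow> real ^ 'd ^ 'n) \<Rightarrow> nat \<Rightarrow> real ^ 'd \<Rightarrow> real" where
  "regret J i a T x = (\<Sum>t=1..T. J i (a t)) - (\<Sum>t=1..T. J i (with_action i x (a t)))"

definition no_regret ::
    "('n \<Rightarrow> (real ^ 'd) set) \<Rightarrow> ('n \<Rightarrow> real ^ 'd ^ 'n \<Rightarrow> real) \<Rightarrow> 'n \<Rightarrow>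
     (nat \<Rightarrow> real ^ 'd ^ 'n) \<Rightarrow> bool" where
  "no_regret A J i a \<longleftrightarrow>
     (\<forall>x\<in>A i. limsup (\<lambda>T. ereal (regret J i a T x / real T)) \<le> 0)"

text \<open>
  The parameters have exactly the stated polynomial order where the algorithm needs it: with an
  upper bound alone, \<open>\<gamma> = 0\<close> would be allowed and the algorithm would never move. Monotonicity of
  the stepsizes is also needed: an opponent can exploit stepsizes that alternate between
  \<open>1 / t powr g\<close> and \<open>2 / t powr g\<close>. The powers \<open>\<gamma> t = c / t powr g\<close> are covered.
\<close>

definition admissible_parameters ::
    "(nat \<Rightarrow> real) \<Rightarrow> (nat \<Rightarrow> real) \<Rightarrow> (nat \<Rightarrow> real) \<Rightarrow> (nat \<Rightarrow> real) \<Rightarrow>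
     real \<Rightarrow> real \<Rightarrow> real \<Rightarrow> real \<Rightarrow> bool" where
  "admissible_parameters \<gamma> \<sigma> \<epsilon> \<rho> g s e r \<longleftrightarrow>
     (\<forall>t. \<gamma> t > 0 \<and> \<sigma> t > 0 \<and> 0 \<le> \<rho> t \<and> \<rho> t < 1) \<and>
     (\<forall>\<^sub>F t in sequentially. \<gamma> (Suc t) \<le> \<gamma> t) \<and>
     \<gamma> \<in> \<Theta>(\<lambda>t. 1 / real t powr g) \<and>
     \<sigma> \<in> \<Theta>(\<lambda>t. 1 / real t powr s) \<and>
     \<epsilon> \<in> O(\<lambda>t. 1 / real t powr e) \<and>
     \<rho> \<in> \<Theta>(\<lambda>t. 1 / real t powr r)"

end

theory Submission
  imports Defs
begin

text \<open>
  Fix the opponents' actions in one round, and let \<open>f\<close> be the cost of player \<open>i\<close> as a function of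
  its own action, \<open>A\<close> its action set, \<open>P\<close> the projection onto \<open>A\<close>, and \<open>z\<close> a standard Gaussian
  vector, so that the sample is \<open>\<mu> + \<sigma> z\<close>. Given the past, the player receives \<open>f (P (\<mu> + \<sigma> z))\<close>
  and forms the one-point gradient estimate \<open>m = f (P (\<mu> + \<sigma> z)) z / \<sigma>\<close>. Everything rests on one
  inequality, valid for every \<open>x \<in> A\<close> with a constant that does not depend on the opponents:
  \<open>E [f (P (\<mu> + \<sigma> z)) - \<langle>m, \<mu> - x\<rangle>] \<le> f x + O(\<sigma>\<^sup>2)\<close>.

  To see it, let \<open>h\<close> be the supremum of the tangents of \<open>f\<close> at the points of \<open>A\<close>. It is convex,
  equals \<open>f\<close> on \<open>A\<close>, lies below \<open>f\<close> everywhere, and grows linearly, uniformly in the opponents'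
  actions. The Gaussian smoothing of a convex function is convex, and its gradient is again an
  expectation against \<open>z / \<sigma>\<close>; this gives
  \<open>E [h (\<mu> + \<sigma> z) (1 - \<langle>z, \<mu> - x\<rangle> / \<sigma>)] \<le> E [h (x + \<sigma> z)]\<close> (\<open>gaussian_smoothing_convex\<close>). The
  right-hand side is at most \<open>f x + O(\<sigma>\<^sup>2)\<close>, since at \<open>x\<close> the function \<open>h\<close> lies below its tangent
  plus a quadratic and the linear part averages out. Finally \<open>f (P (\<mu> + \<sigma> z))\<close> and \<open>h (\<mu> + \<sigma> z)\<close>
  differ only if the sample leaves \<open>A\<close>; as \<open>\<mu>\<close> keeps a distance of order \<open>t powr - r\<close> from the
  boundary while \<open>\<sigma>\<close> is of order \<open>t powr - s\<close> with \<open>s > r\<close>, this costs less than any power of \<open>t\<close>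
  (\<open>perturbed_payoff_first_order_bound\<close>).

  In one round the regret is therefore at most a martingale difference, plus \<open>O(\<sigma>\<^sup>2)\<close>, plus
  \<open>\<langle>m, \<mu> - x\<rangle>\<close>, and the last term is the subject of the usual analysis of projected gradient
  steps: a telescoping part that sums to \<open>O(1 / \<gamma> T) = O(T powr g)\<close> because the stepsizes decrease,
  a part \<open>\<gamma> |m|\<^sup>2\<close> with mean at most of order \<open>\<gamma> / \<sigma>\<^sup>2\<close>, that is \<open>t powr - (g - 2 * s)\<close>, and a part of order
  \<open>\<epsilon>\<close>. A reference point on the boundary of \<open>A\<close> is outside the shrunk set (once \<open>\<rho> > 0\<close>) onto which the algorithm
  projects. It is replaced by a point that is moved towards the interior by an exact multiple of
  \<open>t powr - r\<close>; the displacement is then monotone in \<open>t\<close>, so that these moving comparators still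
  telescope. A reference point in the interior need not be moved, whence the indicator in the bound.
  The result is \<open>regret_decomposition\<close>.

  In expectation the martingale vanishes, which gives the rate. For the almost sure statement, let
  \<open>N\<close> be the martingale and \<open>Q\<close> the sum of the \<open>\<gamma> |m|\<^sup>2\<close>. The means of \<open>(N / T)\<^sup>2\<close> and \<open>Q / T\<close> are
  bounded by a negative power of \<open>T\<close>, hence summable along the horizons \<open>T = k ^ q\<close> for large \<open>q\<close>,
  and both quantities tend to \<open>0\<close> along them. Since the regret changes by a bounded amount per
  round, this controls it at all horizons, for one reference point. A countable dense set of
  reference points is enough, because the regret per round is Lipschitz in the reference point.
\<close>

section \<open>Integration against the standard Gaussian vector\<close>

lemma normal_vec_std_density:
  "normal_vec (0 :: real ^ 'd) 1 =
     density lborel (\<lambda>x. ennreal (\<Prod>b\<in>Basis. std_normal_density (x \<bullet> b)))"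
proof -
  have "1 / (sqrt (2 * pi) * 1) ^ CARD('d) * exp (- (\<Sum>k\<in>UNIV. (x $ k - (0 :: real ^ 'd) $ k)\<^sup>2 / (2 * 1\<^sup>2)))
      = (\<Prod>b\<in>Basis. std_normal_density (x \<bullet> b))" for x :: "real ^ 'd"
  proof -
    have B: "(Basis :: (real ^ 'd) set) = (\<lambda>k. axis k 1) ` UNIV"
      by (auto simp: Basis_vec_def)
    have inj: "inj (\<lambda>k :: 'd. axis k (1 :: real))"
      by (auto simp: inj_on_def axis_eq_axis)
    have "(\<Prod>b\<in>Basis. std_normal_density (x \<bullet> b)) = (\<Prod>k\<in>UNIV. std_normal_density (x $ k))"
      unfolding B by (subst prod.reindex[OF inj]) (simp add: inner_axis)
    also have "\<dots> = 1 / (sqrt (2 * pi)) ^ CARD('d) * exp (\<Sum>k\<in>UNIV. - (x $ k)\<^sup>2 / 2)"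
      by (simp add: std_normal_density_def prod.distrib exp_sum prod_dividef power_one_over)
    also have "(\<Sum>k\<in>UNIV. - (x $ k)\<^sup>2 / 2) = - (\<Sum>k\<in>UNIV. (x $ k - (0 :: real ^ 'd) $ k)\<^sup>2 / (2 * 1\<^sup>2))"
      by (simp add: sum_negf)
    finally show ?thesis by simp
  qed
  then show ?thesis unfolding normal_vec_def by simp
qed

lemma sets_normal_vec [simp, measurable_cong]: "sets (normal_vec m s) = sets borel"
  by (simp add: normal_vec_def)

lemma space_normal_vec [simp]: "space (normal_vec m s) = UNIV"
  by (simp add: normal_vec_def)

text \<open>
  Lebesgue measure on a Euclidean space is by construction an image of the product of the
  one-dimensional ones, so integrals of products over the coordinates factorize.
\<close>

lemma std_normal_integral_prod:
  fixes g :: "real ^ 'd \<Rightarrow> real \<Rightarrow> real"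
  assumes g: "\<And>b. b \<in> Basis \<Longrightarrow> integrable lborel (\<lambda>x. std_normal_density x * g b x)"
    and [measurable]: "\<And>b. b \<in> Basis \<Longrightarrow> g b \<in> borel_measurable borel"
  shows "integrable (normal_vec (0 :: real ^ 'd) 1) (\<lambda>z. \<Prod>b\<in>Basis. g b (z \<bullet> b))"
    and "(\<integral>z. (\<Prod>b\<in>Basis. g b (z \<bullet> b)) \<partial>normal_vec (0 :: real ^ 'd) 1) =
         (\<Prod>b\<in>Basis. \<integral>x. std_normal_density x * g b x \<partial>lborel)"
proof -
  interpret product_sigma_finite "\<lambda>_ :: real ^ 'd. lborel :: real measure" ..
  let ?T = "\<lambda>f :: real ^ 'd \<Rightarrow> real. \<Sum>b\<in>Basis. f b *\<^sub>R b"
  let ?G = "\<lambda>z :: real ^ 'd. \<Prod>b\<in>Basis. std_normal_density (z \<bullet> b) * g b (z \<bullet> b)"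
  have T: "?T \<in> measurable (\<Pi>\<^sub>M b\<in>Basis. lborel) borel" by measurable
  have comp: "?G (?T f) = (\<Prod>b\<in>Basis. std_normal_density (f b) * g b (f b))" for f
    by (intro prod.cong refl) (simp add: inner_sum_left inner_Basis if_distrib cong: if_cong)
  have G: "?G \<in> borel_measurable borel" by measurable
  have lb: "(lborel :: (real ^ 'd) measure) = distr (\<Pi>\<^sub>M b\<in>Basis. lborel) borel ?T"
    by (rule lborel_eq)
  have i: "integrable lborel ?G"
    unfolding lb by (subst integrable_distr_eq[OF T G], unfold comp)
      (rule product_integrable_prod, auto intro: g)
  have e: "integral\<^sup>L lborel ?G = (\<Prod>b\<in>Basis. \<integral>x. std_normal_density x * g b x \<partial>lborel)"
    unfolding lb by (subst integral_distr[OF T G], unfold comp)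
      (rule product_integral_prod, auto intro: g)
  have sp: "0 \<le> (\<Prod>b\<in>Basis. std_normal_density (z \<bullet> b))" for z :: "real ^ 'd"
    by (intro prod_nonneg) auto
  show "integrable (normal_vec (0 :: real ^ 'd) 1) (\<lambda>z. \<Prod>b\<in>Basis. g b (z \<bullet> b))"
    unfolding normal_vec_std_density
    by (subst integrable_density) (use i sp in \<open>auto simp: prod.distrib\<close>)
  show "(\<integral>z. (\<Prod>b\<in>Basis. g b (z \<bullet> b)) \<partial>normal_vec (0 :: real ^ 'd) 1) =
         (\<Prod>b\<in>Basis. \<integral>x. std_normal_density x * g b x \<partial>lborel)"
    unfolding normal_vec_std_density
    by (subst integral_density) (use e sp in \<open>auto simp: prod.distrib\<close>)
qed

lemma prob_space_std_normal: "prob_space (normal_vec (0 :: real ^ 'd) 1)"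
proof
  have "(\<integral>\<^sup>+x. ennreal (std_normal_density x) \<partial>lborel) = 1"
    using prob_space.emeasure_space_1[OF prob_space_normal_density[of 1 0]]
    by (simp add: emeasure_density)
  moreover have "(\<integral>\<^sup>+x. (\<Prod>b\<in>Basis. ennreal (std_normal_density (x \<bullet> b))) \<partial>(lborel :: (real ^ 'd) measure))
      = (\<Prod>b\<in>(Basis :: (real ^ 'd) set). \<integral>\<^sup>+x. ennreal (std_normal_density x) \<partial>lborel)"
    by (rule nn_integral_lborel_prod) auto
  ultimately show "emeasure (normal_vec (0 :: real ^ 'd) 1) (space (normal_vec (0 :: real ^ 'd) 1)) = 1"
    unfolding normal_vec_std_density
    by (simp add: emeasure_density prod_ennreal[symmetric] del: prod_ennreal)
qed

text \<open>
  Reduces all Gaussian laws to the standard one, which allows the mean to depend on the past while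
  the source of randomness does not.
\<close>

lemma normal_vec_affine:
  assumes "s > 0"
  shows "normal_vec (m :: real ^ 'd) s = distr (normal_vec 0 1) borel (\<lambda>z. m + s *\<^sub>R z)"
proof -
  let ?f = "\<lambda>z. m + s *\<^sub>R z"
  let ?D = "\<lambda>m s x. 1 / (sqrt (2 * pi) * s) ^ CARD('d) * exp (- (\<Sum>k\<in>UNIV. (x $ k - m $ k)\<^sup>2 / (2 * s\<^sup>2))) :: real"
  have D: "?D m s (?f x) * s ^ CARD('d) = ?D 0 1 x" for x
    using assms by (simp add: power_mult_distrib field_simps)
  have m[measurable]: "?D m s \<in> borel_measurable borel" for m s by measurable
  have "normal_vec m s = density (density (distr lborel borel ?f) (\<lambda>_. \<bar>s\<bar>^DIM(real ^ 'd))) (\<lambda>x. ennreal (?D m s x))"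
    unfolding normal_vec_def using assms lborel_affine[of s m] by simp
  also have "\<dots> = density (distr lborel borel ?f) (\<lambda>x. ennreal (s ^ CARD('d)) * ennreal (?D m s x))"
    using assms by (subst density_density_eq) (auto simp: ennreal_power)
  also have "\<dots> = distr (density lborel (\<lambda>x. ennreal (s ^ CARD('d)) * ennreal (?D m s (?f x)))) borel ?f"
    by (subst density_distr) auto
  also have "(\<lambda>x. ennreal (s ^ CARD('d)) * ennreal (?D m s (?f x))) = (\<lambda>x. ennreal (?D 0 1 x))"
    using assms by (subst D[symmetric]) (simp add: ennreal_mult'[symmetric] mult.commute fun_eq_iff)
  finally show ?thesis unfolding normal_vec_def .
qed

lemma integrable_std_normal_exp_abs:
  "integrable lborel (\<lambda>x. std_normal_density x * exp \<bar>x\<bar>)"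
proof -
  have eq: "std_normal_density x * exp (c * x) = exp (1/2) * normal_density c 1 x" if "c\<^sup>2 = 1" for c x :: real
    unfolding std_normal_density_def normal_density_def using that
    by (simp add: exp_add[symmetric] power2_diff algebra_simps add_divide_distrib diff_divide_distrib)
  have "integrable lborel (\<lambda>x. std_normal_density x * exp (c * x))" if "c\<^sup>2 = 1" for c
    unfolding eq[OF that] by auto
  from this[of 1] this[of "-1"]
  have "integrable lborel (\<lambda>x. std_normal_density x * exp x + std_normal_density x * exp (- x))"
    by (intro Bochner_Integration.integrable_add) auto
  then show ?thesis
  proof (rule Bochner_Integration.integrable_bound)
    have "std_normal_density x * exp \<bar>x\<bar> \<le> std_normal_density x * exp x + std_normal_density x * exp (- x)" for x
      by (cases "x \<ge> 0") (auto)
    then show "AE x in lborel. norm (std_normal_density x * exp \<bar>x\<bar>)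
        \<le> norm (std_normal_density x * exp x + std_normal_density x * exp (- x))"
      by (auto intro!: AE_I2)
  qed auto
qed

text \<open>
  A power of the norm is dominated by a multiple of \<open>exp\<close> of the sum of the absolute coordinates, which
  is a product over the coordinates.
\<close>

lemma integrable_std_normal_poly_growth:
  fixes h :: "real ^ 'd \<Rightarrow> real"
  assumes [measurable]: "h \<in> borel_measurable borel"
    and h: "\<And>z. \<bar>h z\<bar> \<le> C * (1 + norm z) ^ k"
  shows "integrable (normal_vec 0 1) h"
proof -
  have C: "0 \<le> C" using h[of 0] by simp
  have "integrable (normal_vec (0 :: real ^ 'd) 1) (\<lambda>z. \<Prod>b\<in>Basis. exp \<bar>z \<bullet> b\<bar>)"
    by (rule std_normal_integral_prod(1)) (auto intro: integrable_std_normal_exp_abs)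
  then have "integrable (normal_vec (0 :: real ^ 'd) 1) (\<lambda>z. (C * real k ^ k * exp 1) * (\<Prod>b\<in>Basis. exp \<bar>z \<bullet> b\<bar>))"
    by (rule integrable_mult_right)
  then show ?thesis
  proof (rule Bochner_Integration.integrable_bound)
    have "\<bar>h z\<bar> \<le> C * real k ^ k * exp 1 * (\<Prod>b\<in>Basis. exp \<bar>z \<bullet> b\<bar>)" for z
    proof -
      have "(1 + norm z) ^ k \<le> real k ^ k * exp (1 + norm z)"
      proof (cases "k = 0")
        case False
        have "((1 + norm z) / real k) ^ k \<le> exp ((1 + norm z) / real k) ^ k"
          using exp_ge_add_one_self[of "(1 + norm z) / real k"] by (intro power_mono) (auto simp del: exp_ge_add_one_self)
        also have "\<dots> = exp (1 + norm z)"
          using False by (simp add: exp_of_nat_mult[symmetric])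
        finally show ?thesis using False by (simp add: power_divide divide_le_eq mult.commute)
      qed simp
      also have "\<dots> \<le> real k ^ k * exp (1 + (\<Sum>b\<in>Basis. \<bar>z \<bullet> b\<bar>))"
        by (intro mult_left_mono) (auto simp: norm_le_l1)
      finally have "C * (1 + norm z) ^ k \<le> C * (real k ^ k * exp (1 + (\<Sum>b\<in>Basis. \<bar>z \<bullet> b\<bar>)))"
        using C by (rule mult_left_mono)
      with h[of z] show ?thesis by (simp add: exp_add exp_sum mult.assoc)
    qed
    then show "AE z in normal_vec 0 1. norm (h z) \<le> norm (C * real k ^ k * exp 1 * (\<Prod>b\<in>Basis. exp \<bar>z \<bullet> b\<bar>))"
      using C by (auto simp: prod_nonneg)
  qed simp
qed

lemma integrable_std_normal_inner: "integrable (normal_vec (0 :: real ^ 'd) 1) (\<lambda>z. inner z u)"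
  by (rule integrable_std_normal_poly_growth[where C="norm u" and k=1])
     (auto intro!: order_trans[OF Cauchy_Schwarz_ineq2] simp: algebra_simps)

lemma integrable_std_normal_inner_mult:
  "integrable (normal_vec (0 :: real ^ 'd) 1) (\<lambda>z. inner z u * inner z v)"
proof (rule integrable_std_normal_poly_growth[where C="norm u * norm v" and k=2])
  show "\<bar>inner z u * inner z v\<bar> \<le> norm u * norm v * (1 + norm z)\<^sup>2" for z :: "real ^ 'd"
  proof -
    have "\<bar>inner z u * inner z v\<bar> \<le> (norm z * norm u) * (norm z * norm v)"
      unfolding abs_mult by (intro mult_mono Cauchy_Schwarz_ineq2) auto
    also have "\<dots> = norm u * norm v * (norm z)\<^sup>2" by (simp add: power2_eq_square)
    also have "\<dots> \<le> norm u * norm v * (1 + norm z)\<^sup>2"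
      by (intro mult_left_mono power_mono) auto
    finally show ?thesis .
  qed
qed simp

lemma std_normal_mean_zero: "(\<integral>z. inner z a \<partial>normal_vec (0 :: real ^ 'd) 1) = 0"
proof -
  have coord: "(\<integral>z. inner z b \<partial>normal_vec (0 :: real ^ 'd) 1) = 0" if b: "b \<in> Basis" for b
  proof -
    let ?g = "\<lambda>c x. if c = b then x else 1 :: real"
    have i: "integrable lborel (\<lambda>x. std_normal_density x * ?g c x)" for c
      using integrable_std_normal_moment[of 1] integrable_std_normal_moment[of 0] by (cases "c = b") auto
    have "(\<integral>z. (\<Prod>c\<in>Basis. ?g c (z \<bullet> c)) \<partial>normal_vec (0 :: real ^ 'd) 1) =
         (\<Prod>c\<in>Basis. \<integral>x. std_normal_density x * ?g c x \<partial>lborel)"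
      by (rule std_normal_integral_prod(2)) (use i in auto)
    also have "\<dots> = 0"
      using b integral_std_normal_moment_odd[of 0] by (intro prod_zero bexI[of _ b]) auto
    finally show ?thesis using b by (simp add: prod.delta)
  qed
  have "(\<integral>z. inner z a \<partial>normal_vec (0 :: real ^ 'd) 1) = (\<integral>z. (\<Sum>b\<in>Basis. inner z b * inner a b) \<partial>normal_vec (0 :: real ^ 'd) 1)"
    by (simp add: euclidean_inner[symmetric])
  also have "\<dots> = (\<Sum>b\<in>Basis. (\<integral>z. inner z b \<partial>normal_vec (0 :: real ^ 'd) 1) * inner a b)"
    by (subst Bochner_Integration.integral_sum)
       (auto intro!: integrable_mult_left integrable_std_normal_inner)
  finally show ?thesis by (simp add: coord)
qed

lemma std_normal_covariance:
  "(\<integral>z. inner z a * inner z b \<partial>normal_vec (0 :: real ^ 'd) 1) = inner a b"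
proof -
  let ?N = "normal_vec (0 :: real ^ 'd) 1"
  have coord: "(\<integral>z. inner z u * inner z v \<partial>?N) = (if u = v then 1 else 0)"
    if u: "u \<in> Basis" and v: "v \<in> Basis" for u v
  proof -
    let ?g = "\<lambda>c x. (if c = u then x else 1) * (if c = v then x else 1 :: real)"
    have i: "integrable lborel (\<lambda>x. std_normal_density x * ?g c x)" for c
    proof -
      have "integrable lborel (\<lambda>x. std_normal_density x * x)" "integrable lborel (\<lambda>x. std_normal_density x * (x * x))"
        using integrable_std_normal_moment[of 1] integrable_std_normal_moment[of 2] by (simp_all add: power2_eq_square)
      then show ?thesis by (cases "c = u"; cases "c = v") simp_all
    qed
    have one: "(\<integral>x. std_normal_density x * (x * x) \<partial>lborel) = 1" "(\<integral>x. std_normal_density x \<partial>lborel) = 1"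
      using integral_std_normal_moment_even[of 1] integral_std_normal_moment_even[of 0]
      by (simp_all add: power2_eq_square)
    have "(\<integral>z. (\<Prod>c\<in>Basis. ?g c (z \<bullet> c)) \<partial>?N) = (\<Prod>c\<in>Basis. \<integral>x. std_normal_density x * ?g c x \<partial>lborel)"
      by (rule std_normal_integral_prod(2)) (use i in auto)
    also have "\<dots> = (if u = v then 1 else 0)"
    proof (cases "u = v")
      case True
      have "(\<integral>x. std_normal_density x * ?g c x \<partial>lborel) = 1" for c
        using True one by (cases "c = v") simp_all
      then show ?thesis using True by simp
    next
      case False
      have z: "(\<integral>x. std_normal_density x * ?g u x \<partial>lborel) = 0"
        using False integral_std_normal_moment_odd[of 0] by auto
      have "(\<Prod>c\<in>Basis. \<integral>x. std_normal_density x * ?g c x \<partial>lborel) = 0"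
        by (rule prod_zero[OF finite_Basis bexI[of _ u]]) (fact z, fact u)
      then show ?thesis using False by simp
    qed
    finally show ?thesis using u v by (simp add: prod.distrib prod.delta)
  qed
  have "(\<integral>z. inner z a * inner z b \<partial>?N) =
      (\<integral>z. (\<Sum>u\<in>Basis. \<Sum>v\<in>Basis. (inner a u * inner b v) * (inner z u * inner z v)) \<partial>?N)"
    by (subst (1 2) euclidean_inner) (simp add: sum_product mult_ac)
  also have "\<dots> = (\<Sum>u\<in>Basis. \<Sum>v\<in>Basis. (inner a u * inner b v) * (\<integral>z. inner z u * inner z v \<partial>?N))"
    by (simp add: Bochner_Integration.integral_sum integrable_std_normal_inner_mult)
  also have "\<dots> = (\<Sum>u\<in>Basis. \<Sum>v\<in>Basis. (inner a u * inner b v) * (if u = v then 1 else 0))"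
    by (intro sum.cong refl) (simp add: coord)
  also have "\<dots> = inner a b" by (simp add: euclidean_inner[of a b] if_distrib cong: if_cong)
  finally show ?thesis .
qed

text \<open>
  The Cameron--Martin formula: moving the mean amounts to an exponential density. It turns derivatives
  in the mean into moments against \<open>z\<close>, without differentiating under the integral.
\<close>

lemma normal_vec_tilt:
  "normal_vec (w :: real ^ 'd) 1 = density (normal_vec 0 1) (\<lambda>z. ennreal (exp (inner z w - (norm w)\<^sup>2 / 2)))"
proof -
  let ?D = "\<lambda>m x. 1 / (sqrt (2 * pi) * 1) ^ CARD('d) * exp (- (\<Sum>k\<in>UNIV. (x $ k - m $ k)\<^sup>2 / (2 * 1\<^sup>2))) :: real"
  have [measurable]: "?D m \<in> borel_measurable borel" for m by measurable
  have D: "?D w x = ?D 0 x * exp (inner x w - (norm w)\<^sup>2 / 2)" for x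
  proof -
    have "(\<Sum>k\<in>UNIV. (x $ k - w $ k)\<^sup>2 / 2) = (\<Sum>k\<in>UNIV. (x $ k)\<^sup>2 / 2) - (inner x w - (norm w)\<^sup>2 / 2)"
      unfolding inner_vec_def power2_norm_eq_inner
      by (simp add: power2_eq_square algebra_simps sum.distrib sum_subtractf sum_divide_distrib
          add_divide_distrib diff_divide_distrib)
    then show ?thesis by (simp add: exp_add[symmetric] exp_diff)
  qed
  have "ennreal (?D w x) = ennreal (?D 0 x) * ennreal (exp (inner x w - (norm w)\<^sup>2 / 2))" for x
    unfolding D by (rule ennreal_mult') simp
  note eq = this
  have "density lborel (\<lambda>x. ennreal (?D w x)) =
      density lborel (\<lambda>x. ennreal (?D 0 x) * ennreal (exp (inner x w - (norm w)\<^sup>2 / 2)))"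
    by (simp only: eq)
  also have "\<dots> = density (density lborel (\<lambda>x. ennreal (?D 0 x))) (\<lambda>x. ennreal (exp (inner x w - (norm w)\<^sup>2 / 2)))"
    by (rule density_density_eq[symmetric]) measurable
  finally show ?thesis unfolding normal_vec_def .
qed

lemma integrable_gaussian_perturbation:
  fixes k :: "real ^ 'd \<Rightarrow> real"
  assumes [measurable]: "k \<in> borel_measurable borel"
    and k: "\<And>y. \<bar>k y\<bar> \<le> C * (1 + norm y)" and s: "s \<ge> 0"
    and [measurable]: "q \<in> borel_measurable borel" and q: "\<And>z. \<bar>q z\<bar> \<le> C' * (1 + norm z) ^ j"
  shows "integrable (normal_vec 0 1) (\<lambda>z. k (m + s *\<^sub>R z) * q z)"
proof (rule integrable_std_normal_poly_growth)
  show "\<bar>k (m + s *\<^sub>R z) * q z\<bar> \<le> (C * (1 + norm m + s) * C') * (1 + norm z) ^ Suc j" for z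
  proof -
    have C: "0 \<le> C" "0 \<le> C'" using k[of 0] q[of 0] by auto
    have "1 + norm (m + s *\<^sub>R z) \<le> 1 + norm m + s * norm z"
      using norm_triangle_ineq[of m "s *\<^sub>R z"] s by simp
    also have "\<dots> \<le> (1 + norm m + s) * (1 + norm z)"
      using s by (simp add: algebra_simps)
    finally have "C * (1 + norm (m + s *\<^sub>R z)) \<le> C * ((1 + norm m + s) * (1 + norm z))"
      using C by (intro mult_left_mono)
    then have "\<bar>k (m + s *\<^sub>R z)\<bar> \<le> C * ((1 + norm m + s) * (1 + norm z))" using k[of "m + s *\<^sub>R z"] by simp
    then have "\<bar>k (m + s *\<^sub>R z)\<bar> * \<bar>q z\<bar> \<le> (C * ((1 + norm m + s) * (1 + norm z))) * (C' * (1 + norm z) ^ j)"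
      using q[of z] C s by (intro mult_mono) auto
    then show ?thesis by (simp add: abs_mult mult_ac)
  qed
qed measurable

text \<open>
  The first-order inequality of the convex function \<open>y \<mapsto> E [k (y + s z)]\<close> between \<open>m\<close> and \<open>x\<close>, with its
  gradient at \<open>m\<close> written as a Gaussian moment. Convexity bounds the smoothing at the point that divides
  the segment from \<open>m\<close> to \<open>x\<close> in the ratio \<open>e\<close>; by the change of mean, that value is an expectation
  at \<open>m\<close> against an exponential weight, estimated from below by \<open>exp u \<ge> 1 + u\<close> as \<open>k \<ge> 0\<close>.
  Dividing by \<open>e\<close> and letting \<open>e\<close> tend to \<open>0\<close> gives the claim.
\<close>

lemma gaussian_smoothing_convex:
  fixes k :: "real ^ 'd \<Rightarrow> real"
  assumes conv: "convex_on UNIV k" and nn: "\<And>y. 0 \<le> k y" and k: "\<And>y. \<bar>k y\<bar> \<le> C * (1 + norm y)"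
    and s: "s > 0"
  shows "(\<integral>z. k (m + s *\<^sub>R z) \<partial>normal_vec 0 1) + (\<integral>z. k (m + s *\<^sub>R z) * inner z (x - m) \<partial>normal_vec 0 1) / s
     \<le> (\<integral>z. k (x + s *\<^sub>R z) \<partial>normal_vec 0 1)"
proof -
  let ?N = "normal_vec (0 :: real ^ 'd) 1"
  have [measurable]: "k \<in> borel_measurable borel"
    using convex_on_continuous[OF open_UNIV conv] by (rule borel_measurable_continuous_onI)
  define v where "v = (x - m) /\<^sub>R s"
  have v: "m + (e * s) *\<^sub>R v = m + e *\<^sub>R (x - m)" for e using s by (simp add: v_def)
  have i1: "integrable ?N (\<lambda>z. k (y + s *\<^sub>R z))" for y
    using integrable_gaussian_perturbation[OF _ k less_imp_le[OF s], of "\<lambda>_. 1" 1 0 y] by simp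
  have i2: "integrable ?N (\<lambda>z. k (y + s *\<^sub>R z) * inner z v)" for y
  proof (rule integrable_gaussian_perturbation[OF _ k less_imp_le[OF s], of "\<lambda>z. inner z v" "norm v" 1 y])
    show "\<bar>inner z v\<bar> \<le> norm v * (1 + norm z) ^ 1" for z
    proof -
      have "\<bar>inner z v\<bar> \<le> norm v * norm z"
        using Cauchy_Schwarz_ineq2[of z v] by (simp only: mult.commute)
      also have "\<dots> \<le> norm v * (1 + norm z) ^ 1" by (intro mult_left_mono) auto
      finally show ?thesis .
    qed
  qed auto
  define I where "I = (\<integral>z. k (m + s *\<^sub>R z) \<partial>?N)"
  define D where "D = (\<integral>z. k (m + s *\<^sub>R z) * inner z v \<partial>?N)"
  define X where "X = (\<integral>z. k (x + s *\<^sub>R z) \<partial>?N)"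
  have ineq: "D - e * ((norm v)\<^sup>2 / 2 * I) \<le> X - I" if e: "0 < e" "e \<le> 1" for e
  proof -
    define w where "w = e *\<^sub>R v"
    have tilt: "integral\<^sup>L ?N (\<lambda>z. k (m + s *\<^sub>R (w + z))) =
        integral\<^sup>L ?N (\<lambda>z. exp (inner z w - (norm w)\<^sup>2 / 2) * k (m + s *\<^sub>R z))"
      and tilt_i: "integrable ?N (\<lambda>z. exp (inner z w - (norm w)\<^sup>2 / 2) * k (m + s *\<^sub>R z))"
    proof -
      have "integral\<^sup>L (normal_vec w 1) (\<lambda>z. k (m + s *\<^sub>R z)) = integral\<^sup>L ?N (\<lambda>z. k (m + s *\<^sub>R (w + 1 *\<^sub>R z)))"
        by (subst normal_vec_affine) (simp_all add: integral_distr)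
      moreover have "integral\<^sup>L (normal_vec w 1) (\<lambda>z. k (m + s *\<^sub>R z)) =
         integral\<^sup>L ?N (\<lambda>z. exp (inner z w - (norm w)\<^sup>2 / 2) * k (m + s *\<^sub>R z))"
        by (subst normal_vec_tilt, subst integral_density) auto
      ultimately show "integral\<^sup>L ?N (\<lambda>z. k (m + s *\<^sub>R (w + z))) =
         integral\<^sup>L ?N (\<lambda>z. exp (inner z w - (norm w)\<^sup>2 / 2) * k (m + s *\<^sub>R z))" by simp
      have "integrable ?N (\<lambda>z. k (m + s *\<^sub>R (w + 1 *\<^sub>R z)))"
        using i1[of "m + s *\<^sub>R w"] by (simp add: scaleR_add_right add.assoc)
      then have "integrable (normal_vec w 1) (\<lambda>z. k (m + s *\<^sub>R z))"
        by (subst normal_vec_affine) (simp_all add: integrable_distr_eq)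
      then show "integrable ?N (\<lambda>z. exp (inner z w - (norm w)\<^sup>2 / 2) * k (m + s *\<^sub>R z))"
        unfolding normal_vec_tilt[of w] by (subst (asm) integrable_density) auto
    qed
    have "I + e * D - e\<^sup>2 * ((norm v)\<^sup>2 / 2 * I) =
        integral\<^sup>L ?N (\<lambda>z. k (m + s *\<^sub>R z) + e * (k (m + s *\<^sub>R z) * inner z v) - e\<^sup>2 * (norm v)\<^sup>2 / 2 * k (m + s *\<^sub>R z))"
      using i1[of m] i2[of m] by (simp add: I_def D_def)
    also have "\<dots> \<le> integral\<^sup>L ?N (\<lambda>z. exp (inner z w - (norm w)\<^sup>2 / 2) * k (m + s *\<^sub>R z))"
    proof (rule integral_mono)
      fix z
      have "(1 + (inner z w - (norm w)\<^sup>2 / 2)) * k (m + s *\<^sub>R z) \<le> exp (inner z w - (norm w)\<^sup>2 / 2) * k (m + s *\<^sub>R z)"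
        by (intro mult_right_mono nn exp_ge_add_one_self)
      then show "k (m + s *\<^sub>R z) + e * (k (m + s *\<^sub>R z) * inner z v) - e\<^sup>2 * (norm v)\<^sup>2 / 2 * k (m + s *\<^sub>R z)
          \<le> exp (inner z w - (norm w)\<^sup>2 / 2) * k (m + s *\<^sub>R z)"
        by (simp add: w_def power_mult_distrib algebra_simps)
    qed (use i1[of m] i2[of m] tilt_i in auto)
    also have "\<dots> = integral\<^sup>L ?N (\<lambda>z. k (m + s *\<^sub>R (w + z)))" using tilt by simp
    also have "\<dots> \<le> integral\<^sup>L ?N (\<lambda>z. (1 - e) * k (m + s *\<^sub>R z) + e * k (x + s *\<^sub>R z))"
    proof (rule integral_mono)
      fix z
      have "m + s *\<^sub>R (w + z) = (1 - e) *\<^sub>R (m + s *\<^sub>R z) + e *\<^sub>R (x + s *\<^sub>R z)"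
        using v[of e] by (simp add: w_def algebra_simps)
      then show "k (m + s *\<^sub>R (w + z)) \<le> (1 - e) * k (m + s *\<^sub>R z) + e * k (x + s *\<^sub>R z)"
        using convex_onD[OF conv, of e "m + s *\<^sub>R z" "x + s *\<^sub>R z"] e by simp
    qed (use i1[of m] i1[of x] i1[of "m + s *\<^sub>R w"] in \<open>auto simp: scaleR_add_right add.assoc\<close>)
    also have "\<dots> = I - e * I + e * X"
      using i1[of m] i1[of x] by (simp add: I_def X_def algebra_simps)
    finally have "e * (D - e * ((norm v)\<^sup>2 / 2 * I)) \<le> e * (X - I)"
      by (simp add: algebra_simps power2_eq_square)
    then show ?thesis using e by simp
  qed
  have "D \<le> X - I"
  proof (rule tendsto_upperbound)
    show "((\<lambda>e. D - e * ((norm v)\<^sup>2 / 2 * I)) \<longlongrightarrow> D) (at_right 0)"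
      by (auto intro!: tendsto_eq_intros)
    show "\<forall>\<^sub>F e in at_right 0. D - e * ((norm v)\<^sup>2 / 2 * I) \<le> X - I"
      using ineq by (auto simp: eventually_at_right[of 0 1] intro!: exI[of _ 1])
  qed simp
  moreover have "D = (\<integral>z. k (m + s *\<^sub>R z) * inner z (x - m) \<partial>?N) / s"
  proof -
    have "k (m + s *\<^sub>R z) * inner z v = k (m + s *\<^sub>R z) * inner z (x - m) / s" for z
      by (simp add: v_def divide_inverse)
    then show ?thesis unfolding D_def by simp
  qed
  ultimately show ?thesis by (simp add: I_def X_def)
qed

section \<open>First-order inequality for Gaussian perturbations of a convex cost\<close>

text \<open>
  The inequality that drives the regret bound, see the introduction. The factor
  \<open>1 - inner z (m - x) / s\<close> combines the realized cost and the gradient estimate in direction \<open>m - x\<close>,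
  so that the two are compared with \<open>f x\<close> in a single step. The last summand pays for samples outside
  \<open>A\<close>: they have \<open>s * norm z \<ge> \<rho>\<close>, and Markov's inequality with the \<open>p\<close>-th moment applies.
\<close>

lemma perturbed_payoff_first_order_bound:
  fixes f :: "real ^ 'd \<Rightarrow> real" and G :: "real ^ 'd \<Rightarrow> real ^ 'd"
  assumes A: "compact A" "convex A"
    and f: "continuous_on UNIV f"
    and tangent: "\<And>x y. x \<in> A \<Longrightarrow> f x + inner (G x) (y - x) \<le> f y"
    and smooth: "\<And>x y. x \<in> A \<Longrightarrow> norm (y - x) \<le> 1 \<Longrightarrow> f y \<le> f x + inner (G x) (y - x) + K * (norm (y - x))\<^sup>2"
    and B: "\<And>x. x \<in> A \<Longrightarrow> \<bar>f x\<bar> \<le> B" and L: "\<And>x. x \<in> A \<Longrightarrow> norm (G x) \<le> L"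
    and R: "\<And>x. x \<in> A \<Longrightarrow> norm x \<le> R" and K: "0 \<le> K"
    and m: "m \<in> A" and x: "x \<in> A" and s: "0 < s" "s \<le> 1"
    and \<rho>: "0 < \<rho>" "ball m \<rho> \<subseteq> A"
  shows "(\<integral>z. f (closest_point A (m + s *\<^sub>R z)) * (1 - inner z (m - x) / s) \<partial>normal_vec 0 1)
    \<le> f x + (K + 2 * L) * (\<integral>z. (norm (z :: real ^ 'd))\<^sup>2 \<partial>normal_vec 0 1) * s\<^sup>2
      + (2 * B + 2 * L * R + L) * (1 + 2 * R) * (\<integral>z. (1 + norm (z :: real ^ 'd)) ^ (p + 2) \<partial>normal_vec 0 1)
        * (s / \<rho>) ^ p / s"
proof -
  let ?N = "normal_vec (0 :: real ^ 'd) 1"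
  have ne: "A \<noteq> {}" using m by auto
  have cl: "closed A" using A compact_imp_closed by blast
  have L0: "0 \<le> L" using L[OF m] norm_ge_zero order_trans by blast
  have B0: "0 \<le> B" using B[OF m] abs_ge_zero order_trans by blast
  have R0: "0 \<le> R" using R[OF m] norm_ge_zero order_trans by blast
  define T where "T z y = f z + inner (G z) (y - z)" for z y
  \<comment> \<open>The upper envelope \<open>h\<close> of the tangents agrees with \<open>f\<close> on \<open>A\<close> and grows linearly. Subtracting
    the tangent at \<open>m\<close> makes it nonnegative; on the tangent itself all integrals are explicit.\<close>
  define h where "h y = (SUP z\<in>A. T z y)" for y
  define k where "k y = h y - T m y" for y
  define M where "M = B + L * R + L"
  have M0: "0 \<le> M" using L0 B0 R0 by (simp add: M_def)
  have Tf: "T z y \<le> f y" if "z \<in> A" for z y using tangent[OF that] by (simp add: T_def)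
  have bdd: "bdd_above ((\<lambda>z. T z y) ` A)" for y using Tf by (intro bdd_aboveI2) auto
  have Th: "T z y \<le> h y" if "z \<in> A" for z y unfolding h_def by (rule cSUP_upper[OF that bdd])
  have hI: "h y \<le> c" if "\<And>z. z \<in> A \<Longrightarrow> T z y \<le> c" for y c
    unfolding h_def using ne that by (rule cSUP_least)
  have hf: "h y \<le> f y" for y using Tf by (rule hI)
  have hA: "h y = f y" if "y \<in> A" for y using hf[of y] Th[OF that, of y] by (simp add: T_def)
  have absT: "\<bar>T z y\<bar> \<le> B + L * R + L * norm y" if z: "z \<in> A" for z y
  proof -
    have "\<bar>inner (G z) (y - z)\<bar> \<le> norm (G z) * norm (y - z)" by (rule Cauchy_Schwarz_ineq2)
    also have "\<dots> \<le> L * (norm y + R)"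
      using L[OF z] R[OF z] norm_triangle_ineq4[of y z] L0 by (intro mult_mono) auto
    finally show ?thesis using B[OF z] by (simp add: T_def algebra_simps)
  qed
  have absh: "\<bar>h y\<bar> \<le> B + L * R + L * norm y" for y
    using absT[of _ y] Th[OF m, of y] absT[OF m, of y] hI[of y "B + L * R + L * norm y"] by fastforce
  have k0: "0 \<le> k y" for y using Th[OF m] by (simp add: k_def)
  have absk: "\<bar>k y\<bar> \<le> (2 * M) * (1 + norm y)" for y
  proof -
    have "\<bar>k y\<bar> \<le> 2 * (B + L * R + L * norm y)" using absh[of y] absT[OF m, of y] by (simp add: k_def)
    also have "\<dots> \<le> (2 * M) * (1 + norm y)"
      using B0 L0 R0 by (simp add: M_def algebra_simps)
    finally show ?thesis .
  qed
  have convk: "convex_on UNIV k"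
  proof (intro convex_onI)
    fix t :: real and y1 y2 :: "real ^ 'd" assume t: "0 < t" "t < 1"
    have "T z ((1 - t) *\<^sub>R y1 + t *\<^sub>R y2) = (1 - t) * T z y1 + t * T z y2" for z
      by (simp add: T_def algebra_simps inner_add_right inner_diff_right)
    moreover from this have "h ((1 - t) *\<^sub>R y1 + t *\<^sub>R y2) \<le> (1 - t) * h y1 + t * h y2"
      using Th t by (intro hI) (auto intro!: add_mono mult_left_mono)
    ultimately show "k ((1 - t) *\<^sub>R y1 + t *\<^sub>R y2) \<le> (1 - t) * k y1 + t * k y2"
      by (simp add: k_def algebra_simps)
  qed simp
  \<comment> \<open>Near \<open>x\<close> the bound follows from \<open>h \<le> f\<close> and the smoothness of \<open>f\<close>, far from \<open>x\<close> from linear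
    growth, as \<open>norm (y - x)\<close> is then at most its square.\<close>
  have hquad: "h y \<le> f x + inner (G x) (y - x) + (K + 2 * L) * (norm (y - x))\<^sup>2" for y
  proof (cases "norm (y - x) \<le> 1")
    case True
    have "K * (norm (y - x))\<^sup>2 \<le> (K + 2 * L) * (norm (y - x))\<^sup>2" using L0 by (intro mult_right_mono) auto
    then show ?thesis using smooth[OF x True] hf[of y] by simp
  next
    case False
    have "T z y \<le> f x + L * norm (y - x)" if z: "z \<in> A" for z
    proof -
      have "T z y = T z x + inner (G z) (y - x)" by (simp add: T_def inner_diff_right)
      moreover have "inner (G z) (y - x) \<le> L * norm (y - x)"
        using norm_cauchy_schwarz[of "G z" "y - x"] mult_right_mono[OF L[OF z] norm_ge_zero[of "y - x"]] by linarith
      ultimately show ?thesis using Tf[OF z, of x] by simp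
    qed
    then have "h y \<le> f x + L * norm (y - x)" by (rule hI)
    moreover have "- inner (G x) (y - x) \<le> L * norm (y - x)"
      using norm_cauchy_schwarz[of "- G x" "y - x"] mult_right_mono[OF L[OF x] norm_ge_zero[of "y - x"]] by auto
    moreover have "(2 * L) * (norm (y - x) * 1) \<le> (2 * L) * (norm (y - x) * norm (y - x))"
      using False L0 by (intro mult_left_mono) auto
    moreover have "0 \<le> K * (norm (y - x))\<^sup>2" using K by simp
    ultimately show ?thesis by (simp add: power2_eq_square algebra_simps)
  qed
  have [measurable]: "k \<in> borel_measurable borel"
    using convex_on_continuous[OF open_UNIV convk] by (rule borel_measurable_continuous_onI)
  have [measurable]: "f \<in> borel_measurable borel"
    using f by (rule borel_measurable_continuous_onI)
  have [measurable]: "closest_point A \<in> borel_measurable borel"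
    using continuous_on_closest_point[OF A(2) cl ne] by (intro borel_measurable_continuous_onI)
  have ml: "(\<lambda>y. T z y) \<in> borel_measurable borel" for z unfolding T_def by measurable
  note [measurable] = ml
  have h_eq: "h = (\<lambda>y. k y + T m y)" by (simp add: k_def)
  have [measurable]: "h \<in> borel_measurable borel" unfolding h_eq by measurable
  define W where "W z = 1 - inner z (m - x) / s" for z
  have [measurable]: "W \<in> borel_measurable borel" unfolding W_def by measurable
  have W: "\<bar>W z\<bar> \<le> ((1 + 2 * R) / s) * (1 + norm z)" for z
  proof -
    have "norm (m - x) \<le> 2 * R"
      using norm_triangle_ineq4[of m x] R[OF m] R[OF x] by linarith
    then have "norm z * norm (m - x) \<le> norm z * (2 * R)" by (intro mult_left_mono) auto
    then have "\<bar>inner z (m - x)\<bar> \<le> norm z * (2 * R)"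
      using Cauchy_Schwarz_ineq2[of z "m - x"] by linarith
    moreover have "\<bar>W z\<bar> \<le> 1 + \<bar>inner z (m - x)\<bar> / s"
      using s unfolding W_def by (metis abs_divide abs_of_pos abs_one abs_triangle_ineq4)
    ultimately have "\<bar>W z\<bar> \<le> 1 + norm z * (2 * R) / s"
      using s by (smt (verit) divide_right_mono)
    also have "\<dots> \<le> 1 / s + norm z * (2 * R) / s" using s by simp
    also have "\<dots> \<le> ((1 + 2 * R) / s) * (1 + norm z)"
      using s R0 by (simp add: field_simps)
    finally show ?thesis .
  qed
  have W1: "\<bar>W z\<bar> \<le> ((1 + 2 * R) / s) * (1 + norm z) ^ 1" for z using W by simp
  have ik: "integrable ?N (\<lambda>z. k (y + s *\<^sub>R z))" for y
    using integrable_gaussian_perturbation[OF _ absk less_imp_le[OF s(1)], of "\<lambda>_. 1" 1 0 y] by simp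
  have ikW: "integrable ?N (\<lambda>z. k (y + s *\<^sub>R z) * W z)" for y
    by (rule integrable_gaussian_perturbation[OF _ absk less_imp_le[OF s(1)] _ W1]) auto
  have absT': "\<bar>T m y\<bar> \<le> M * (1 + norm y)" for y
    using absT[OF m, of y] B0 L0 R0 by (simp add: M_def algebra_simps) (smt (verit) mult_nonneg_nonneg norm_ge_zero)
  have iTW: "integrable ?N (\<lambda>z. T m (y + s *\<^sub>R z) * W z)" for y
    by (rule integrable_gaussian_perturbation[OF _ absT' less_imp_le[OF s(1)] _ W1]) auto
  have ihW: "integrable ?N (\<lambda>z. h (m + s *\<^sub>R z) * W z)"
    unfolding h_eq using ikW[of m] iTW[of m] by (simp add: distrib_right)
  note il = integrable_std_normal_inner[where 'd='d] and il2 = integrable_std_normal_inner_mult[where 'd='d]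
  have i2: "integrable ?N (\<lambda>z. (norm z)\<^sup>2)"
    by (rule integrable_std_normal_poly_growth[where C=1 and k=2]) (auto intro!: power_mono)
  interpret N: prob_space ?N by (rule prob_space_std_normal)
  have step1: "(\<integral>z. k (m + s *\<^sub>R z) * W z \<partial>?N) \<le> (\<integral>z. k (x + s *\<^sub>R z) \<partial>?N)"
  proof -
    have e: "k (m + s *\<^sub>R z) * W z = k (m + s *\<^sub>R z) + k (m + s *\<^sub>R z) * inner z (x - m) / s" for z
      using s by (simp add: W_def inner_diff_right field_simps)
    have "integrable ?N (\<lambda>z. k (m + s *\<^sub>R z) * W z - k (m + s *\<^sub>R z))" using ik ikW by auto
    then have "integrable ?N (\<lambda>z. k (m + s *\<^sub>R z) * inner z (x - m) / s)" unfolding e by simp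
    then have "(\<integral>z. k (m + s *\<^sub>R z) * W z \<partial>?N) = (\<integral>z. k (m + s *\<^sub>R z) \<partial>?N) + (\<integral>z. k (m + s *\<^sub>R z) * inner z (x - m) \<partial>?N) / s"
      unfolding e using ik[of m] by simp
    then show ?thesis using gaussian_smoothing_convex[OF convk k0 absk s(1)] by simp
  qed
  have step2: "(\<integral>z. k (x + s *\<^sub>R z) \<partial>?N) \<le> f x - T m x + (K + 2 * L) * (\<integral>z. (norm z)\<^sup>2 \<partial>?N) * s\<^sup>2"
  proof -
    have "(\<integral>z. k (x + s *\<^sub>R z) \<partial>?N) \<le>
       (\<integral>z. (f x - T m x) + s * inner z (G x - G m) + ((K + 2 * L) * s\<^sup>2) * (norm z)\<^sup>2 \<partial>?N)"
    proof (rule integral_mono)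
      fix z
      have "k (x + s *\<^sub>R z) \<le> f x + inner (G x) (s *\<^sub>R z) + (K + 2 * L) * (norm (s *\<^sub>R z))\<^sup>2 - T m (x + s *\<^sub>R z)"
        using hquad[of "x + s *\<^sub>R z"] by (simp add: k_def)
      also have "\<dots> = (f x - T m x) + s * inner z (G x - G m) + ((K + 2 * L) * s\<^sup>2) * (norm z)\<^sup>2"
        by (simp add: T_def inner_add_right inner_diff_right power_mult_distrib inner_commute algebra_simps)
      finally show "k (x + s *\<^sub>R z) \<le> (f x - T m x) + s * inner z (G x - G m) + ((K + 2 * L) * s\<^sup>2) * (norm z)\<^sup>2" .
    qed (use ik[of x] il i2 in auto)
    also have "\<dots> = f x - T m x + (K + 2 * L) * (\<integral>z. (norm z)\<^sup>2 \<partial>?N) * s\<^sup>2"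
      using il i2 by (simp add: std_normal_mean_zero N.prob_space[simplified] mult_ac)
    finally show ?thesis .
  qed
  have step3: "(\<integral>z. T m (m + s *\<^sub>R z) * W z \<partial>?N) = T m x"
  proof -
    have "T m (m + s *\<^sub>R z) * W z = f m + s * inner z (G m) - (f m / s) * inner z (m - x) - inner z (G m) * inner z (m - x)" for z
      using s by (simp add: T_def W_def field_simps inner_commute)
    then have "(\<integral>z. T m (m + s *\<^sub>R z) * W z \<partial>?N) = f m - inner (G m) (m - x)"
      using il il2 by (simp add: std_normal_mean_zero std_normal_covariance N.prob_space[simplified])
    then show ?thesis by (simp add: T_def inner_diff_right)
  qed
  have main: "(\<integral>z. h (m + s *\<^sub>R z) * W z \<partial>?N) \<le> f x + (K + 2 * L) * (\<integral>z. (norm z)\<^sup>2 \<partial>?N) * s\<^sup>2"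
  proof -
    have "(\<integral>z. h (m + s *\<^sub>R z) * W z \<partial>?N) = (\<integral>z. k (m + s *\<^sub>R z) * W z \<partial>?N) + (\<integral>z. T m (m + s *\<^sub>R z) * W z \<partial>?N)"
      unfolding h_eq using ikW[of m] iTW[of m] by (simp add: distrib_right)
    then show ?thesis using step1 step2 step3 by simp
  qed
  let ?P = "\<lambda>z. closest_point A (m + s *\<^sub>R z)"
  let ?C = "(2 * B + 2 * L * R + L) * (1 + 2 * R)"
  have P: "?P z \<in> A" for z using closest_point_in_set[OF cl ne] .
  have ifW: "integrable ?N (\<lambda>z. f (?P z) * W z)"
  proof (rule integrable_std_normal_poly_growth[where k=1])
    show "\<bar>f (?P z) * W z\<bar> \<le> B * ((1 + 2 * R) / s) * (1 + norm z) ^ 1" for z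
      unfolding abs_mult mult.assoc using B[OF P] W[of z] B0 by (intro mult_mono) auto
  qed measurable
  have iM: "integrable ?N (\<lambda>z. (1 + norm z) ^ (p + 2))"
    by (rule integrable_std_normal_poly_growth[where C=1 and k="p+2"]) auto
  \<comment> \<open>The integrands agree unless the sample leaves \<open>A\<close>, and then \<open>1 \<le> ((s / \<rho>) * (1 + norm z)) ^ p\<close>.\<close>
  have err: "(\<integral>z. f (?P z) * W z \<partial>?N) - (\<integral>z. h (m + s *\<^sub>R z) * W z \<partial>?N)
     \<le> ?C * (\<integral>z. (1 + norm z) ^ (p + 2) \<partial>?N) * (s / \<rho>) ^ p / s"
  proof -
    have "(\<integral>z. f (?P z) * W z \<partial>?N) - (\<integral>z. h (m + s *\<^sub>R z) * W z \<partial>?N) = (\<integral>z. f (?P z) * W z - h (m + s *\<^sub>R z) * W z \<partial>?N)"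
      using ifW ihW by simp
    also have "\<dots> \<le> (\<integral>z. (?C * (s / \<rho>) ^ p / s) * (1 + norm z) ^ (p + 2) \<partial>?N)"
    proof (rule integral_mono)
      fix z
      show "f (?P z) * W z - h (m + s *\<^sub>R z) * W z \<le> (?C * (s / \<rho>) ^ p / s) * (1 + norm z) ^ (p + 2)"
      proof (cases "s * norm z < \<rho>")
        case True
        then have "m + s *\<^sub>R z \<in> A" using \<rho> s by (intro subsetD[OF \<rho>(2)]) (simp add: dist_norm)
        then have "f (?P z) = h (m + s *\<^sub>R z)" using hA closest_point_self by metis
        then show ?thesis using B0 L0 R0 s \<rho> by simp
      next
        case False
        have "L * norm (m + s *\<^sub>R z) \<le> L * (R + norm z)"
          using norm_triangle_ineq[of m "s *\<^sub>R z"] R[OF m] s mult_right_mono[of s 1 "norm z"] L0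
          by (intro mult_left_mono) auto
        then have "\<bar>f (?P z) - h (m + s *\<^sub>R z)\<bar> \<le> 2 * B + 2 * L * R + L * norm z"
          using absh[of "m + s *\<^sub>R z"] B[OF P[of z]] by (simp add: algebra_simps)
        also have "\<dots> \<le> (2 * B + 2 * L * R + L) * (1 + norm z)"
          using B0 L0 R0 by (simp add: algebra_simps)
        finally have a: "\<bar>f (?P z) - h (m + s *\<^sub>R z)\<bar> \<le> (2 * B + 2 * L * R + L) * (1 + norm z)" .
        have "1 ^ p \<le> ((s / \<rho>) * (1 + norm z)) ^ p"
        proof (intro power_mono)
          have "1 \<le> (s / \<rho>) * norm z" using False \<rho> by (simp add: field_simps)
          also have "\<dots> \<le> (s / \<rho>) * (1 + norm z)" using s \<rho> by (intro mult_left_mono) auto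
          finally show "1 \<le> (s / \<rho>) * (1 + norm z)" .
        qed simp
        then have b: "1 \<le> (s / \<rho>) ^ p * (1 + norm z) ^ p" by (simp only: power_mult_distrib power_one)
        have "f (?P z) * W z - h (m + s *\<^sub>R z) * W z \<le> \<bar>f (?P z) - h (m + s *\<^sub>R z)\<bar> * \<bar>W z\<bar>"
          by (metis abs_ge_self abs_mult left_diff_distrib)
        also have "\<dots> \<le> ((2 * B + 2 * L * R + L) * (1 + norm z)) * (((1 + 2 * R) / s) * (1 + norm z))"
          using a W[of z] B0 L0 R0 by (intro mult_mono) auto
        also have "\<dots> = (?C / s * (1 + norm z)\<^sup>2) * 1" by (simp add: power2_eq_square)
        also have "\<dots> \<le> (?C / s * (1 + norm z)\<^sup>2) * ((s / \<rho>) ^ p * (1 + norm z) ^ p)"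
          using b B0 L0 R0 s by (intro mult_left_mono) auto
        also have "\<dots> = (?C * (s / \<rho>) ^ p / s) * (1 + norm z) ^ (p + 2)"
          by (simp only: power_add power2_eq_square divide_inverse mult_ac)
        finally show ?thesis .
      qed
    qed (use ifW ihW iM in auto)
    also have "\<dots> = ?C * (\<integral>z. (1 + norm z) ^ (p + 2) \<partial>?N) * (s / \<rho>) ^ p / s"
      by (subst integral_mult_right_zero) (simp only: divide_inverse mult_ac)
    finally show ?thesis .
  qed
  show ?thesis using main err unfolding W_def by simp
qed

section \<open>Convexity and smoothness in the player's own action\<close>

lemma with_action_nth [simp]:
  "with_action i x a $ j = (if j = i then x else a $ j)"
  by (simp add: with_action_def)

lemma with_action_with_action [simp]: "with_action i x (with_action i y a) = with_action i x a"
  by (simp add: vec_eq_iff)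

lemma with_action_same [simp]: "with_action i (a $ i) a = a"
  by (simp add: vec_eq_iff)

lemma with_action_diff: "with_action i x a - with_action i y a = with_action i (x - y) 0"
  by (simp add: vec_eq_iff)

lemma norm_with_action_0 [simp]: "norm (with_action i x (0 :: real ^ 'd ^ 'n)) = norm x"
proof -
  have "(norm (with_action i x (0 :: real ^ 'd ^ 'n) $ j))\<^sup>2 = (if j = i then (norm x)\<^sup>2 else 0)" for j
    by simp
  then show ?thesis unfolding norm_vec_def[of "with_action i x 0"] L2_set_def by simp
qed

lemma with_action_has_derivative:
  "((\<lambda>y. with_action i y (a :: real ^ 'd ^ 'n)) has_derivative (\<lambda>h. with_action i h 0)) (at x)"
proof -
  have lin: "bounded_linear (\<lambda>h :: real ^ 'd. with_action i h (0 :: real ^ 'd ^ 'n))"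
    by (rule bounded_linear_intro[where K=1]) (auto simp: vec_eq_iff)
  have "(\<lambda>y. with_action i y a) = (\<lambda>y. with_action i 0 a + with_action i y 0)"
    by (auto simp: fun_eq_iff vec_eq_iff)
  then show ?thesis
    using has_derivative_add[OF has_derivative_const bounded_linear_imp_has_derivative[OF lin], of "with_action i 0 a" "at x"] by simp
qed

text \<open>
  Riesz representation of the derivative; it also gives uniqueness, so that the definite description
  in the definition of the gradient is meaningful.
\<close>

lemma gderiv_gradient:
  fixes f :: "'a :: euclidean_space \<Rightarrow> real"
  assumes "(f has_derivative f') (at x)"
  shows "GDERIV f x :> gradient f x"
proof -
  interpret bounded_linear f' using assms by (rule has_derivative_bounded_linear)
  define D where "D = (\<Sum>b\<in>Basis. f' b *\<^sub>R b)"
  have "f' h = inner h D" for h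
  proof -
    have "f' h = f' (\<Sum>b\<in>Basis. (h \<bullet> b) *\<^sub>R b)" by (simp add: euclidean_representation)
    also have "\<dots> = (\<Sum>b\<in>Basis. (h \<bullet> b) * f' b)" by (simp add: sum scale)
    also have "\<dots> = inner h D" by (simp add: D_def inner_sum_right mult.commute)
    finally show ?thesis .
  qed
  then have "f' = (\<lambda>h. inner h D)" by blast
  then have D: "GDERIV f x :> D" using assms by (simp add: gderiv_def)
  have "E = D" if "GDERIV f x :> E" for E
  proof -
    have "(\<lambda>h. inner h E) = (\<lambda>h. inner h D)"
      using that D unfolding gderiv_def by (rule has_derivative_unique)
    then have "inner (E - D) (E - D) = 0" by (auto simp: inner_diff_right dest: fun_cong)
    then show ?thesis by simp
  qed
  then show ?thesis unfolding gradient_def using D by (rule_tac theI) auto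
qed

lemma convex_above_gradient_tangent:
  fixes f :: "'a :: euclidean_space \<Rightarrow> real"
  assumes conv: "convex_on UNIV f" and D: "GDERIV f x :> D"
  shows "f x + inner D (y - x) \<le> f y"
proof -
  let ?g = "\<lambda>t :: real. f (x + t *\<^sub>R (y - x))"
  have g: "convex_on UNIV ?g"
  proof (intro convex_onI)
    fix t u v :: real assume "0 < t" "t < 1"
    moreover have "x + ((1 - t) *\<^sub>R u + t *\<^sub>R v) *\<^sub>R (y - x) =
      (1 - t) *\<^sub>R (x + u *\<^sub>R (y - x)) + t *\<^sub>R (x + v *\<^sub>R (y - x))"
      by (simp add: algebra_simps)
    ultimately show "?g ((1 - t) *\<^sub>R u + t *\<^sub>R v) \<le> (1 - t) * ?g u + t * ?g v"
      using convex_onD[OF conv, of t] by simp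
  qed simp
  have D': "(f has_derivative (\<lambda>h. inner h D)) (at (x + 0 *\<^sub>R (y - x)))"
    using D by (simp add: gderiv_def)
  have "(?g has_derivative (\<lambda>h. inner (h *\<^sub>R (y - x)) D)) (at 0)"
    by (rule has_derivative_compose[where f="\<lambda>t. x + t *\<^sub>R (y - x)" and g=f, OF _ D']) (auto intro!: derivative_eq_intros)
  then have "(?g has_real_derivative inner (y - x) D) (at 0)"
    by (simp add: has_field_derivative_def mult_commute_abs)
  from convex_on_imp_above_tangent[OF g _ _ _ this, of 1]
  have "?g 1 - ?g 0 \<ge> inner (y - x) D" by simp
  then show ?thesis by (simp add: inner_commute)
qed

lemma continuously_differentiable_imp_continuous:
  "continuously_differentiable f \<Longrightarrow> continuous_on UNIV f"
  unfolding continuously_differentiable_def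
  by (meson has_derivative_continuous continuous_at_imp_continuous_on)

lemma continuously_differentiable_lipschitz_cball:
  fixes f :: "'a :: euclidean_space \<Rightarrow> 'b :: real_normed_vector"
  assumes "continuously_differentiable f"
  obtains K where "K \<ge> 0" "\<And>x y. x \<in> cball 0 r \<Longrightarrow> y \<in> cball 0 r \<Longrightarrow> norm (f x - f y) \<le> K * norm (x - y)"
proof -
  obtain f' :: "'a \<Rightarrow> 'a \<Rightarrow>\<^sub>L 'b"
    where f': "\<And>x. (f has_derivative blinfun_apply (f' x)) (at x)" "continuous_on UNIV f'"
    using assms unfolding continuously_differentiable_def by blast
  have "compact (f' ` cball 0 r)"
    using f'(2) by (intro compact_continuous_image) (auto intro: continuous_on_subset)
  then obtain K where K: "\<And>x. x \<in> cball 0 r \<Longrightarrow> norm (f' x) \<le> K"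
    using compact_imp_bounded bounded_iff by (metis image_eqI)
  show thesis
  proof (rule that[of "max 0 K"])
    fix x y :: 'a assume xy: "x \<in> cball 0 r" "y \<in> cball 0 r"
    show "norm (f x - f y) \<le> max 0 K * norm (x - y)"
    proof (rule differentiable_bound[of "cball 0 r"])
      show "onorm (blinfun_apply (f' z)) \<le> max 0 K" if "z \<in> cball 0 r" for z
        using K[OF that] by (simp add: norm_blinfun.rep_eq)
    qed (use xy f'(1) in \<open>auto intro: has_derivative_at_withinI\<close>)
  qed simp
qed

lemma own_gradient:
  fixes J :: "'n :: finite \<Rightarrow> real ^ 'd :: finite ^ 'n \<Rightarrow> real"
  assumes "convex_game A J"
  shows "GDERIV (\<lambda>y. J i (with_action i y a)) x :> pseudo_gradient J (with_action i x a) $ i"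
proof -
  obtain f' :: "real ^ 'd ^ 'n \<Rightarrow> (real ^ 'd ^ 'n) \<Rightarrow>\<^sub>L real" where
    f': "\<And>x. (J i has_derivative blinfun_apply (f' x)) (at x)"
    using assms unfolding convex_game_def continuously_differentiable_def by blast
  have "((\<lambda>y. J i (with_action i y a)) has_derivative (\<lambda>h. blinfun_apply (f' (with_action i x a)) (with_action i h 0))) (at x)"
    by (rule has_derivative_compose[OF with_action_has_derivative f'])
  from gderiv_gradient[OF this] show ?thesis by (simp add: pseudo_gradient_def)
qed

lemma own_tangent:
  assumes "convex_game A J"
  shows "J i (with_action i x a) + inner (pseudo_gradient J (with_action i x a) $ i) (y - x) \<le> J i (with_action i y a)"
  using assms own_gradient[OF assms, of i a x] unfolding convex_game_def
  by (intro convex_above_gradient_tangent) auto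

lemma bounded_joint_actions:
  fixes A :: "'n :: finite \<Rightarrow> (real ^ 'd :: finite) set"
  assumes "convex_game A J"
  obtains r where "\<And>a i y. a \<in> joint_actions A \<Longrightarrow> (\<exists>x\<in>A i. norm (y - x) \<le> 1) \<Longrightarrow> with_action i y a \<in> cball 0 r"
proof -
  have "\<exists>R. \<forall>j. \<forall>x\<in>A j. norm x \<le> R j"
    using assms unfolding convex_game_def by (intro choice) (metis compact_imp_bounded bounded_iff)
  then obtain R where R: "\<And>j x. x \<in> A j \<Longrightarrow> norm x \<le> R j" by blast
  define S where "S = (\<Sum>j\<in>UNIV. \<bar>R j\<bar>)"
  have S: "R j \<le> S" for j
    using member_le_sum[of j UNIV "\<lambda>j. \<bar>R j\<bar>"] by (auto simp: S_def)
  show thesis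
  proof (rule that[of "real CARD('n) * (S + 1)"])
    fix a i y assume a: "a \<in> joint_actions A" and y: "\<exists>x\<in>A i. norm (y - x) \<le> 1"
    from y obtain x where x: "x \<in> A i" "norm (y - x) \<le> 1" by blast
    have "norm (with_action i y a $ j) \<le> S + 1" for j
      using a R[of "a $ j" j] S[of j] R[OF x(1)] S[of i] x(2) norm_triangle_sub[of y x]
      by (auto simp: joint_actions_def)
    then have "norm (with_action i y a) \<le> (\<Sum>j\<in>(UNIV :: 'n set). S + 1)"
      unfolding norm_vec_def[of "with_action i y a"]
      by (intro order_trans[OF L2_set_le_sum] sum_mono) auto
    then show "with_action i y a \<in> cball 0 (real CARD('n) * (S + 1))" by simp
  qed
qed

text \<open>
  All constants come from compactness of one ball in the space of joint actions that contains every
  joint action of the game together with all unit displacements of player \<open>i\<close>. In this way they do not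
  depend on what the opponents play. The quadratic upper bound combines the tangent inequality at
  \<open>y\<close> with the Lipschitz continuity of the pseudo-gradient.
\<close>

lemma uniform_payoff_bounds:
  fixes A :: "'n :: finite \<Rightarrow> (real ^ 'd :: finite) set"
  assumes game: "convex_game A J" and smooth: "continuously_differentiable (pseudo_gradient J)"
  obtains B L K R where "0 \<le> B" "0 \<le> L" "0 \<le> K" "0 \<le> R"
    "\<And>x. x \<in> A i \<Longrightarrow> norm x \<le> R"
    "\<And>a. a \<in> joint_actions A \<Longrightarrow> \<bar>J i a\<bar> \<le> B"
    "\<And>a. a \<in> joint_actions A \<Longrightarrow> norm (pseudo_gradient J a $ i) \<le> L"
    "\<And>a x y. a \<in> joint_actions A \<Longrightarrow> x \<in> A i \<Longrightarrow> norm (y - x) \<le> 1 \<Longrightarrow>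
       J i (with_action i y a) \<le> J i (with_action i x a)
         + inner (pseudo_gradient J (with_action i x a) $ i) (y - x) + K * (norm (y - x))\<^sup>2"
proof -
  obtain r where r: "\<And>a i y. a \<in> joint_actions A \<Longrightarrow> (\<exists>x\<in>A i. norm (y - x) \<le> 1) \<Longrightarrow> with_action i y a \<in> cball 0 r"
    using bounded_joint_actions[OF game] by metis
  have jr: "a \<in> cball 0 r" if "a \<in> joint_actions A" for a
    using r[OF that, of i "a $ i"] that by (force simp: joint_actions_def)
  obtain K where K: "0 \<le> K" "\<And>x y. x \<in> cball 0 r \<Longrightarrow> y \<in> cball 0 r \<Longrightarrow>
      norm (pseudo_gradient J x - pseudo_gradient J y) \<le> K * norm (x - y)"
    using continuously_differentiable_lipschitz_cball[OF smooth] by blast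
  have bdd: "\<exists>b\<ge>0. \<forall>x\<in>S. norm (f x) \<le> b" if "compact S" "continuous_on S f"
    for S and f :: "'x :: topological_space \<Rightarrow> 'y :: real_normed_vector"
  proof -
    from compact_continuous_image[OF that(2,1)] obtain b where "\<forall>y\<in>f ` S. norm y \<le> b"
      using compact_imp_bounded bounded_iff by metis
    then show ?thesis by (intro exI[of _ "max 0 b"]) auto
  qed
  have "continuous_on (cball 0 r) (J i)" "continuous_on (cball 0 r) (pseudo_gradient J)"
    using game smooth continuously_differentiable_imp_continuous
    unfolding convex_game_def by (blast intro: continuous_on_subset)+
  then obtain B L where B: "0 \<le> B" "\<And>a. a \<in> cball 0 r \<Longrightarrow> norm (J i a) \<le> B"
    and L: "0 \<le> L" "\<And>a. a \<in> cball 0 r \<Longrightarrow> norm (pseudo_gradient J a) \<le> L"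
    using bdd[OF compact_cball, of 0 r "J i"] bdd[OF compact_cball, of 0 r "pseudo_gradient J"] by blast
  have "compact (A i)" using game by (simp add: convex_game_def)
  then obtain R where R: "0 \<le> R" "\<And>x. x \<in> A i \<Longrightarrow> norm x \<le> R"
    using bdd[of "A i" "\<lambda>x. x"] by auto
  show thesis
  proof (rule that[OF B(1) L(1) K(1) R])
    show "\<bar>J i a\<bar> \<le> B" if "a \<in> joint_actions A" for a using B(2)[OF jr[OF that]] by simp
    show "norm (pseudo_gradient J a $ i) \<le> L" if "a \<in> joint_actions A" for a
      using L(2)[OF jr[OF that]] Finite_Cartesian_Product.norm_nth_le[of "pseudo_gradient J a" i] by linarith
    fix a x y assume a: "a \<in> joint_actions A" and x: "x \<in> A i" and y: "norm (y - x) \<le> 1"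
    let ?G = "\<lambda>y. pseudo_gradient J (with_action i y a) $ i"
    have "norm (?G y - ?G x) \<le> norm (pseudo_gradient J (with_action i y a) - pseudo_gradient J (with_action i x a))"
      by (metis Finite_Cartesian_Product.norm_nth_le vector_minus_component)
    also have "\<dots> \<le> K * norm (with_action i y a - with_action i x a)"
      using x y by (intro K r a) (auto intro!: bexI[of _ x])
    finally have "norm (?G y - ?G x) \<le> K * norm (y - x)" by (simp add: with_action_diff)
    then have "inner (?G y - ?G x) (y - x) \<le> K * norm (y - x) * norm (y - x)"
      by (rule order_trans[OF norm_cauchy_schwarz mult_right_mono]) simp
    moreover have "J i (with_action i y a) + inner (?G y) (x - y) \<le> J i (with_action i x a)"
      by (rule own_tangent[OF game])
    ultimately show "J i (with_action i y a) \<le> J i (with_action i x a) + inner (?G x) (y - x) + K * (norm (y - x))\<^sup>2"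
      by (simp add: inner_diff_left inner_diff_right power2_eq_square)
  qed
qed

section \<open>Conditionally Gaussian samples\<close>

text \<open>
  The sample may be replaced by \<open>m + s z\<close> with \<open>z\<close> independent of the past: the joint law of the
  outcome and the sample, with the outcome seen only through \<open>F\<close>, agrees with that of the constructed
  pair on rectangles, where the assumption on the conditional law applies.
\<close>

lemma law_of_gaussian_sample:
  fixes m \<xi> :: "'w \<Rightarrow> real ^ 'd :: finite"
  assumes M: "prob_space M" and F: "subalgebra M F"
    and m: "m \<in> borel_measurable F" and \<xi>: "\<xi> \<in> borel_measurable M" and s: "s > 0"
    and cond: "\<And>S. S \<in> sets borel \<Longrightarrow> AE \<omega> in M.
      real_cond_exp M F (\<lambda>\<omega>. indicator S (\<xi> \<omega>)) \<omega> = measure (normal_vec (m \<omega>) s) S"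
  shows "distr M (restr_to_subalg M F \<Otimes>\<^sub>M borel) (\<lambda>\<omega>. (\<omega>, \<xi> \<omega>)) =
    distr (restr_to_subalg M F \<Otimes>\<^sub>M normal_vec 0 1) (restr_to_subalg M F \<Otimes>\<^sub>M borel) (\<lambda>(\<omega>, z). (\<omega>, m \<omega> + s *\<^sub>R z))"
proof -
  let ?f = "\<lambda>(\<omega>, z). (\<omega>, m \<omega> + s *\<^sub>R z)"
  define P where "P = restr_to_subalg M F"
  let ?N = "normal_vec (0 :: real ^ 'd) 1"
  interpret M: prob_space M by fact
  interpret sub: finite_measure_subalgebra M F
    using F by unfold_locales
  interpret N: prob_space ?N by (rule prob_space_std_normal)
  interpret F': prob_space P unfolding P_def by (rule prob_space_restr_to_subalg[OF F M])
  have setsP: "sets P = sets F" unfolding P_def by (rule sets_restr_to_subalg[OF F])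
  have spF: "space P = space M" unfolding P_def by (rule space_restr_to_subalg)
  have [measurable]: "m \<in> borel_measurable P" using m measurable_cong_sets[OF setsP refl] by blast
  have pm [measurable]: "(\<lambda>\<omega>. (\<omega>, \<xi> \<omega>)) \<in> measurable M (P \<Otimes>\<^sub>M borel)"
  proof (rule measurable_Pair)
    show "(\<lambda>\<omega>. \<omega>) \<in> measurable M P"
      using F by (auto simp: measurable_def spF setsP subalgebra_def)
  qed fact
  have pm2 [measurable]: "?f \<in> measurable (P \<Otimes>\<^sub>M ?N) (P \<Otimes>\<^sub>M borel)"
    by measurable
  let ?E = "{G \<times> S | G S. G \<in> sets P \<and> S \<in> sets (borel :: (real ^ 'd) measure)}"
  let ?L = "distr M (P \<Otimes>\<^sub>M borel) (\<lambda>\<omega>. (\<omega>, \<xi> \<omega>))"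
  let ?R = "distr (P \<Otimes>\<^sub>M ?N) (P \<Otimes>\<^sub>M borel) ?f"
  have "?L = ?R"
  proof (rule measure_eqI_generator_eq[OF Int_stable_pair_measure_generator[of P "borel :: (real ^ 'd) measure"], where \<Omega>="space (P \<Otimes>\<^sub>M borel)" and A="\<lambda>_. space (P \<Otimes>\<^sub>M borel)"])
    show "?E \<subseteq> Pow (space (P \<Otimes>\<^sub>M borel))"
      using sets.space_closed[of P] by (auto simp: space_pair_measure)
    show "sets ?L = sigma_sets (space (P \<Otimes>\<^sub>M borel)) ?E" "sets ?R = sigma_sets (space (P \<Otimes>\<^sub>M borel)) ?E"
      by (simp_all add: sets_pair_measure space_pair_measure)
    show "range (\<lambda>_ :: nat. space (P \<Otimes>\<^sub>M (borel :: (real ^ 'd) measure))) \<subseteq> ?E"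
      by (force simp: space_pair_measure)
    show "emeasure ?L (space (P \<Otimes>\<^sub>M borel)) \<noteq> \<infinity>"
      by (simp add: emeasure_distr M.emeasure_eq_measure)
    fix X assume "X \<in> ?E"
    then obtain G S where X: "X = G \<times> S" and G: "G \<in> sets P" and S [measurable]: "S \<in> sets borel" by blast
    have GF [measurable]: "G \<in> sets F" using G setsP by simp
    have GM [measurable]: "G \<in> sets M" using GF F by (auto simp: subalgebra_def)
    have [measurable]: "G \<in> sets P" by fact
    have XM [measurable]: "X \<in> sets (P \<Otimes>\<^sub>M borel)" unfolding X by measurable
    define p where "p \<omega> = measure (normal_vec (m \<omega>) s) S" for \<omega>
    let ?q = "\<lambda>\<omega>. indicator G \<omega> * p \<omega> :: real"
    have pN: "p \<omega> = measure ?N ((\<lambda>z. m \<omega> + s *\<^sub>R z) -` S)" for \<omega>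
      unfolding p_def using s by (subst normal_vec_affine) (simp_all add: measure_distr)
    have sec: "emeasure ?N (Pair \<omega> -` (?f -` X \<inter> space (P \<Otimes>\<^sub>M ?N))) =
       ennreal (?q \<omega>)" if "\<omega> \<in> space M" for \<omega>
    proof -
      have "Pair \<omega> -` (?f -` X \<inter> space (P \<Otimes>\<^sub>M ?N)) =
         (if \<omega> \<in> G then (\<lambda>z. m \<omega> + s *\<^sub>R z) -` S else {})"
        using that by (auto simp: X space_pair_measure spF)
      then show ?thesis by (simp add: pN N.emeasure_eq_measure)
    qed
    have "emeasure ?R X = emeasure (P \<Otimes>\<^sub>M ?N) (?f -` X \<inter> space (P \<Otimes>\<^sub>M ?N))"
      by (rule emeasure_distr[OF pm2 XM])
    also have "\<dots> = (\<integral>\<^sup>+\<omega>. emeasure ?N (Pair \<omega> -` (?f -` X \<inter> space (P \<Otimes>\<^sub>M ?N))) \<partial>P)"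
      by (rule N.emeasure_pair_measure_alt[OF measurable_sets[OF pm2 XM]])
    also have "\<dots> = (\<integral>\<^sup>+\<omega>. ennreal (?q \<omega>) \<partial>P)"
      by (intro nn_integral_cong sec) (simp add: spF)
    finally have R1: "emeasure ?R X = (\<integral>\<^sup>+\<omega>. ennreal (?q \<omega>) \<partial>P)" .
    have pm: "(\<lambda>\<omega>. ennreal (?q \<omega>)) \<in> borel_measurable P"
    proof (subst measurable_cong[OF sec[symmetric]])
      show "(\<lambda>\<omega>. emeasure ?N (Pair \<omega> -` (?f -` X \<inter> space (P \<Otimes>\<^sub>M ?N)))) \<in> borel_measurable P"
        by (rule N.measurable_emeasure_Pair) measurable
    qed (simp add: spF)
    have R2: "emeasure ?R X = (\<integral>\<^sup>+\<omega>. ennreal (?q \<omega>) \<partial>M)"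
      unfolding R1 unfolding P_def using pm measurable_cong_sets[OF setsP refl] by (intro nn_integral_subalgebra2[OF F]) blast
    have "(\<lambda>\<omega>. enn2real (ennreal (?q \<omega>))) = (\<lambda>\<omega>. ?q \<omega>)"
      unfolding p_def by (intro ext enn2real_ennreal mult_nonneg_nonneg) auto
    with borel_measurable_enn2real[OF pm]
    have "(\<lambda>\<omega>. ?q \<omega>) \<in> borel_measurable P" by (simp only:)
    then have "(\<lambda>\<omega>. ?q \<omega>) \<in> borel_measurable F"
      using measurable_cong_sets[OF setsP refl] by blast
    then have pr: "(\<lambda>\<omega>. ?q \<omega>) \<in> borel_measurable M"
      by (rule measurable_from_subalg[OF F])
    have int1: "integrable M (\<lambda>\<omega>. ?q \<omega> :: real)"
    proof (rule M.integrable_const_bound[where B=1])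
      show "AE \<omega> in M. norm (?q \<omega> :: real) \<le> 1"
        by (auto simp: pN indicator_def)
    qed fact
    have int2: "integrable M (\<lambda>\<omega>. indicator G \<omega> * indicator S (\<xi> \<omega>) :: real)"
      by (rule M.integrable_const_bound[where B=1]) (use \<xi> in \<open>auto simp: indicator_def\<close>)
    have "emeasure ?L X = emeasure M (G \<inter> (\<xi> -` S \<inter> space M))"
      using sets.sets_into_space[OF GM] by (subst emeasure_distr) (auto simp: X intro!: arg_cong[where f="emeasure M"])
    also have "\<dots> = ennreal (\<integral>\<omega>. indicator G \<omega> * indicator S (\<xi> \<omega>) \<partial>M)"
    proof -
      have "(\<integral>\<omega>. indicator G \<omega> * indicator S (\<xi> \<omega>) \<partial>M) = (\<integral>\<omega>. indicat_real (G \<inter> (\<xi> -` S \<inter> space M)) \<omega> \<partial>M)"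
        by (intro Bochner_Integration.integral_cong) (auto simp: indicator_def)
      also have "\<dots> = measure M (G \<inter> (\<xi> -` S \<inter> space M))"
        by (simp add: Int_assoc)
      finally show ?thesis by (simp add: M.emeasure_eq_measure)
    qed
    also have "(\<integral>\<omega>. indicator G \<omega> * indicator S (\<xi> \<omega>) \<partial>M) =
        (\<integral>\<omega>. indicator G \<omega> * real_cond_exp M F (\<lambda>\<omega>. indicator S (\<xi> \<omega>)) \<omega> \<partial>M)"
      using int2 \<xi> by (intro sub.real_cond_exp_intg(2)[symmetric]) auto
    also have "\<dots> = (\<integral>\<omega>. ?q \<omega> \<partial>M)"
    proof (rule integral_cong_AE)
      show "AE \<omega> in M. indicator G \<omega> * real_cond_exp M F (\<lambda>\<omega>. indicator S (\<xi> \<omega>)) \<omega> = ?q \<omega>"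
        using cond[OF S] by eventually_elim (simp add: p_def)
    qed (intro borel_measurable_times borel_measurable_indicator GM borel_measurable_cond_exp2, rule pr)
    also have "ennreal \<dots> = (\<integral>\<^sup>+\<omega>. ennreal (?q \<omega>) \<partial>M)"
      using int1 by (intro nn_integral_eq_integral[symmetric]) (auto simp: pN)
    finally show "emeasure ?L X = emeasure ?R X" using R2 by simp
  qed (auto simp: space_pair_measure)
  then show ?thesis unfolding P_def .
qed

text \<open>
  Conditional expectation given \<open>F\<close> as an explicit Gaussian integral \<open>\<psi>\<close>. Having a version that is
  defined pointwise allows deterministic inequalities to be used for every outcome.
\<close>

lemma gaussian_sample_integral:
  fixes m \<xi> :: "'w \<Rightarrow> real ^ 'd :: finite" and \<Phi> :: "'w \<times> (real ^ 'd) \<Rightarrow> real"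
  assumes M: "prob_space M" and F: "subalgebra M F"
    and m: "m \<in> borel_measurable F" and \<xi>: "\<xi> \<in> borel_measurable M" and s: "s > 0"
    and cond: "\<And>S. S \<in> sets borel \<Longrightarrow> AE \<omega> in M.
      real_cond_exp M F (\<lambda>\<omega>. indicator S (\<xi> \<omega>)) \<omega> = measure (normal_vec (m \<omega>) s) S"
    and \<Phi>: "\<Phi> \<in> borel_measurable (F \<Otimes>\<^sub>M borel)"
  defines "\<psi> \<equiv> \<lambda>\<omega>. \<integral>z. \<Phi> (\<omega>, m \<omega> + s *\<^sub>R z) \<partial>normal_vec 0 1"
  shows "\<psi> \<in> borel_measurable F"
    and "(\<integral>\<^sup>+\<omega>. ennreal (\<Phi> (\<omega>, \<xi> \<omega>)) \<partial>M) = (\<integral>\<^sup>+\<omega>. \<integral>\<^sup>+z. ennreal (\<Phi> (\<omega>, m \<omega> + s *\<^sub>R z)) \<partial>normal_vec 0 1 \<partial>M)"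
    and "integrable M (\<lambda>\<omega>. \<Phi> (\<omega>, \<xi> \<omega>)) \<Longrightarrow> integrable M \<psi>"
    and "integrable M (\<lambda>\<omega>. \<Phi> (\<omega>, \<xi> \<omega>)) \<Longrightarrow> (\<integral>\<omega>. \<Phi> (\<omega>, \<xi> \<omega>) \<partial>M) = (\<integral>\<omega>. \<psi> \<omega> \<partial>M)"
proof -
  let ?f = "\<lambda>(\<omega>, z). (\<omega>, m \<omega> + s *\<^sub>R z)"
  define P where "P = restr_to_subalg M F"
  let ?N = "normal_vec (0 :: real ^ 'd) 1"
  note law = law_of_gaussian_sample[OF M F m \<xi> s cond, folded P_def]
  interpret N: prob_space ?N by (rule prob_space_std_normal)
  interpret F': prob_space P unfolding P_def by (rule prob_space_restr_to_subalg[OF F M])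
  have setsP: "sets P = sets F" unfolding P_def by (rule sets_restr_to_subalg[OF F])
  note PF = measurable_cong_sets[OF setsP refl]
  interpret pair_sigma_finite P ?N ..
  have spF: "space P = space M" unfolding P_def by (rule space_restr_to_subalg)
  have [measurable]: "m \<in> borel_measurable P" using m PF by blast
  have "sets (P \<Otimes>\<^sub>M (borel :: (real ^ 'd) measure)) = sets (F \<Otimes>\<^sub>M borel)"
    using setsP by (intro sets_pair_measure_cong) auto
  then have \<Phi>' [measurable]: "\<Phi> \<in> borel_measurable (P \<Otimes>\<^sub>M borel)" using \<Phi> measurable_cong_sets by blast
  have pm [measurable]: "(\<lambda>\<omega>. (\<omega>, \<xi> \<omega>)) \<in> measurable M (P \<Otimes>\<^sub>M borel)"
  proof (rule measurable_Pair)
    show "(\<lambda>\<omega>. \<omega>) \<in> measurable M P"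
      using F by (auto simp: measurable_def spF setsP subalgebra_def)
  qed fact
  have pm2 [measurable]: "?f \<in> measurable (P \<Otimes>\<^sub>M ?N) (P \<Otimes>\<^sub>M borel)"
    by measurable
  have \<psi>F: "\<psi> \<in> borel_measurable P"
    unfolding \<psi>_def by (rule N.borel_measurable_lebesgue_integral) measurable
  then show \<psi>F': "\<psi> \<in> borel_measurable F" using PF by blast
  let ?L = "distr M (P \<Otimes>\<^sub>M borel) (\<lambda>\<omega>. (\<omega>, \<xi> \<omega>))"
  let ?R = "distr (P \<Otimes>\<^sub>M ?N) (P \<Otimes>\<^sub>M borel) ?f"
  have "(\<integral>\<^sup>+\<omega>. ennreal (\<Phi> (\<omega>, \<xi> \<omega>)) \<partial>M) = (\<integral>\<^sup>+x. ennreal (\<Phi> x) \<partial>?L)"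
    by (subst nn_integral_distr) auto
  also have "\<dots> = (\<integral>\<^sup>+x. ennreal (\<Phi> x) \<partial>?R)" by (simp only: law)
  also have "\<dots> = (\<integral>\<^sup>+x. ennreal (\<Phi> (case x of (\<omega>, z) \<Rightarrow> (\<omega>, m \<omega> + s *\<^sub>R z))) \<partial>(P \<Otimes>\<^sub>M ?N))"
    by (subst nn_integral_distr) auto
  also have "\<dots> = (\<integral>\<^sup>+\<omega>. \<integral>\<^sup>+z. ennreal (\<Phi> (\<omega>, m \<omega> + s *\<^sub>R z)) \<partial>?N \<partial>P)"
    by (subst N.nn_integral_fst[symmetric]) auto
  also have "\<dots> = (\<integral>\<^sup>+\<omega>. \<integral>\<^sup>+z. ennreal (\<Phi> (\<omega>, m \<omega> + s *\<^sub>R z)) \<partial>?N \<partial>M)"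
    unfolding P_def
  proof (rule nn_integral_subalgebra2[OF F])
    have "(\<lambda>\<omega>. \<integral>\<^sup>+z. ennreal (\<Phi> (\<omega>, m \<omega> + s *\<^sub>R z)) \<partial>?N) \<in> borel_measurable P" by measurable
    then show "(\<lambda>\<omega>. \<integral>\<^sup>+z. ennreal (\<Phi> (\<omega>, m \<omega> + s *\<^sub>R z)) \<partial>?N) \<in> borel_measurable F"
      using PF by blast
  qed
  finally show "(\<integral>\<^sup>+\<omega>. ennreal (\<Phi> (\<omega>, \<xi> \<omega>)) \<partial>M) = (\<integral>\<^sup>+\<omega>. \<integral>\<^sup>+z. ennreal (\<Phi> (\<omega>, m \<omega> + s *\<^sub>R z)) \<partial>?N \<partial>M)" .
  assume i: "integrable M (\<lambda>\<omega>. \<Phi> (\<omega>, \<xi> \<omega>))"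
  have "integrable ?L \<Phi>" using i by (subst integrable_distr_eq) auto
  then have "integrable ?R \<Phi>" by (simp only: law)
  then have i2: "integrable (P \<Otimes>\<^sub>M ?N) (\<lambda>x. \<Phi> (case x of (\<omega>, z) \<Rightarrow> (\<omega>, m \<omega> + s *\<^sub>R z)))"
    by (subst (asm) integrable_distr_eq) auto
  have iF: "integrable P \<psi>" using integrable_fst'[OF i2] by (simp add: \<psi>_def)
  then show "integrable M \<psi>" unfolding P_def by (rule integrable_from_subalg[OF F])
  have "(\<integral>\<omega>. \<Phi> (\<omega>, \<xi> \<omega>) \<partial>M) = integral\<^sup>L ?L \<Phi>" by (subst integral_distr) auto
  also have "\<dots> = integral\<^sup>L ?R \<Phi>" by (simp only: law)
  also have "\<dots> = integral\<^sup>L (P \<Otimes>\<^sub>M ?N) (\<lambda>x. \<Phi> (case x of (\<omega>, z) \<Rightarrow> (\<omega>, m \<omega> + s *\<^sub>R z)))"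
    by (subst integral_distr) auto
  also have "\<dots> = (\<integral>\<omega>. \<psi> \<omega> \<partial>P)" using integral_fst'[OF i2] by (simp add: \<psi>_def)
  also have "\<dots> = (\<integral>\<omega>. \<psi> \<omega> \<partial>M)" unfolding P_def using \<psi>F' by (rule integral_subalgebra2[OF F])
  finally show "(\<integral>\<omega>. \<Phi> (\<omega>, \<xi> \<omega>) \<partial>M) = (\<integral>\<omega>. \<psi> \<omega> \<partial>M)" .
qed

text \<open>
  The empty set has to be included: for small \<open>t\<close> the set onto which the algorithm projects may be
  empty, and then \<open>closest_point\<close> is a constant.
\<close>

lemma borel_measurable_closest_point:
  fixes S :: "'a :: euclidean_space set"
  assumes "closed S" "convex S"
  shows "closest_point S \<in> borel_measurable borel"
proof (cases "S = {}")
  case True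
  then have "closest_point S = (\<lambda>_. SOME x. False)" by (simp add: closest_point_def fun_eq_iff)
  then show ?thesis by simp
next
  case False
  then show ?thesis using assms by (intro borel_measurable_continuous_onI continuous_on_closest_point)
qed

lemma borel_measurable_vecI:
  fixes f :: "'w \<Rightarrow> 'a :: euclidean_space ^ 'n :: finite"
  assumes "\<And>j. (\<lambda>\<omega>. f \<omega> $ j) \<in> borel_measurable M"
  shows "f \<in> borel_measurable M"
  unfolding borel_measurable_euclidean_space[of f]
proof
  fix b :: "'a ^ 'n" assume "b \<in> Basis"
  then obtain j c where b: "b = axis j c" by (auto simp: Basis_vec_def)
  show "(\<lambda>\<omega>. f \<omega> \<bullet> b) \<in> borel_measurable M"
    unfolding b inner_axis using assms[of j] by measurable
qed

section \<open>Power sums and sequences\<close>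

lemma inverse_powr_tendsto_0:
  assumes "0 < q"
  shows "(\<lambda>t. u / real t powr q) \<longlonglongrightarrow> 0"
proof -
  have "(\<lambda>t. u * real t powr (- q)) \<longlonglongrightarrow> u * 0"
    using assms by (intro tendsto_intros tendsto_neg_powr filterlim_real_sequentially) auto
  then show ?thesis by (simp add: powr_minus divide_inverse)
qed

lemma eventually_inverse_powr_le:
  assumes "0 < q" "0 < c"
  shows "\<forall>\<^sub>F t in sequentially. u / real t powr q \<le> c"
  using order_tendstoD(2)[OF inverse_powr_tendsto_0[OF assms(1), of u] assms(2)]
  by eventually_elim simp

lemma bigtheta_inverse_powr_bounds:
  assumes f: "f \<in> \<Theta>(\<lambda>t. 1 / real t powr q)" and pos: "\<And>t. 0 \<le> f t"
  obtains l u :: real where "0 < l" "0 < u" "\<forall>\<^sub>F t in sequentially. l / real t powr q \<le> f t \<and> f t \<le> u / real t powr q"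
proof -
  from f have O: "f \<in> O(\<lambda>t. 1 / real t powr q)" and \<Omega>: "f \<in> \<Omega>(\<lambda>t. 1 / real t powr q)"
    by (rule bigthetaD1, rule bigthetaD2)
  obtain u where u: "0 < u" "\<forall>\<^sub>F t in sequentially. norm (f t) \<le> u * norm (1 / real t powr q)"
    by (rule landau_o.bigE[OF O])
  obtain l where l: "0 < l" "\<forall>\<^sub>F t in sequentially. norm (f t) \<ge> l * norm (1 / real t powr q)"
    by (rule landau_omega.bigE[OF \<Omega>])
  from u(2) l(2) have "\<forall>\<^sub>F t in sequentially. l / real t powr q \<le> f t \<and> f t \<le> u / real t powr q"
    by eventually_elim (simp add: pos)
  with l(1) u(1) show thesis by (rule that)
qed

text \<open>
  The increment of \<open>T powr (1 - p)\<close> is estimated by Young's inequality.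
\<close>

lemma sum_inverse_powr_le:
  fixes p :: real
  assumes p: "0 < p" "p < 1"
  shows "(\<Sum>t=1..T. 1 / real t powr p) \<le> real T powr (1 - p) / (1 - p)"
proof (induction T)
  case (Suc T)
  have "real T powr (1 - p) * real (Suc T) powr p \<le> (1 - p) * real T + p * real (Suc T)"
    using p by (cases "T = 0") (auto intro!: Youngs_inequality_0)
  also have "\<dots> = real (Suc T) - (1 - p)" by (simp add: algebra_simps)
  finally have "real T powr (1 - p) \<le> (real (Suc T) - (1 - p)) / real (Suc T) powr p"
    by (simp add: pos_le_divide_eq)
  also have "\<dots> = real (Suc T) powr (1 - p) - (1 - p) / real (Suc T) powr p"
  proof -
    have "real (Suc T) powr (1 - p) = real (Suc T) / real (Suc T) powr p"
      by (simp add: powr_diff)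
    then show ?thesis by (simp only: diff_divide_distrib)
  qed
  finally have "real T powr (1 - p) / (1 - p) \<le> (real (Suc T) powr (1 - p) - (1 - p) / real (Suc T) powr p) / (1 - p)"
    using p by (intro divide_right_mono) auto
  also have "\<dots> = real (Suc T) powr (1 - p) / (1 - p) - 1 / real (Suc T) powr p"
    using p diff_divide_distrib[of "real (Suc T) powr (1 - p)" "(1 - p) / real (Suc T) powr p" "1 - p"]
    by simp
  finally have "real T powr (1 - p) / (1 - p) + 1 / real (Suc T) powr p \<le> real (Suc T) powr (1 - p) / (1 - p)"
    by simp
  with Suc.IH show ?case by simp
qed simp

text \<open>
  The gap between consecutive \<open>q\<close>-th powers is of smaller order than the powers themselves, and \<open>s\<close>
  can grow only linearly across it.
\<close>

lemma linear_bound_from_powers: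
  fixes s :: "nat \<Rightarrow> real"
  assumes incr: "\<And>n. \<bar>s (Suc n) - s n\<bar> \<le> C"
    and q: "q \<ge> 1"
    and sub: "\<And>\<epsilon>. \<epsilon> > 0 \<Longrightarrow> \<forall>\<^sub>F k in sequentially. s (k ^ q) \<le> \<epsilon> * real (k ^ q)"
    and e: "\<epsilon> > 0"
  shows "\<forall>\<^sub>F n in sequentially. s n \<le> \<epsilon> * real n"
proof -
  have C: "0 \<le> C" using incr[of 0] by linarith
  have lip: "s (n + m) \<le> s n + C * real m" for n m
  proof (induction m)
    case (Suc m)
    then show ?case using incr[of "n + m"] by (simp add: algebra_simps)
  qed simp
  define \<eta> where "\<eta> = \<epsilon> / (2 * (C + 1))"
  have \<eta>: "\<eta> > 0" using e C by (simp add: \<eta>_def)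
  have "(\<lambda>k. (1 + 1 / real k) ^ q) \<longlonglongrightarrow> (1 + 0) ^ q"
    by (intro tendsto_intros lim_1_over_n)
  then have "\<forall>\<^sub>F k in sequentially. (1 + 1 / real k) ^ q < 1 + \<eta>"
    using \<eta> by (intro order_tendstoD(2)[of _ "(1 + 0) ^ q"]) auto
  with sub[of "\<epsilon> / 2"] e have "\<forall>\<^sub>F k in sequentially. s (k ^ q) \<le> \<epsilon> / 2 * real (k ^ q) \<and> (1 + 1 / real k) ^ q < 1 + \<eta> \<and> k \<ge> 1"
    using eventually_ge_at_top[of 1] by (intro eventually_conj) auto
  then obtain K where K: "\<And>k. k \<ge> K \<Longrightarrow> s (k ^ q) \<le> \<epsilon> / 2 * real (k ^ q) \<and> (1 + 1 / real k) ^ q < 1 + \<eta> \<and> k \<ge> 1"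
    unfolding eventually_sequentially by blast
  have "s n \<le> \<epsilon> * real n" if n: "n \<ge> (Suc K) ^ q" for n
  proof -
    define k where "k = (GREATEST k. k ^ q \<le> n)"
    have bnd: "y \<le> n" if "y ^ q \<le> n" for y
    proof (cases "y = 0")
      case False
      then have "y \<le> y ^ q" using q by (intro self_le_power) auto
      with that show ?thesis by (rule order_trans[rotated])
    qed simp
    have k: "k ^ q \<le> n" unfolding k_def
      by (rule GreatestI_nat[where P="\<lambda>k. k ^ q \<le> n", OF n bnd])
    have kK: "Suc K \<le> k" unfolding k_def
      by (rule Greatest_le_nat[where P="\<lambda>k. k ^ q \<le> n", OF n bnd])
    have "\<not> (Suc k) ^ q \<le> n"
    proof
      assume "(Suc k) ^ q \<le> n"
      then have "Suc k \<le> (GREATEST k. k ^ q \<le> n)"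
        by (rule Greatest_le_nat[where P="\<lambda>k. k ^ q \<le> n", OF _ bnd])
      then show False unfolding k_def[symmetric] by simp
    qed
    then have "n \<le> Suc k ^ q" by linarith
    then have n2: "real n \<le> real (Suc k) ^ q" by (simp only: of_nat_power[symmetric] of_nat_le_iff)
    have k1: "real k > 0" using kK by simp
    have "real (Suc k) = real k * (1 + 1 / real k)" using k1 by (simp add: field_simps)
    then have "real (Suc k) ^ q = real k ^ q * (1 + 1 / real k) ^ q" by (simp only: power_mult_distrib)
    also have "\<dots> \<le> real k ^ q * (1 + \<eta>)" using K[of k] kK by (intro mult_left_mono) auto
    finally have n3: "real n - real (k ^ q) \<le> \<eta> * real (k ^ q)" using n2 by (simp add: algebra_simps)
    have "s n \<le> s (k ^ q) + C * (real n - real (k ^ q))"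
      using lip[of "k ^ q" "n - k ^ q"] k by (simp add: of_nat_diff)
    also have "\<dots> \<le> \<epsilon> / 2 * real (k ^ q) + C * (\<eta> * real (k ^ q))"
      using K[of k] kK n3 C by (intro add_mono mult_left_mono) auto
    also have "\<dots> = (\<epsilon> / 2 + C * \<eta>) * real (k ^ q)" by (simp add: algebra_simps)
    also have "\<dots> \<le> \<epsilon> * real (k ^ q)"
    proof (intro mult_right_mono)
      have "C * \<eta> \<le> (C + 1) * \<eta>" using \<eta> by (intro mult_right_mono) auto
      also have "\<dots> = \<epsilon> / 2" using C by (simp add: \<eta>_def field_simps)
      finally show "\<epsilon> / 2 + C * \<eta> \<le> \<epsilon>" by simp
    qed simp
    also have "\<dots> \<le> \<epsilon> * real n" using k e by (intro mult_left_mono) (simp_all only: of_nat_le_iff less_imp_le)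
    finally show ?thesis .
  qed
  then show ?thesis unfolding eventually_sequentially by blast
qed

section \<open>Second moments and almost sure convergence\<close>

text \<open>
  Choosing \<open>q * \<delta> \<ge> 2\<close> makes the means summable along \<open>k ^ q\<close>.
\<close>

lemma AE_tendsto_zero_along_powers:
  fixes X :: "nat \<Rightarrow> 'w \<Rightarrow> real"
  assumes int: "\<And>T. T \<ge> t1 \<Longrightarrow> integrable M (X T)" and nn: "\<And>T \<omega>. T \<ge> t1 \<Longrightarrow> 0 \<le> X T \<omega>"
    and le: "\<And>T. T \<ge> t1 \<Longrightarrow> (\<integral>\<omega>. X T \<omega> \<partial>M) \<le> C / real T powr \<delta>" and \<delta>: "\<delta> > 0"
  obtains q :: nat where "q \<ge> 1" "AE \<omega> in M. (\<lambda>k. X (k ^ q) \<omega>) \<longlonglongrightarrow> 0"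
proof -
  define q where "q = nat \<lceil>2 / \<delta>\<rceil>"
  have q\<delta>: "2 \<le> real q * \<delta>"
  proof -
    have "2 / \<delta> \<le> real q" unfolding q_def by linarith
    then show ?thesis using \<delta> by (simp add: field_simps)
  qed
  then have q1: "q \<ge> 1" using \<delta> by (cases "q = 0") auto
  define b where "b = Suc t1"
  have C: "0 \<le> C"
  proof -
    have "0 \<le> (\<integral>\<omega>. X b \<omega> \<partial>M)" using nn[of b] by (intro Bochner_Integration.integral_nonneg) (simp add: b_def)
    also have "\<dots> \<le> C / real b powr \<delta>" using le[of b] by (simp add: b_def)
    finally have "0 \<le> C / real b powr \<delta>" .
    moreover have "0 < real b powr \<delta>" by (simp add: b_def)
    ultimately show ?thesis by (simp add: zero_le_divide_iff)
  qed
  have big: "t1 \<le> (k + b) ^ q" for k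
    using self_le_power[of "k + b" q] q1 by (simp add: b_def)
  have bound: "(\<integral>\<omega>. X ((k + b) ^ q) \<omega> \<partial>M) \<le> C / real (k + b) ^ 2" for k
  proof -
    have "(\<integral>\<omega>. X ((k + b) ^ q) \<omega> \<partial>M) \<le> C / (real (k + b) ^ q) powr \<delta>"
      using le[OF big[of k]] by simp
    also have "(real (k + b) ^ q) powr \<delta> = real (k + b) powr (real q * \<delta>)"
      by (subst powr_realpow[symmetric]) (simp_all add: b_def powr_powr)
    also have "C / \<dots> \<le> C / real (k + b) powr 2"
      using C q\<delta> by (intro divide_left_mono powr_mono mult_pos_pos) (auto simp: b_def)
    also have "real (k + b) powr 2 = real (k + b) ^ 2"
      by (simp add: b_def)
    finally show ?thesis .
  qed
  have summ: "summable (\<lambda>k. C / real (k + b) ^ 2)"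
    using summable_mult[OF summable_ignore_initial_segment[OF inverse_power_summable[where 'a=real, of 2], of b], of C]
    by (simp only: divide_inverse)
  have "(\<integral>\<^sup>+\<omega>. (\<Sum>k. ennreal (X ((k + b) ^ q) \<omega>)) \<partial>M) = (\<Sum>k. \<integral>\<^sup>+\<omega>. ennreal (X ((k + b) ^ q) \<omega>) \<partial>M)"
    using int[OF big] by (intro nn_integral_suminf) auto
  also have "\<dots> = (\<Sum>k. ennreal (\<integral>\<omega>. X ((k + b) ^ q) \<omega> \<partial>M))"
    using int[OF big] nn[OF big] by (simp add: nn_integral_eq_integral)
  also have "\<dots> \<le> (\<Sum>k. ennreal (C / real (k + b) ^ 2))"
    using bound by (intro suminf_le ennreal_leI) auto
  also have "\<dots> < \<infinity>"
    by (subst suminf_ennreal_eq[OF _ summable_sums[OF summ]]) (use C in simp_all)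
  finally have "AE \<omega> in M. (\<Sum>k. ennreal (X ((k + b) ^ q) \<omega>)) \<noteq> \<infinity>"
    using int[OF big] by (intro nn_integral_noteq_infinite) auto
  then have "AE \<omega> in M. (\<lambda>k. X (k ^ q) \<omega>) \<longlonglongrightarrow> 0"
  proof eventually_elim
    case (elim \<omega>)
    then have "summable (\<lambda>k. X ((k + b) ^ q) \<omega>)"
      using nn[OF big] by (intro summable_suminf_not_top) auto
    then have "(\<lambda>k. X ((k + b) ^ q) \<omega>) \<longlonglongrightarrow> 0" by (rule summable_LIMSEQ_zero)
    then show ?case by (rule LIMSEQ_offset)
  qed
  with q1 show thesis by (rule that)
qed

lemma integrable_mult_of_square_integrable:
  fixes u v :: "'w \<Rightarrow> real"
  assumes "u \<in> borel_measurable M" "v \<in> borel_measurable M"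
    and "integrable M (\<lambda>\<omega>. (u \<omega>)\<^sup>2)" "integrable M (\<lambda>\<omega>. (v \<omega>)\<^sup>2)"
  shows "integrable M (\<lambda>\<omega>. u \<omega> * v \<omega>)"
proof (rule Bochner_Integration.integrable_bound)
  show "integrable M (\<lambda>\<omega>. (u \<omega>)\<^sup>2 + (v \<omega>)\<^sup>2)" using assms by auto
  have "\<bar>a * b\<bar> \<le> a\<^sup>2 + b\<^sup>2" for a b :: real
  proof -
    have "2 * (\<bar>a\<bar> * \<bar>b\<bar>) \<le> a\<^sup>2 + b\<^sup>2"
      using zero_le_power2[of "\<bar>a\<bar> - \<bar>b\<bar>"] by (simp add: power2_diff)
    moreover have "0 \<le> \<bar>a\<bar> * \<bar>b\<bar>" by simp
    ultimately show ?thesis unfolding abs_mult by linarith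
  qed
  then show "AE \<omega> in M. norm (u \<omega> * v \<omega>) \<le> norm ((u \<omega>)\<^sup>2 + (v \<omega>)\<^sup>2)" by simp
qed (use assms in auto)

lemma orthogonal_sum_second_moment:
  fixes n :: "nat \<Rightarrow> 'w \<Rightarrow> real"
  assumes I: "finite I" and meas: "\<And>t. t \<in> I \<Longrightarrow> n t \<in> borel_measurable M"
    and sq: "\<And>t. t \<in> I \<Longrightarrow> integrable M (\<lambda>\<omega>. (n t \<omega>)\<^sup>2)"
    and orth: "\<And>s t. s \<in> I \<Longrightarrow> t \<in> I \<Longrightarrow> s < t \<Longrightarrow> (\<integral>\<omega>. n s \<omega> * n t \<omega> \<partial>M) = 0"
    and v: "\<And>t. t \<in> I \<Longrightarrow> (\<integral>\<omega>. (n t \<omega>)\<^sup>2 \<partial>M) \<le> v t"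
  shows "integrable M (\<lambda>\<omega>. (\<Sum>t\<in>I. n t \<omega>)\<^sup>2)" and "(\<integral>\<omega>. (\<Sum>t\<in>I. n t \<omega>)\<^sup>2 \<partial>M) \<le> (\<Sum>t\<in>I. v t)"
proof -
  have prod: "integrable M (\<lambda>\<omega>. n s \<omega> * n t \<omega>)" if "s \<in> I" "t \<in> I" for s t
    using that meas sq by (intro integrable_mult_of_square_integrable)
  have eq: "(\<Sum>t\<in>I. n t \<omega>)\<^sup>2 = (\<Sum>s\<in>I. \<Sum>t\<in>I. n s \<omega> * n t \<omega>)" for \<omega>
    by (simp add: power2_eq_square sum_product)
  show "integrable M (\<lambda>\<omega>. (\<Sum>t\<in>I. n t \<omega>)\<^sup>2)" unfolding eq using prod by auto
  have "(\<integral>\<omega>. (\<Sum>t\<in>I. n t \<omega>)\<^sup>2 \<partial>M) = (\<Sum>s\<in>I. \<Sum>t\<in>I. \<integral>\<omega>. n s \<omega> * n t \<omega> \<partial>M)"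
    unfolding eq using prod by (simp add: Bochner_Integration.integral_sum)
  also have "\<dots> = (\<Sum>s\<in>I. \<Sum>t\<in>I. if t = s then \<integral>\<omega>. (n s \<omega>)\<^sup>2 \<partial>M else 0)"
  proof (intro sum.cong refl)
    fix s t assume "s \<in> I" "t \<in> I"
    then show "(\<integral>\<omega>. n s \<omega> * n t \<omega> \<partial>M) = (if t = s then \<integral>\<omega>. (n s \<omega>)\<^sup>2 \<partial>M else 0)"
      using orth[of s t] orth[of t s] by (cases s t rule: linorder_cases) (auto simp: power2_eq_square mult.commute)
  qed
  also have "\<dots> \<le> (\<Sum>t\<in>I. v t)" using I v by (auto intro: sum_mono)
  finally show "(\<integral>\<omega>. (\<Sum>t\<in>I. n t \<omega>)\<^sup>2 \<partial>M) \<le> (\<Sum>t\<in>I. v t)" .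
qed

section \<open>Shrunk action sets\<close>

lemma frontier_compact_nonempty:
  fixes Y :: "'a :: euclidean_space set"
  assumes "compact Y" "Y \<noteq> {}"
  shows "frontier Y \<noteq> {}"
  using assms by (auto simp: frontier_eq_empty not_bounded_UNIV dest: compact_imp_bounded)

text \<open>
  For a point of \<open>Y\<close>, leaving \<open>Y\<close> means crossing its frontier. The description by balls makes convexity
  of the shrunk set visible, and it is the form in which the margin is used.
\<close>

lemma shrunk_eq_ball_subset:
  fixes Y :: "'a :: euclidean_space set"
  assumes Y: "compact Y"
  shows "shrunk \<rho> Y = {x \<in> Y. ball x \<rho> \<subseteq> Y}"
proof (cases "Y = {}")
  case True
  then show ?thesis by (simp add: shrunk_def)
next
  case False
  have cl: "closed Y" using Y by (rule compact_imp_closed)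
  have ne: "frontier Y \<noteq> {}" using Y False by (rule frontier_compact_nonempty)
  show ?thesis
  proof (intro set_eqI iffI; clarsimp simp: shrunk_def)
    fix x y assume x: "x \<in> Y" "\<rho> \<le> infdist x (frontier Y)" and y: "dist x y < \<rho>"
    show "y \<in> Y"
    proof (rule ccontr)
      assume "y \<notin> Y"
      then have "closed_segment x y \<inter> frontier Y \<noteq> {}"
        using x(1) by (intro connected_Int_frontier) auto
      then obtain z where z: "z \<in> closed_segment x y" "z \<in> frontier Y" by blast
      have "infdist x (frontier Y) \<le> dist x z" using z(2) by (rule infdist_le)
      also have "\<dots> \<le> dist x y" using dist_in_closed_segment[OF z(1)] by (simp add: dist_commute)
      finally show False using x y by simp
    qed
  next
    fix x assume x: "x \<in> Y" "ball x \<rho> \<subseteq> Y"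
    show "\<rho> \<le> infdist x (frontier Y)"
      unfolding infdist_notempty[OF ne]
    proof (rule cINF_greatest[OF ne])
      fix z assume z: "z \<in> frontier Y"
      show "\<rho> \<le> dist x z"
      proof (rule ccontr)
        assume "\<not> \<rho> \<le> dist x z"
        then have "z \<in> interior Y" using x(2) by (intro interiorI[of "ball x \<rho>"]) auto
        with z show False by (simp add: frontier_def)
      qed
    qed
  qed
qed

lemma closed_shrunk: "closed Y \<Longrightarrow> closed (shrunk \<rho> (Y :: 'a :: euclidean_space set))"
proof -
  assume "closed Y"
  moreover have "closed {x. \<rho> \<le> infdist x (frontier Y)}"
    by (intro closed_Collect_le continuous_intros continuous_on_infdist continuous_on_id)
  moreover have "shrunk \<rho> Y = Y \<inter> {x. \<rho> \<le> infdist x (frontier Y)}" by (auto simp: shrunk_def)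
  ultimately show ?thesis by auto
qed

lemma convex_shrunk:
  fixes Y :: "'a :: euclidean_space set"
  assumes Y: "compact Y" "convex Y"
  shows "convex (shrunk \<rho> Y)"
  unfolding shrunk_eq_ball_subset[OF Y(1)] convex_alt
proof (safe)
  fix x y :: 'a and u :: real assume *: "x \<in> Y" "ball x \<rho> \<subseteq> Y" "y \<in> Y" "ball y \<rho> \<subseteq> Y" "0 \<le> u" "u \<le> 1"
  then show "(1 - u) *\<^sub>R x + u *\<^sub>R y \<in> Y" using Y(2) by (auto simp: convex_alt)
  fix w assume w: "w \<in> ball ((1 - u) *\<^sub>R x + u *\<^sub>R y) \<rho>"
  define d where "d = w - ((1 - u) *\<^sub>R x + u *\<^sub>R y)"
  have "x + d \<in> Y" "y + d \<in> Y" using * w by (auto simp: subset_iff dist_norm d_def norm_minus_commute)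
  moreover have "w = (1 - u) *\<^sub>R (x + d) + u *\<^sub>R (y + d)" by (simp add: d_def algebra_simps)
  ultimately show "w \<in> Y" using Y(2) * by (simp add: convex_alt)
qed

text \<open>
  A convex set that contains \<open>x\<close> and a ball of radius \<open>d\<close> around \<open>x0\<close> contains the ball of radius
  \<open>c * d\<close> around the point that divides the segment from \<open>x\<close> to \<open>x0\<close> in the ratio \<open>c\<close>.
\<close>

lemma contraction_in_shrunk:
  fixes Y :: "'a :: euclidean_space set"
  assumes Y: "compact Y" "convex Y" and x: "x \<in> Y" and x0: "ball x0 d \<subseteq> Y" "0 < d" and c: "0 \<le> c" "c \<le> 1" "\<rho> \<le> c * d"
  shows "(1 - c) *\<^sub>R x + c *\<^sub>R x0 \<in> shrunk \<rho> Y"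
  unfolding shrunk_eq_ball_subset[OF Y(1)]
proof (safe)
  have "x0 \<in> Y" using x0 by auto
  then show mem: "(1 - c) *\<^sub>R x + c *\<^sub>R x0 \<in> Y" using Y(2) x c by (auto simp: convex_alt)
  fix w assume w: "w \<in> ball ((1 - c) *\<^sub>R x + c *\<^sub>R x0) \<rho>"
  show "w \<in> Y"
  proof (cases "c = 0")
    case True
    then show ?thesis using w c by (auto simp: dist_norm) (smt (verit) norm_ge_zero)
  next
    case False
    define e where "e = (w - ((1 - c) *\<^sub>R x + c *\<^sub>R x0)) /\<^sub>R c"
    have "norm e < d"
    proof -
      have "norm e = norm (w - ((1 - c) *\<^sub>R x + c *\<^sub>R x0)) / c" using c by (simp add: e_def divide_inverse mult.commute)
      also have "\<dots> < (c * d) / c" using w c False by (intro divide_strict_right_mono) (auto simp: dist_norm norm_minus_commute)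
      finally show ?thesis using False by simp
    qed
    then have "x0 + e \<in> Y" using x0(1) by (auto simp: subset_iff dist_norm)
    moreover have "w = (1 - c) *\<^sub>R x + c *\<^sub>R (x0 + e)" using False by (simp add: e_def algebra_simps)
    ultimately show ?thesis using Y(2) x c by (simp add: convex_alt)
  qed
qed

section \<open>Projected descent\<close>

text \<open>
  The basic inequality of projected gradient descent; the regularization term \<open>\<epsilon> u\<close> is moved to the
  error.
\<close>

lemma projected_step:
  fixes u m x :: "'a :: euclidean_space"
  assumes S: "closed S" "convex S" and x: "x \<in> S" and \<gamma>: "\<gamma> > 0"
    and R: "norm u \<le> R" "norm x \<le> R" and E: "\<gamma> * \<bar>\<epsilon>\<bar> \<le> E"
    and u': "u' = closest_point S (u - \<gamma> *\<^sub>R (m + \<epsilon> *\<^sub>R u))"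
  shows "inner m (u - x) \<le> ((norm (u - x))\<^sup>2 - (norm (u' - x))\<^sup>2) / (2 * \<gamma>) + \<gamma> * (norm m)\<^sup>2 + (E + 2) * R\<^sup>2 * \<bar>\<epsilon>\<bar>"
proof -
  let ?d = "m + \<epsilon> *\<^sub>R u"
  have R0: "0 \<le> R" using R(1) norm_ge_zero order_trans by blast
  have "norm (u' - x) \<le> norm (u - \<gamma> *\<^sub>R ?d - x)"
    using closest_point_lipschitz[OF S(2,1), of "u - \<gamma> *\<^sub>R ?d" x] x
    by (simp add: u' closest_point_self dist_norm ex_in_conv[symmetric] exI[of _ x])
  then have "(norm (u' - x))\<^sup>2 \<le> (norm ((u - x) - \<gamma> *\<^sub>R ?d))\<^sup>2"
    by (intro power_mono) (auto simp: algebra_simps)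
  also have "\<dots> = (norm (u - x))\<^sup>2 - 2 * \<gamma> * inner ?d (u - x) + \<gamma>\<^sup>2 * (norm ?d)\<^sup>2"
  proof -
    have "(norm (a - \<gamma> *\<^sub>R d))\<^sup>2 = (norm a)\<^sup>2 - 2 * \<gamma> * inner d a + \<gamma>\<^sup>2 * (norm d)\<^sup>2" for a d :: 'a
      unfolding power2_norm_eq_inner
      by (simp add: inner_diff_left inner_diff_right inner_commute power2_eq_square algebra_simps)
    then show ?thesis .
  qed
  finally have "2 * \<gamma> * inner ?d (u - x) \<le> (norm (u - x))\<^sup>2 - (norm (u' - x))\<^sup>2 + \<gamma>\<^sup>2 * (norm ?d)\<^sup>2" by simp
  then have "inner ?d (u - x) \<le> ((norm (u - x))\<^sup>2 - (norm (u' - x))\<^sup>2 + \<gamma>\<^sup>2 * (norm ?d)\<^sup>2) / (2 * \<gamma>)"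
    using \<gamma> by (simp add: pos_le_divide_eq mult.commute)
  also have "\<dots> = ((norm (u - x))\<^sup>2 - (norm (u' - x))\<^sup>2) / (2 * \<gamma>) + \<gamma> / 2 * (norm ?d)\<^sup>2"
    using \<gamma> by (simp add: add_divide_distrib power2_eq_square)
  finally have 1: "inner m (u - x) \<le> ((norm (u - x))\<^sup>2 - (norm (u' - x))\<^sup>2) / (2 * \<gamma>) + \<gamma> / 2 * (norm ?d)\<^sup>2 - \<epsilon> * inner u (u - x)"
    by (simp add: inner_add_left)
  have "(norm ?d)\<^sup>2 \<le> (norm m + \<bar>\<epsilon>\<bar> * R)\<^sup>2"
    using norm_triangle_ineq[of m "\<epsilon> *\<^sub>R u"] mult_left_mono[OF R(1), of "\<bar>\<epsilon>\<bar>"]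
    by (intro power_mono) auto
  also have "\<dots> \<le> 2 * (norm m)\<^sup>2 + 2 * (\<bar>\<epsilon>\<bar> * R)\<^sup>2"
    using zero_le_power2[of "norm m - \<bar>\<epsilon>\<bar> * R"] by (simp add: power2_sum power2_diff)
  finally have "\<gamma> / 2 * (norm ?d)\<^sup>2 \<le> \<gamma> / 2 * (2 * (norm m)\<^sup>2 + 2 * (\<bar>\<epsilon>\<bar> * R)\<^sup>2)"
    using \<gamma> by (intro mult_left_mono) auto
  also have "\<dots> = \<gamma> * (norm m)\<^sup>2 + (\<gamma> * \<bar>\<epsilon>\<bar>) * (R\<^sup>2 * \<bar>\<epsilon>\<bar>)"
    by (simp add: power2_eq_square algebra_simps)
  also have "\<dots> \<le> \<gamma> * (norm m)\<^sup>2 + E * (R\<^sup>2 * \<bar>\<epsilon>\<bar>)"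
    using E by (intro add_left_mono mult_right_mono) auto
  finally have 2: "\<gamma> / 2 * (norm ?d)\<^sup>2 \<le> \<gamma> * (norm m)\<^sup>2 + E * (R\<^sup>2 * \<bar>\<epsilon>\<bar>)" .
  have "\<bar>inner u (u - x)\<bar> \<le> norm u * norm (u - x)" by (rule Cauchy_Schwarz_ineq2)
  also have "\<dots> \<le> R * (2 * R)"
    using R norm_triangle_ineq4[of u x] R0 by (intro mult_mono) auto
  finally have "\<bar>\<epsilon>\<bar> * \<bar>inner u (u - x)\<bar> \<le> \<bar>\<epsilon>\<bar> * (R * (2 * R))" by (intro mult_left_mono) auto
  then have 3: "- \<epsilon> * inner u (u - x) \<le> 2 * R\<^sup>2 * \<bar>\<epsilon>\<bar>"
  proof -
    have "- \<epsilon> * w \<le> \<bar>\<epsilon>\<bar> * \<bar>w\<bar>" for w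
      using abs_ge_minus_self[of "\<epsilon> * w"] by (simp add: abs_mult)
    from this[of "inner u (u - x)"] \<open>\<bar>\<epsilon>\<bar> * \<bar>inner u (u - x)\<bar> \<le> \<bar>\<epsilon>\<bar> * (R * (2 * R))\<close>
    have "- \<epsilon> * inner u (u - x) \<le> \<bar>\<epsilon>\<bar> * (R * (2 * R))" by (rule order_trans)
    also have "\<dots> = 2 * R\<^sup>2 * \<bar>\<epsilon>\<bar>" by (simp add: power2_eq_square)
    finally show ?thesis .
  qed
  from 1 2 3 show ?thesis by (simp add: algebra_simps)
qed

text \<open>
  Summation by parts: the weights \<open>1 / \<gamma> t\<close> increase, so every increment of a weight may be charged with
  the maximal value \<open>D\<close>.
\<close>

lemma telescoping_stepsizes:
  fixes \<Psi> \<gamma> :: "nat \<Rightarrow> real"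
  assumes \<Psi>: "\<And>t. t \<ge> t1 \<Longrightarrow> 0 \<le> \<Psi> t \<and> \<Psi> t \<le> D" and \<gamma>: "\<And>t. 0 < \<gamma> t" "\<And>t. t \<ge> t1 \<Longrightarrow> \<gamma> (Suc t) \<le> \<gamma> t"
    and T: "T \<ge> t1"
  shows "(\<Sum>t=t1..T. (\<Psi> t - \<Psi> (Suc t)) / (2 * \<gamma> t)) \<le> D / (2 * \<gamma> T)"
proof -
  have "(\<Sum>t=t1..T. (\<Psi> t - \<Psi> (Suc t)) / (2 * \<gamma> t)) \<le> (D - \<Psi> (Suc T)) / (2 * \<gamma> T)"
    using T
  proof (induction T rule: dec_induct)
    case base
    then show ?case using \<Psi>[of t1] \<gamma>(1)[of t1] by (simp add: divide_right_mono)
  next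
    case (step T)
    have "(D - \<Psi> (Suc T)) / (2 * \<gamma> T) \<le> (D - \<Psi> (Suc T)) / (2 * \<gamma> (Suc T))"
      using \<Psi>[of "Suc T"] \<gamma>(1)[of T] \<gamma>(1)[of "Suc T"] \<gamma>(2)[of T] step.hyps
      by (intro divide_left_mono) auto
    with step show ?case by (simp add: add_divide_distrib diff_divide_distrib)
  qed
  also have "\<dots> \<le> D / (2 * \<gamma> T)"
    using \<Psi>[of "Suc T"] T \<gamma>(1)[of T] by (intro divide_right_mono) auto
  finally show ?thesis .
qed

section \<open>Conditional means of the payoffs along a run\<close>

text \<open>
  A run together with the constants that control it. \<open>B\<close>, \<open>L\<close>, \<open>K\<close> and \<open>R\<close> bound the cost, its gradient,
  its curvature and the actions; the letters \<open>l\<close> and \<open>u\<close> mark lower and upper constants for \<open>\<gamma>\<close>, \<open>\<sigma>\<close>,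
  \<open>\<epsilon>\<close> and \<open>\<rho>\<close> (in this order \<open>g\<close>, \<open>s\<close>, \<open>e\<close>, \<open>r\<close>) from time \<open>t1\<close> on. The lower bound on \<open>\<rho>\<close> has index
  \<open>t - 1\<close>, because \<open>\<mu> t\<close> was projected with parameter \<open>\<rho> (t - 1)\<close>.
\<close>

locale controlled_run = prob_space M for M :: "'w measure" +
  fixes A :: "'n :: finite \<Rightarrow> (real ^ 'd :: finite) set"
    and J :: "'n \<Rightarrow> real ^ 'd ^ 'n \<Rightarrow> real"
    and i :: 'n
    and \<gamma> \<sigma> \<epsilon> \<rho> :: "nat \<Rightarrow> real"
    and g s e r :: real
    and F :: "nat \<Rightarrow> 'w measure"
    and \<mu>0 :: "real ^ 'd"
    and \<mu> \<xi> :: "nat \<Rightarrow> 'w \<Rightarrow> real ^ 'd"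
    and a :: "nat \<Rightarrow> 'w \<Rightarrow> real ^ 'd ^ 'n"
    and B L K R :: real
    and t1 :: nat and lg ug ls us ue lr ur :: real
  assumes game: "convex_game A J"
    and flow: "information_flow M F"
    and opp: "arbitrary_opponents M F A i a"
    and run: "payoff_based_run M F A J i \<gamma> \<sigma> \<epsilon> \<rho> \<mu>0 \<mu> \<xi> a"
    and bounds_nonneg: "0 \<le> B" "0 \<le> L" "0 \<le> K" "0 \<le> R"
    and norm_le_R: "\<And>x. x \<in> A i \<Longrightarrow> norm x \<le> R"
    and payoff_le_B: "\<And>b. b \<in> joint_actions A \<Longrightarrow> \<bar>J i b\<bar> \<le> B"
    and gradient_le_L: "\<And>b. b \<in> joint_actions A \<Longrightarrow> norm (pseudo_gradient J b $ i) \<le> L"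
    and smooth_K: "\<And>b x y. b \<in> joint_actions A \<Longrightarrow> x \<in> A i \<Longrightarrow> norm (y - x) \<le> 1 \<Longrightarrow>
       J i (with_action i y b) \<le> J i (with_action i x b)
         + inner (pseudo_gradient J (with_action i x b) $ i) (y - x) + K * (norm (y - x))\<^sup>2"
    and param_pos: "\<And>t. 0 < \<gamma> t" "\<And>t. 0 < \<sigma> t"
    and rates: "0 < g" "g < 1" "0 < s" "0 < r" "0 < e" "r < s" "0 < g - 2 * s"
    and const_pos: "0 < lg" "0 < ug" "0 < ls" "0 < us" "0 < ue" "0 < lr" "0 < ur" "2 \<le> t1"
    and gamma_decr: "\<And>t. t \<ge> t1 \<Longrightarrow> \<gamma> (Suc t) \<le> \<gamma> t"
    and gamma_bounds: "\<And>t. t \<ge> t1 \<Longrightarrow> lg / real t powr g \<le> \<gamma> t \<and> \<gamma> t \<le> ug / real t powr g"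
    and sigma_bounds: "\<And>t. t \<ge> t1 \<Longrightarrow> ls / real t powr s \<le> \<sigma> t \<and> \<sigma> t \<le> us / real t powr s \<and> \<sigma> t \<le> 1"
    and eps_bound: "\<And>t. t \<ge> t1 \<Longrightarrow> \<bar>\<epsilon> t\<bar> \<le> ue / real t powr e"
    and rho_bound: "\<And>t. t \<ge> t1 \<Longrightarrow> lr / real t powr r \<le> \<rho> (t - 1) \<and> shrunk (\<rho> (t - 1)) (A i) \<noteq> {}"
    and rho_upper: "\<And>t. t \<ge> t1 \<Longrightarrow> \<rho> t \<le> ur / real t powr r"
begin

abbreviation "N \<equiv> normal_vec (0 :: real ^ 'd) 1"

abbreviation cost :: "real ^ 'd \<Rightarrow> nat \<Rightarrow> 'w \<Rightarrow> real" where
  "cost x t \<omega> \<equiv> J i (with_action i x (a t \<omega>))"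

sublocale N: prob_space N by (rule prob_space_std_normal)

lemma compact_A: "compact (A j)" and convex_A: "convex (A j)" and A_nonempty: "A j \<noteq> {}" and closed_A: "closed (A j)"
  using game interior_empty unfolding convex_game_def by (metis compact_imp_closed)+

lemma subalg: "subalgebra M (F t)" using flow by (simp add: information_flow_def)

lemma sets_F_mono: "t \<le> t' \<Longrightarrow> sets (F t) \<subseteq> sets (F t')"
  using flow filtration.sets_F_mono unfolding information_flow_def by blast

lemma space_F: "space (F t) = space M" using subalg by (simp add: subalgebra_def)

lemma measurable_F_mono: "f \<in> borel_measurable (F t) \<Longrightarrow> t \<le> t' \<Longrightarrow> f \<in> borel_measurable (F t')"
  by (rule measurable_from_subalg[of "F t'" "F t"]) (auto simp: subalgebra_def space_F sets_F_mono)

lemma measurable_F_M: "f \<in> borel_measurable (F t) \<Longrightarrow> f \<in> borel_measurable M"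
  by (rule measurable_from_subalg[OF subalg])

lemma own_action: "\<omega> \<in> space M \<Longrightarrow> a t \<omega> $ i = closest_point (A i) (\<xi> t \<omega>)"
  and mu_Suc: "\<omega> \<in> space M \<Longrightarrow> \<mu> (Suc t) \<omega> = closest_point (shrunk (\<rho> t) (A i))
     (\<mu> t \<omega> - \<gamma> t *\<^sub>R ((J i (a t \<omega>) / (\<sigma> t)\<^sup>2) *\<^sub>R (\<xi> t \<omega> - \<mu> t \<omega>) + \<epsilon> t *\<^sub>R \<mu> t \<omega>))"
  and xi_meas: "\<xi> t \<in> borel_measurable (F (Suc t))"
  and xi_law: "S \<in> sets borel \<Longrightarrow> AE \<omega> in M. real_cond_exp M (F t) (\<lambda>\<omega>. indicator S (\<xi> t \<omega>)) \<omega> =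
           measure (normal_vec (\<mu> t \<omega>) (\<sigma> t)) S"
  and mu_0: "\<omega> \<in> space M \<Longrightarrow> \<mu> 0 \<omega> = \<mu>0"
  using run unfolding payoff_based_run_def Let_def by blast+

lemma opp_meas: "j \<noteq> i \<Longrightarrow> (\<lambda>\<omega>. a t \<omega> $ j) \<in> borel_measurable (F t)"
  and opp_in: "j \<noteq> i \<Longrightarrow> \<omega> \<in> space M \<Longrightarrow> a t \<omega> $ j \<in> A j"
  using opp unfolding arbitrary_opponents_def by blast+

lemma joint_action: "\<omega> \<in> space M \<Longrightarrow> a t \<omega> \<in> joint_actions A"
  unfolding joint_actions_def using own_action opp_in closest_point_in_set[OF closed_A A_nonempty, of i]
  by (auto) (metis (full_types))

lemma joint_with_action: "b \<in> joint_actions A \<Longrightarrow> x \<in> A i \<Longrightarrow> with_action i x b \<in> joint_actions A"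
  by (auto simp: joint_actions_def)

lemma J_continuous: "continuous_on UNIV (J i)"
  using game continuously_differentiable_imp_continuous unfolding convex_game_def by blast

lemma J_borel: "J i \<in> borel_measurable borel"
  using J_continuous by (rule borel_measurable_continuous_onI)

lemma proj_borel: "closest_point (A i) \<in> borel_measurable borel"
  by (rule borel_measurable_closest_point[OF closed_A convex_A])

lemma payoff_measurable:
  assumes "h \<in> borel_measurable P" "\<And>j. j \<noteq> i \<Longrightarrow> (\<lambda>p. b p $ j) \<in> borel_measurable P"
  shows "(\<lambda>p. J i (with_action i (h p) (b p))) \<in> borel_measurable P"
proof -
  have "(\<lambda>p. with_action i (h p) (b p)) \<in> borel_measurable P"
  proof (rule borel_measurable_vecI)
    fix j show "(\<lambda>p. with_action i (h p) (b p) $ j) \<in> borel_measurable P"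
      using assms by (cases "j = i") auto
  qed
  then show ?thesis by (rule measurable_compose[OF _ J_borel])
qed

lemma realized_payoff: "\<omega> \<in> space M \<Longrightarrow> J i (a t \<omega>) = J i (with_action i (closest_point (A i) (\<xi> t \<omega>)) (a t \<omega>))"
  using own_action[of \<omega> t] with_action_same[of i "a t \<omega>"] by simp

lemma realized_payoff_measurable: "(\<lambda>\<omega>. J i (a t \<omega>)) \<in> borel_measurable (F (Suc t))"
proof -
  have "(\<lambda>\<omega>. J i (with_action i (closest_point (A i) (\<xi> t \<omega>)) (a t \<omega>))) \<in> borel_measurable (F (Suc t))"
    by (intro payoff_measurable measurable_compose[OF xi_meas proj_borel] measurable_F_mono[OF opp_meas]) auto
  then show ?thesis
    by (rule iffD1[OF measurable_cong, rotated]) (simp add: space_F realized_payoff[symmetric])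
qed

lemma mu_meas: "\<mu> t \<in> borel_measurable (F t)"
proof (induction t)
  case 0
  have "(\<lambda>_. \<mu>0) \<in> borel_measurable (F 0)" by simp
  then show ?case by (rule iffD1[OF measurable_cong, rotated]) (simp add: space_F mu_0)
next
  case (Suc t)
  have [measurable]: "\<mu> t \<in> borel_measurable (F (Suc t))" using Suc.IH by (rule measurable_F_mono) simp
  note [measurable] = xi_meas[of t] realized_payoff_measurable[of t]
  have "(\<lambda>\<omega>. closest_point (shrunk (\<rho> t) (A i))
     (\<mu> t \<omega> - \<gamma> t *\<^sub>R ((J i (a t \<omega>) / (\<sigma> t)\<^sup>2) *\<^sub>R (\<xi> t \<omega> - \<mu> t \<omega>) + \<epsilon> t *\<^sub>R \<mu> t \<omega>))) \<in> borel_measurable (F (Suc t))"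
    by (rule measurable_compose[OF _ borel_measurable_closest_point[OF closed_shrunk[OF closed_A] convex_shrunk[OF compact_A convex_A]]]) measurable
  then show ?case by (rule iffD1[OF measurable_cong, rotated]) (simp add: space_F mu_Suc)
qed

lemma mu_margin:
  assumes "t \<ge> t1" "\<omega> \<in> space M"
  shows "\<mu> t \<omega> \<in> A i" "ball (\<mu> t \<omega>) (lr / real t powr r) \<subseteq> A i"
proof -
  have t: "t = Suc (t - 1)" using assms const_pos by simp
  have "\<mu> t \<omega> \<in> shrunk (\<rho> (t - 1)) (A i)"
    using rho_bound[OF assms(1)] closest_point_in_set[OF closed_shrunk[OF closed_A]]
    by (subst t, subst mu_Suc[OF assms(2)]) blast
  then have *: "\<mu> t \<omega> \<in> A i" "ball (\<mu> t \<omega>) (\<rho> (t - 1)) \<subseteq> A i"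
    unfolding shrunk_eq_ball_subset[OF compact_A] by auto
  show "\<mu> t \<omega> \<in> A i" by fact
  show "ball (\<mu> t \<omega>) (lr / real t powr r) \<subseteq> A i"
    using *(2) subset_ball[of "lr / real t powr r" "\<rho> (t - 1)" "\<mu> t \<omega>"] rho_bound[OF assms(1)] by blast
qed

definition grad_est :: "nat \<Rightarrow> 'w \<Rightarrow> real ^ 'd" where
  "grad_est t \<omega> = (J i (a t \<omega>) / (\<sigma> t)\<^sup>2) *\<^sub>R (\<xi> t \<omega> - \<mu> t \<omega>)"

abbreviation grad_sq :: "nat \<Rightarrow> 'w \<Rightarrow> real" where
  "grad_sq t \<omega> \<equiv> (norm (grad_est t \<omega>))\<^sup>2"

text \<open>
  The realized cost with the linear term of the descent analysis subtracted. Working with this one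
  quantity leaves a single martingale in the analysis.
\<close>

definition linearized :: "real ^ 'd \<Rightarrow> nat \<Rightarrow> 'w \<Rightarrow> real" where
  "linearized x t \<omega> = J i (a t \<omega>) - inner (grad_est t \<omega>) (\<mu> t \<omega> - x)"

text \<open>
  The conditional mean of \<open>linearized\<close>, as a Gaussian integral.
\<close>

definition predicted :: "real ^ 'd \<Rightarrow> nat \<Rightarrow> 'w \<Rightarrow> real" where
  "predicted x t \<omega> = (\<integral>z. J i (with_action i (closest_point (A i) (\<mu> t \<omega> + \<sigma> t *\<^sub>R z)) (a t \<omega>))
      * (1 - inner z (\<mu> t \<omega> - x) / \<sigma> t) \<partial>N)"

definition noise :: "real ^ 'd \<Rightarrow> nat \<Rightarrow> 'w \<Rightarrow> real" where
  "noise x t \<omega> = linearized x t \<omega> - predicted x t \<omega>"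

text \<open>
  The quantity \<open>linearized\<close> as a function of the outcome and of a hypothetical sample.
\<close>

definition kernel :: "real ^ 'd \<Rightarrow> nat \<Rightarrow> 'w \<times> (real ^ 'd) \<Rightarrow> real" where
  "kernel x t p = J i (with_action i (closest_point (A i) (snd p)) (a t (fst p)))
      * (1 - inner (snd p - \<mu> t (fst p)) (\<mu> t (fst p) - x) / (\<sigma> t)\<^sup>2)"

lemma kernel_measurable: "kernel x t \<in> borel_measurable (F t \<Otimes>\<^sub>M borel)"
proof -
  have m: "(\<lambda>p. h (fst p)) \<in> borel_measurable (F t \<Otimes>\<^sub>M (borel :: (real ^ 'd) measure))"
    if "h \<in> borel_measurable (F t)" for h :: "'w \<Rightarrow> 'z :: topological_space"
    by (rule measurable_compose[OF measurable_fst that])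
  note [measurable] = m[OF mu_meas[of t]]
  have [measurable]: "(\<lambda>p. J i (with_action i (closest_point (A i) (snd p)) (a t (fst p)))) \<in> borel_measurable (F t \<Otimes>\<^sub>M borel)"
    by (intro payoff_measurable measurable_compose[OF measurable_snd proj_borel] m opp_meas)
  show ?thesis unfolding kernel_def by measurable
qed

lemma kernel_sample: "\<omega> \<in> space M \<Longrightarrow> kernel x t (\<omega>, \<xi> t \<omega>) = linearized x t \<omega>"
  by (simp add: kernel_def linearized_def grad_est_def realized_payoff[symmetric] right_diff_distrib)

lemma kernel_gaussian:
  "(\<integral>z. kernel x t (\<omega>, \<mu> t \<omega> + \<sigma> t *\<^sub>R z) \<partial>N) = predicted x t \<omega>"
  using param_pos(2)[of t] by (simp add: kernel_def predicted_def power2_eq_square)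

lemmas sample_integral = gaussian_sample_integral[OF prob_space_axioms subalg mu_meas measurable_F_M[OF xi_meas] param_pos(2) xi_law]

lemma predicted_measurable: "predicted x t \<in> borel_measurable (F t)"
  using sample_integral(1)[OF _ kernel_measurable[of x t]] by (simp add: kernel_gaussian)

lemma linearized_measurable: "linearized x t \<in> borel_measurable (F (Suc t))"
proof -
  have [measurable]: "\<mu> t \<in> borel_measurable (F (Suc t))" by (rule measurable_F_mono[OF mu_meas]) simp
  note [measurable] = realized_payoff_measurable[of t] xi_meas[of t]
  have [measurable]: "grad_est t \<in> borel_measurable (F (Suc t))" unfolding grad_est_def by measurable
  show ?thesis unfolding linearized_def by measurable
qed

lemma noise_measurable: "noise x t \<in> borel_measurable (F (Suc t))"
  unfolding noise_def using linearized_measurable measurable_F_mono[OF predicted_measurable, of t "Suc t"]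
  by (intro borel_measurable_diff) auto

text \<open>
  The characteristic property of conditional expectation, for weights \<open>W\<close> known before the sample is
  drawn.
\<close>

lemma conditional_mean:
  assumes W: "W \<in> borel_measurable (F t)" and int: "integrable M (\<lambda>\<omega>. W \<omega> * linearized x t \<omega>)"
  shows "integrable M (\<lambda>\<omega>. W \<omega> * predicted x t \<omega>)"
    and "(\<integral>\<omega>. W \<omega> * linearized x t \<omega> \<partial>M) = (\<integral>\<omega>. W \<omega> * predicted x t \<omega> \<partial>M)"
proof -
  let ?\<Phi> = "\<lambda>p. W (fst p) * kernel x t p"
  have \<Phi>: "?\<Phi> \<in> borel_measurable (F t \<Otimes>\<^sub>M borel)"
    by (intro borel_measurable_times kernel_measurable measurable_compose[OF measurable_fst W])
  have i: "integrable M (\<lambda>\<omega>. ?\<Phi> (\<omega>, \<xi> t \<omega>))"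
    using int by (rule iffD1[OF Bochner_Integration.integrable_cong, rotated -1]) (auto simp: kernel_sample)
  have g: "(\<integral>z. ?\<Phi> (\<omega>, \<mu> t \<omega> + \<sigma> t *\<^sub>R z) \<partial>N) = W \<omega> * predicted x t \<omega>" for \<omega>
    by (simp add: kernel_gaussian)
  show "integrable M (\<lambda>\<omega>. W \<omega> * predicted x t \<omega>)"
    using sample_integral(3)[OF _ \<Phi> i] by (simp only: g)
  have "(\<integral>\<omega>. W \<omega> * linearized x t \<omega> \<partial>M) = (\<integral>\<omega>. ?\<Phi> (\<omega>, \<xi> t \<omega>) \<partial>M)"
    by (rule Bochner_Integration.integral_cong) (auto simp: kernel_sample)
  also have "\<dots> = (\<integral>\<omega>. W \<omega> * predicted x t \<omega> \<partial>M)"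
    using sample_integral(4)[OF _ \<Phi> i] by (simp only: g)
  finally show "(\<integral>\<omega>. W \<omega> * linearized x t \<omega> \<partial>M) = (\<integral>\<omega>. W \<omega> * predicted x t \<omega> \<partial>M)" .
qed

definition second_moment :: real where "second_moment = (\<integral>z. (norm (z :: real ^ 'd))\<^sup>2 \<partial>N)"

lemma second_moment_nonneg: "0 \<le> second_moment" unfolding second_moment_def by simp

lemma integrable_norm_sq: "integrable N (\<lambda>z. (norm z)\<^sup>2)"
  by (rule integrable_std_normal_poly_growth[where C=1 and k=2]) (auto intro!: power_mono)

lemma sample_second_moment:
  "integrable M (\<lambda>\<omega>. (norm (\<xi> t \<omega> - \<mu> t \<omega>))\<^sup>2)" "(\<integral>\<omega>. (norm (\<xi> t \<omega> - \<mu> t \<omega>))\<^sup>2 \<partial>M) = (\<sigma> t)\<^sup>2 * second_moment"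
proof -
  let ?\<Phi> = "\<lambda>p. (norm (snd p - \<mu> t (fst p)))\<^sup>2"
  have [measurable]: "(\<lambda>p. \<mu> t (fst p)) \<in> borel_measurable (F t \<Otimes>\<^sub>M (borel :: (real ^ 'd) measure))"
    by (rule measurable_compose[OF measurable_fst mu_meas])
  have \<Phi>: "?\<Phi> \<in> borel_measurable (F t \<Otimes>\<^sub>M borel)" by measurable
  have "(\<integral>\<^sup>+z. ennreal (?\<Phi> (\<omega>, \<mu> t \<omega> + \<sigma> t *\<^sub>R z)) \<partial>N) = ennreal ((\<sigma> t)\<^sup>2 * second_moment)" for \<omega>
  proof -
    have "(\<integral>\<^sup>+z. ennreal (?\<Phi> (\<omega>, \<mu> t \<omega> + \<sigma> t *\<^sub>R z)) \<partial>N) = (\<integral>\<^sup>+z. ennreal ((\<sigma> t)\<^sup>2 * (norm z)\<^sup>2) \<partial>N)"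
      by (simp add: power_mult_distrib)
    also have "\<dots> = ennreal (\<integral>z. (\<sigma> t)\<^sup>2 * (norm z)\<^sup>2 \<partial>N)"
      using integrable_norm_sq by (intro nn_integral_eq_integral) auto
    finally show ?thesis by (simp add: second_moment_def)
  qed
  then have nn: "(\<integral>\<^sup>+\<omega>. ennreal ((norm (\<xi> t \<omega> - \<mu> t \<omega>))\<^sup>2) \<partial>M) = ennreal ((\<sigma> t)\<^sup>2 * second_moment)"
    using sample_integral(2)[OF _ \<Phi>] by (simp add: emeasure_space_1)
  have m: "(\<lambda>\<omega>. (norm (\<xi> t \<omega> - \<mu> t \<omega>))\<^sup>2) \<in> borel_measurable M"
    using measurable_F_M[OF xi_meas] measurable_F_M[OF mu_meas] by measurable
  show "integrable M (\<lambda>\<omega>. (norm (\<xi> t \<omega> - \<mu> t \<omega>))\<^sup>2)"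
    using nn m by (intro integrableI_nonneg) auto
  show "(\<integral>\<omega>. (norm (\<xi> t \<omega> - \<mu> t \<omega>))\<^sup>2 \<partial>M) = (\<sigma> t)\<^sup>2 * second_moment"
    using nn m second_moment_nonneg by (subst integral_eq_nn_integral) auto
qed

lemma grad_est_second_moment:
  "integrable M (\<lambda>\<omega>. grad_sq t \<omega>)" "(\<integral>\<omega>. grad_sq t \<omega> \<partial>M) \<le> B\<^sup>2 * second_moment / (\<sigma> t)\<^sup>2"
proof -
  have le: "grad_sq t \<omega> \<le> (B\<^sup>2 / (\<sigma> t) ^ 4) * (norm (\<xi> t \<omega> - \<mu> t \<omega>))\<^sup>2" if "\<omega> \<in> space M" for \<omega>
  proof -
    have "grad_sq t \<omega> = (J i (a t \<omega>))\<^sup>2 / (\<sigma> t) ^ 4 * (norm (\<xi> t \<omega> - \<mu> t \<omega>))\<^sup>2"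
      by (simp add: grad_est_def power_mult_distrib power_divide flip: power_mult)
    also have "\<dots> \<le> (B\<^sup>2 / (\<sigma> t) ^ 4) * (norm (\<xi> t \<omega> - \<mu> t \<omega>))\<^sup>2"
      using payoff_le_B[OF joint_action[OF that]] bounds_nonneg(1)
      by (intro mult_right_mono divide_right_mono) (auto simp: abs_le_square_iff[symmetric])
    finally show ?thesis .
  qed
  have i: "integrable M (\<lambda>\<omega>. (B\<^sup>2 / (\<sigma> t) ^ 4) * (norm (\<xi> t \<omega> - \<mu> t \<omega>))\<^sup>2)"
    using sample_second_moment(1) by simp
  note [measurable] = measurable_F_M[OF realized_payoff_measurable[of t]] measurable_F_M[OF xi_meas[of t]] measurable_F_M[OF mu_meas[of t]]
  have m: "(\<lambda>\<omega>. grad_sq t \<omega>) \<in> borel_measurable M" unfolding grad_est_def by measurable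
  show i': "integrable M (\<lambda>\<omega>. grad_sq t \<omega>)"
    by (rule Bochner_Integration.integrable_bound[OF i m]) (use le in \<open>auto intro!: AE_I2\<close>)
  have "(\<integral>\<omega>. grad_sq t \<omega> \<partial>M) \<le> (\<integral>\<omega>. (B\<^sup>2 / (\<sigma> t) ^ 4) * (norm (\<xi> t \<omega> - \<mu> t \<omega>))\<^sup>2 \<partial>M)"
    by (rule integral_mono[OF i' i le])
  also have "\<dots> = B\<^sup>2 * second_moment / (\<sigma> t)\<^sup>2"
    using param_pos(2)[of t] by (simp add: sample_second_moment(2)) (simp add: power2_eq_square power4_eq_xxxx)
  finally show "(\<integral>\<omega>. grad_sq t \<omega> \<partial>M) \<le> B\<^sup>2 * second_moment / (\<sigma> t)\<^sup>2" .
qed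

definition error_const :: "nat \<Rightarrow> real" where
  "error_const p = (K + 2 * L) * second_moment * us\<^sup>2
     + (2 * B + 2 * L * R + L) * (1 + 2 * R) * (\<integral>z. (1 + norm (z :: real ^ 'd)) ^ (p + 2) \<partial>N) * (us / lr) ^ p / ls"

definition noise_const :: real where
  "noise_const = 2 * (2 * B\<^sup>2 + 8 * R\<^sup>2 * B\<^sup>2 * second_moment) + 2 * (B * (1 + 2 * R) * (\<integral>z. 1 + norm z \<partial>N))\<^sup>2"

context
  fixes t :: nat and x :: "real ^ 'd"
  assumes t: "t \<ge> t1" and x: "x \<in> A i"
begin

lemma dist_mu_x: "\<omega> \<in> space M \<Longrightarrow> norm (\<mu> t \<omega> - x) \<le> 2 * R"
  using norm_triangle_ineq4[of "\<mu> t \<omega>" x] norm_le_R[OF x] norm_le_R[OF mu_margin(1)[OF t, of \<omega>]] by simp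

lemma linearized_second_moment:
  "integrable M (\<lambda>\<omega>. (linearized x t \<omega>)\<^sup>2)"
  "(\<integral>\<omega>. (linearized x t \<omega>)\<^sup>2 \<partial>M) \<le> (2 * B\<^sup>2 + 8 * R\<^sup>2 * B\<^sup>2 * second_moment) / (\<sigma> t)\<^sup>2"
proof -
  have le: "(linearized x t \<omega>)\<^sup>2 \<le> 2 * B\<^sup>2 + 8 * R\<^sup>2 * grad_sq t \<omega>" if \<omega>: "\<omega> \<in> space M" for \<omega>
  proof -
    have "\<bar>inner (grad_est t \<omega>) (\<mu> t \<omega> - x)\<bar> \<le> norm (grad_est t \<omega>) * norm (\<mu> t \<omega> - x)"
      by (rule Cauchy_Schwarz_ineq2)
    also have "\<dots> \<le> norm (grad_est t \<omega>) * (2 * R)" by (intro mult_left_mono dist_mu_x \<omega>) simp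
    finally have "\<bar>linearized x t \<omega>\<bar> \<le> B + norm (grad_est t \<omega>) * (2 * R)"
      using payoff_le_B[OF joint_action[OF \<omega>, of t]] unfolding linearized_def by linarith
    then have "(linearized x t \<omega>)\<^sup>2 \<le> (B + norm (grad_est t \<omega>) * (2 * R))\<^sup>2"
      using power_mono[of "\<bar>linearized x t \<omega>\<bar>" _ 2] by simp
    also have "\<dots> \<le> 2 * B\<^sup>2 + 2 * (norm (grad_est t \<omega>) * (2 * R))\<^sup>2"
      using zero_le_power2[of "B - norm (grad_est t \<omega>) * (2 * R)"] unfolding power2_sum power2_diff by linarith
    also have "\<dots> = 2 * B\<^sup>2 + 8 * R\<^sup>2 * grad_sq t \<omega>" by (simp add: power_mult_distrib)
    finally show ?thesis .
  qed
  have i: "integrable M (\<lambda>\<omega>. 2 * B\<^sup>2 + 8 * R\<^sup>2 * grad_sq t \<omega>)"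
    using grad_est_second_moment(1) by simp
  have m: "(\<lambda>\<omega>. (linearized x t \<omega>)\<^sup>2) \<in> borel_measurable M"
    using measurable_F_M[OF linearized_measurable] by measurable
  show i': "integrable M (\<lambda>\<omega>. (linearized x t \<omega>)\<^sup>2)"
    by (rule Bochner_Integration.integrable_bound[OF i m]) (use le in \<open>auto intro!: AE_I2\<close>)
  have "(\<integral>\<omega>. (linearized x t \<omega>)\<^sup>2 \<partial>M) \<le> (\<integral>\<omega>. 2 * B\<^sup>2 + 8 * R\<^sup>2 * grad_sq t \<omega> \<partial>M)"
    by (rule integral_mono[OF i' i le])
  also have "\<dots> = 2 * B\<^sup>2 + 8 * R\<^sup>2 * (\<integral>\<omega>. grad_sq t \<omega> \<partial>M)"
    using grad_est_second_moment(1) by (simp add: prob_space)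
  also have "\<dots> \<le> 2 * B\<^sup>2 / (\<sigma> t)\<^sup>2 + 8 * R\<^sup>2 * (B\<^sup>2 * second_moment / (\<sigma> t)\<^sup>2)"
  proof (intro add_mono mult_left_mono grad_est_second_moment(2))
    have "(\<sigma> t)\<^sup>2 \<le> 1" using sigma_bounds[OF t] param_pos(2)[of t] by (simp add: power_le_one)
    then show "2 * B\<^sup>2 \<le> 2 * B\<^sup>2 / (\<sigma> t)\<^sup>2"
      using param_pos(2)[of t] by (simp add: pos_le_divide_eq mult_left_le)
  qed simp
  also have "\<dots> = (2 * B\<^sup>2 + 8 * R\<^sup>2 * B\<^sup>2 * second_moment) / (\<sigma> t)\<^sup>2" by (simp add: add_divide_distrib)
  finally show "(\<integral>\<omega>. (linearized x t \<omega>)\<^sup>2 \<partial>M) \<le> (2 * B\<^sup>2 + 8 * R\<^sup>2 * B\<^sup>2 * second_moment) / (\<sigma> t)\<^sup>2" .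
qed

lemma predicted_abs_le:
  assumes \<omega>: "\<omega> \<in> space M"
  shows "\<bar>predicted x t \<omega>\<bar> \<le> B * (1 + 2 * R) * (\<integral>z. 1 + norm z \<partial>N) / \<sigma> t"
proof -
  let ?f = "\<lambda>z. J i (with_action i (closest_point (A i) (\<mu> t \<omega> + \<sigma> t *\<^sub>R z)) (a t \<omega>)) * (1 - inner z (\<mu> t \<omega> - x) / \<sigma> t)"
  have s: "0 < \<sigma> t" "\<sigma> t \<le> 1" using sigma_bounds[OF t] param_pos(2)[of t] by auto
  have le: "\<bar>?f z\<bar> \<le> (B * (1 + 2 * R) / \<sigma> t) * (1 + norm z)" for z
  proof -
    have "\<bar>inner z (\<mu> t \<omega> - x)\<bar> \<le> norm z * (2 * R)"
      using Cauchy_Schwarz_ineq2[of z "\<mu> t \<omega> - x"] mult_left_mono[OF dist_mu_x[OF \<omega>], of "norm z"] by simp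
    then have "\<bar>inner z (\<mu> t \<omega> - x) / \<sigma> t\<bar> \<le> norm z * (2 * R) / \<sigma> t"
      using s by (simp add: abs_divide divide_right_mono)
    then have "\<bar>1 - inner z (\<mu> t \<omega> - x) / \<sigma> t\<bar> \<le> 1 + norm z * (2 * R) / \<sigma> t" by linarith
    also have "\<dots> \<le> 1 / \<sigma> t + norm z * (2 * R) / \<sigma> t" using s by simp
    also have "\<dots> \<le> ((1 + 2 * R) / \<sigma> t) * (1 + norm z)"
      using s bounds_nonneg(4) by (simp add: field_simps)
    finally have "\<bar>1 - inner z (\<mu> t \<omega> - x) / \<sigma> t\<bar> \<le> ((1 + 2 * R) / \<sigma> t) * (1 + norm z)" .
    moreover have "\<bar>J i (with_action i (closest_point (A i) (\<mu> t \<omega> + \<sigma> t *\<^sub>R z)) (a t \<omega>))\<bar> \<le> B"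
      by (intro payoff_le_B joint_with_action joint_action \<omega> closest_point_in_set closed_A A_nonempty)
    ultimately have "\<bar>?f z\<bar> \<le> B * (((1 + 2 * R) / \<sigma> t) * (1 + norm z))"
      using bounds_nonneg unfolding abs_mult by (intro mult_mono) auto
    then show ?thesis by simp
  qed
  have i1: "integrable N (\<lambda>z. 1 + norm z)"
    by (rule integrable_std_normal_poly_growth[where C=1 and k=1]) auto
  have "\<bar>predicted x t \<omega>\<bar> \<le> (\<integral>z. (B * (1 + 2 * R) / \<sigma> t) * (1 + norm z) \<partial>N)"
    unfolding predicted_def using i1 le order_trans[OF abs_ge_zero le]
    by (intro integral_abs_bound[THEN order_trans] Bochner_Integration.integral_mono') auto
  then show ?thesis by simp
qed

text \<open>
  The first-order inequality of the smoothed cost, at the margin and sampling width of time \<open>t\<close>. The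
  exponent \<open>p\<close> is so large that the probability of leaving the action set is absorbed in the error of
  order \<open>\<sigma>\<^sup>2\<close>, even after division by \<open>\<sigma>\<close>.
\<close>

lemma predicted_le:
  assumes \<omega>: "\<omega> \<in> space M" and p: "3 * s \<le> (s - r) * real p"
  shows "predicted x t \<omega> \<le> cost x t \<omega> + error_const p / real t powr (2 * s)"
proof -
  define m where "m = lr / real t powr r"
  define C0 where "C0 = (2 * B + 2 * L * R + L) * (1 + 2 * R) * (\<integral>z. (1 + norm (z :: real ^ 'd)) ^ (p + 2) \<partial>N)"
  have C0: "0 \<le> C0" using bounds_nonneg unfolding C0_def by (intro mult_nonneg_nonneg integral_nonneg) auto
  have tp: "0 < real t" "1 \<le> real t" using t const_pos by auto
  have sg: "0 < \<sigma> t" "\<sigma> t \<le> 1" "ls / real t powr s \<le> \<sigma> t" "\<sigma> t \<le> us / real t powr s"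
    using sigma_bounds[OF t] param_pos(2)[of t] by auto
  have m: "0 < m" using const_pos tp by (simp add: m_def)
  have "predicted x t \<omega> \<le> cost x t \<omega> + (K + 2 * L) * (\<integral>z. (norm (z :: real ^ 'd))\<^sup>2 \<partial>N) * (\<sigma> t)\<^sup>2
      + (2 * B + 2 * L * R + L) * (1 + 2 * R) * (\<integral>z. (1 + norm (z :: real ^ 'd)) ^ (p + 2) \<partial>N) * (\<sigma> t / m) ^ p / \<sigma> t"
    unfolding predicted_def
  proof (rule perturbed_payoff_first_order_bound[where f="\<lambda>y. cost y t \<omega>"
        and G="\<lambda>y. pseudo_gradient J (with_action i y (a t \<omega>)) $ i"])
    show "continuous_on UNIV (\<lambda>y. cost y t \<omega>)"
      using has_derivative_continuous[OF with_action_has_derivative]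
      by (intro continuous_on_compose2[OF J_continuous] continuous_at_imp_continuous_on) auto
    show "cost y t \<omega> + inner (pseudo_gradient J (with_action i y (a t \<omega>)) $ i) (y' - y)
        \<le> cost y' t \<omega>" for y y'
      by (rule own_tangent[OF game])
    show "ball (\<mu> t \<omega>) m \<subseteq> A i" "\<mu> t \<omega> \<in> A i" unfolding m_def using mu_margin[OF t \<omega>] by auto
  qed (use compact_A convex_A smooth_K joint_action[OF \<omega>] payoff_le_B gradient_le_L joint_with_action norm_le_R bounds_nonneg x sg m in auto)
  also have "\<dots> = cost x t \<omega> + (K + 2 * L) * second_moment * (\<sigma> t)\<^sup>2 + C0 * ((\<sigma> t / m) ^ p / \<sigma> t)"
    by (simp add: second_moment_def C0_def)
  also have "\<dots> \<le> cost x t \<omega> + (K + 2 * L) * second_moment * (us\<^sup>2 / real t powr (2 * s))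
      + C0 * ((us / lr) ^ p / ls / real t powr (2 * s))"
  proof (intro add_mono mult_left_mono order_refl)
    have "(\<sigma> t)\<^sup>2 \<le> (us / real t powr s)\<^sup>2" using sg by (intro power_mono) auto
    also have "\<dots> = us\<^sup>2 / real t powr (2 * s)"
      using tp by (simp add: power_divide powr_powr powr_realpow[symmetric] mult.commute flip: powr_numeral)
    finally show "(\<sigma> t)\<^sup>2 \<le> us\<^sup>2 / real t powr (2 * s)" .
    have "\<sigma> t / m \<le> (us / real t powr s) / m" using sg m by (intro divide_right_mono) auto
    also have "\<dots> = (us / lr) * real t powr (r - s)"
      using tp const_pos by (simp add: m_def powr_diff field_simps)
    finally have "(\<sigma> t / m) ^ p \<le> ((us / lr) * real t powr (r - s)) ^ p"
      using sg m by (intro power_mono) auto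
    also have "\<dots> = (us / lr) ^ p * real t powr ((r - s) * real p)"
      unfolding power_mult_distrib using tp by (simp add: powr_powr[symmetric] powr_realpow)
    also have "\<dots> \<le> (us / lr) ^ p * real t powr (- (3 * s))"
      using tp p const_pos by (intro mult_left_mono powr_mono) (auto simp: algebra_simps)
    finally have 1: "(\<sigma> t / m) ^ p \<le> (us / lr) ^ p * real t powr (- (3 * s))" .
    have "(\<sigma> t / m) ^ p / \<sigma> t \<le> ((us / lr) ^ p * real t powr (- (3 * s))) / (ls / real t powr s)"
      using 1 sg m const_pos tp by (intro frac_le) auto
    also have "\<dots> = (us / lr) ^ p / ls * (real t powr (- (3 * s)) * real t powr s)"
      by (simp add: divide_inverse)
    also have "real t powr (- (3 * s)) * real t powr s = 1 / real t powr (2 * s)"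
      using tp by (simp add: powr_add[symmetric] powr_minus_divide[symmetric])
    finally show "(\<sigma> t / m) ^ p / \<sigma> t \<le> (us / lr) ^ p / ls / real t powr (2 * s)" by simp
  qed (use bounds_nonneg second_moment_nonneg C0 in auto)
  also have "\<dots> = cost x t \<omega> + ((K + 2 * L) * second_moment * us\<^sup>2 + C0 * (us / lr) ^ p / ls) / real t powr (2 * s)"
    by (simp add: add_divide_distrib)
  finally show ?thesis unfolding C0_def error_const_def .
qed

lemma noise_second_moment:
  "integrable M (\<lambda>\<omega>. (noise x t \<omega>)\<^sup>2)" "(\<integral>\<omega>. (noise x t \<omega>)\<^sup>2 \<partial>M) \<le> noise_const / (\<sigma> t)\<^sup>2"
proof -
  define c where "c = (B * (1 + 2 * R) * (\<integral>z. 1 + norm z \<partial>N) / \<sigma> t)\<^sup>2"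
  have le: "(noise x t \<omega>)\<^sup>2 \<le> 2 * (linearized x t \<omega>)\<^sup>2 + 2 * c" if "\<omega> \<in> space M" for \<omega>
  proof -
    have "(predicted x t \<omega>)\<^sup>2 \<le> c"
      unfolding c_def using power_mono[OF predicted_abs_le[OF that], of 2] by simp
    moreover have "(noise x t \<omega>)\<^sup>2 \<le> 2 * (linearized x t \<omega>)\<^sup>2 + 2 * (predicted x t \<omega>)\<^sup>2"
      using zero_le_power2[of "linearized x t \<omega> + predicted x t \<omega>"]
      unfolding noise_def power2_sum power2_diff by linarith
    ultimately show ?thesis by linarith
  qed
  have i: "integrable M (\<lambda>\<omega>. 2 * (linearized x t \<omega>)\<^sup>2 + 2 * c)"
    using linearized_second_moment(1) by simp
  have m: "(\<lambda>\<omega>. (noise x t \<omega>)\<^sup>2) \<in> borel_measurable M"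
    using measurable_F_M[OF noise_measurable] by measurable
  show i': "integrable M (\<lambda>\<omega>. (noise x t \<omega>)\<^sup>2)"
    by (rule Bochner_Integration.integrable_bound[OF i m]) (use le in \<open>auto intro!: AE_I2 simp: c_def\<close>)
  have "(\<integral>\<omega>. (noise x t \<omega>)\<^sup>2 \<partial>M) \<le> (\<integral>\<omega>. 2 * (linearized x t \<omega>)\<^sup>2 + 2 * c \<partial>M)"
    by (rule integral_mono[OF i' i le])
  also have "\<dots> = 2 * (\<integral>\<omega>. (linearized x t \<omega>)\<^sup>2 \<partial>M) + 2 * c"
    using linearized_second_moment(1) by (simp add: prob_space)
  also have "\<dots> \<le> 2 * ((2 * B\<^sup>2 + 8 * R\<^sup>2 * B\<^sup>2 * second_moment) / (\<sigma> t)\<^sup>2) + 2 * c"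
    by (intro add_mono mult_left_mono linearized_second_moment(2)) auto
  also have "\<dots> = noise_const / (\<sigma> t)\<^sup>2"
    by (simp add: noise_const_def c_def power_divide add_divide_distrib)
  finally show "(\<integral>\<omega>. (noise x t \<omega>)\<^sup>2 \<partial>M) \<le> noise_const / (\<sigma> t)\<^sup>2" .
qed

text \<open>
  The martingale property, in the form that makes noises of different rounds orthogonal.
\<close>

lemma noise_orthogonal:
  assumes W: "W \<in> borel_measurable (F t)" "integrable M (\<lambda>\<omega>. (W \<omega>)\<^sup>2)"
  shows "(\<integral>\<omega>. W \<omega> * noise x t \<omega> \<partial>M) = 0"
proof -
  have i: "integrable M (\<lambda>\<omega>. W \<omega> * linearized x t \<omega>)"
    by (intro integrable_mult_of_square_integrable measurable_F_M[OF W(1)] measurable_F_M[OF linearized_measurable]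
        W(2) linearized_second_moment(1))
  show ?thesis
    using conditional_mean[OF W(1) i] i by (simp add: noise_def right_diff_distrib)
qed

lemma noise_mean: "(\<integral>\<omega>. noise x t \<omega> \<partial>M) = 0"
  using noise_orthogonal[of "\<lambda>_. 1"] by simp

lemma noise_integrable: "integrable M (noise x t)"
  using square_integrable_imp_integrable[OF measurable_F_M[OF noise_measurable] noise_second_moment(1)] by simp

end

lemma payoff_lipschitz:
  assumes "b \<in> joint_actions A" "x \<in> A i" "y \<in> A i"
  shows "J i (with_action i y b) - J i (with_action i x b) \<le> L * norm (y - x)"
proof -
  have "J i (with_action i y b) + inner (pseudo_gradient J (with_action i y b) $ i) (x - y) \<le> J i (with_action i x b)"
    by (rule own_tangent[OF game])
  moreover have "inner (pseudo_gradient J (with_action i y b) $ i) (y - x) \<le> L * norm (y - x)"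
    by (rule order_trans[OF norm_cauchy_schwarz]) (intro mult_right_mono gradient_le_L joint_with_action assms norm_ge_zero)
  ultimately show ?thesis by (simp add: inner_diff_right)
qed

section \<open>Regret along a run\<close>

abbreviation run_regret :: "real ^ 'd \<Rightarrow> nat \<Rightarrow> 'w \<Rightarrow> real" where
  "run_regret x T \<omega> \<equiv> regret J i (\<lambda>t. a t \<omega>) T x"

abbreviation power_sums :: "real \<Rightarrow> nat \<Rightarrow> real" where
  "power_sums k T \<equiv> 1 + real T powr g + (\<Sum>t=1..T. 1 / real t powr (2 * s)) + k * (\<Sum>t=1..T. 1 / real t powr r)
         + (\<Sum>t=1..T. 1 / real t powr e)"

text \<open>
  The realized cost is the noise, plus its conditional mean, plus the linear term. The first-order
  inequality bounds the conditional mean, the projected step bounds the linear term.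
\<close>

lemma one_round_regret:
  assumes \<omega>: "\<omega> \<in> space M" and t: "t \<ge> t1" and x: "x \<in> A i" and x': "x' \<in> shrunk (\<rho> t) (A i)"
    and p: "predicted x' t \<omega> \<le> cost x' t \<omega> + Ce / real t powr (2 * s)"
  shows "J i (a t \<omega>) - cost x t \<omega> \<le> noise x' t \<omega> + Ce / real t powr (2 * s) + L * norm (x' - x)
     + ((norm (\<mu> t \<omega> - x'))\<^sup>2 - (norm (\<mu> (Suc t) \<omega> - x'))\<^sup>2) / (2 * \<gamma> t)
     + \<gamma> t * grad_sq t \<omega> + (ug * ue + 2) * R\<^sup>2 * ue / real t powr e"
proof -
  have tp: "1 \<le> real t" using t const_pos by auto
  have x'A: "x' \<in> A i" using x' by (simp add: shrunk_def)
  have "inner (grad_est t \<omega>) (\<mu> t \<omega> - x') \<le> ((norm (\<mu> t \<omega> - x'))\<^sup>2 - (norm (\<mu> (Suc t) \<omega> - x'))\<^sup>2) / (2 * \<gamma> t)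
      + \<gamma> t * grad_sq t \<omega> + (ug * ue + 2) * R\<^sup>2 * \<bar>\<epsilon> t\<bar>"
  proof (rule projected_step[OF closed_shrunk[OF closed_A] convex_shrunk[OF compact_A convex_A] x' param_pos(1)])
    show "norm (\<mu> t \<omega>) \<le> R" "norm x' \<le> R" using norm_le_R mu_margin(1)[OF t \<omega>] x'A by auto
    have "\<gamma> t \<le> ug / real t powr g" "\<bar>\<epsilon> t\<bar> \<le> ue / real t powr e" using gamma_bounds[OF t] eps_bound[OF t] by auto
    moreover have "ug / real t powr g \<le> ug" "ue / real t powr e \<le> ue"
      using tp rates const_pos by (auto simp: divide_le_eq ge_one_powr_ge_zero)
    ultimately show "\<gamma> t * \<bar>\<epsilon> t\<bar> \<le> ug * ue" using param_pos(1)[of t] const_pos by (intro mult_mono) auto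
    show "\<mu> (Suc t) \<omega> = closest_point (shrunk (\<rho> t) (A i)) (\<mu> t \<omega> - \<gamma> t *\<^sub>R (grad_est t \<omega> + \<epsilon> t *\<^sub>R \<mu> t \<omega>))"
      using mu_Suc[OF \<omega>] by (simp add: grad_est_def)
  qed
  moreover have "(ug * ue + 2) * R\<^sup>2 * \<bar>\<epsilon> t\<bar> \<le> (ug * ue + 2) * R\<^sup>2 * (ue / real t powr e)"
    using eps_bound[OF t] const_pos by (intro mult_left_mono mult_nonneg_nonneg) auto
  moreover have "cost x' t \<omega> - cost x t \<omega> \<le> L * norm (x' - x)"
    by (rule payoff_lipschitz[OF joint_action[OF \<omega>] x x'A])
  moreover have "J i (a t \<omega>) = noise x' t \<omega> + predicted x' t \<omega> + inner (grad_est t \<omega>) (\<mu> t \<omega> - x')"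
    by (simp add: noise_def linearized_def)
  ultimately show ?thesis using p by simp
qed

lemma noise_const_nonneg: "0 \<le> noise_const"
  using second_moment_nonneg by (simp add: noise_const_def)

text \<open>
  Here \<open>N'\<close> is the accumulated noise and \<open>Q\<close> the accumulated squared gradient estimates, weighted by the
  stepsizes. The point \<open>x0\<close> and the number \<open>k\<close> describe the comparators: at time \<open>t\<close> the reference
  point is moved towards \<open>x0\<close> by the proportion \<open>k / t powr r\<close>.
\<close>

lemma regret_decomposition:
  assumes x: "x \<in> A i" and x0: "x0 \<in> A i" and k: "0 \<le> k" and t2: "t2 \<ge> t1"
    and comp: "\<And>t. t \<ge> t2 \<Longrightarrow> k / real t powr r \<le> 1 \<and>
      (1 - k / real t powr r) *\<^sub>R x + (k / real t powr r) *\<^sub>R x0 \<in> shrunk (\<rho> t) (A i)"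
  obtains C and N' Q :: "nat \<Rightarrow> 'w \<Rightarrow> real" where "0 \<le> C"
    "\<And>T \<omega>. T \<ge> t2 \<Longrightarrow> \<omega> \<in> space M \<Longrightarrow> run_regret x T \<omega> \<le>
       C * power_sums k T + N' T \<omega> + Q T \<omega>"
    "\<And>T. integrable M (N' T)" "\<And>T. (\<integral>\<omega>. N' T \<omega> \<partial>M) = 0"
    "\<And>T. integrable M (\<lambda>\<omega>. (N' T \<omega>)\<^sup>2)" "\<And>T. T \<ge> t2 \<Longrightarrow> (\<integral>\<omega>. (N' T \<omega>)\<^sup>2 \<partial>M) \<le> C * real T powr (1 + 2 * s)"
    "\<And>T \<omega>. 0 \<le> Q T \<omega>" "\<And>T. integrable M (Q T)"
    "\<And>T. (\<integral>\<omega>. Q T \<omega> \<partial>M) \<le> C * (\<Sum>t=1..T. 1 / real t powr (g - 2 * s))"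
proof -
  define c where "c t = k / real t powr r" for t
  define x' where "x' t = (1 - c t) *\<^sub>R x + c t *\<^sub>R x0" for t
  have tpos: "1 \<le> t" "1 \<le> real t" "t1 \<le> t" if "t \<ge> t2" for t using that t2 const_pos by auto
  have c: "0 \<le> c t" "c t \<le> 1" "x' t \<in> shrunk (\<rho> t) (A i)" if "t \<ge> t2" for t
    using comp[OF that] k by (auto simp: c_def x'_def)
  have x'A: "x' t \<in> A i" if "t \<ge> t2" for t using c(3)[OF that] by (simp add: shrunk_def)
  have xx0: "norm (x0 - x) \<le> 2 * R" using norm_triangle_ineq4[of x0 x] norm_le_R[OF x] norm_le_R[OF x0] by simp
  have c_decr: "c (Suc t) \<le> c t" if "t \<ge> t2" for t
    unfolding c_def using k tpos[OF that] rates by (intro divide_left_mono powr_mono2) auto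
  obtain p :: nat where p: "3 * s \<le> (s - r) * real p"
  proof -
    obtain p :: nat where "3 * s / (s - r) \<le> real p" using real_arch_simple by blast
    then have "3 * s \<le> (s - r) * real p" using rates by (simp add: pos_divide_le_eq mult.commute)
    then show ?thesis by (rule that)
  qed
  define Ce where "Ce = error_const p"
  have Ce: "0 \<le> Ce"
    unfolding Ce_def error_const_def using bounds_nonneg second_moment_nonneg const_pos
    by (intro add_nonneg_nonneg divide_nonneg_nonneg mult_nonneg_nonneg integral_nonneg) auto
  define Ee where "Ee = (ug * ue + 2) * R\<^sup>2 * ue"
  have Ee: "0 \<le> Ee" unfolding Ee_def using const_pos by simp
  define N' where "N' T \<omega> = (\<Sum>t=t2..T. noise (x' t) t \<omega>)" for T \<omega>
  define Q where "Q T \<omega> = (\<Sum>t=t2..T. \<gamma> t * grad_sq t \<omega>)" for T \<omega>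
  define D where "D = 4 * R\<^sup>2 + 8 * R\<^sup>2"
  define C where "C = 2 * B * real t2 + D / (2 * lg) + Ce + 2 * L * R + Ee + noise_const / ls\<^sup>2 + ug * (B\<^sup>2 * second_moment / ls\<^sup>2)"
  have parts: "0 \<le> 2 * B * real t2" "0 \<le> D / (2 * lg)" "0 \<le> 2 * L * R" "0 \<le> noise_const / ls\<^sup>2" "0 \<le> ug * (B\<^sup>2 * second_moment / ls\<^sup>2)"
    using bounds_nonneg const_pos second_moment_nonneg noise_const_nonneg by (auto simp: D_def)
  have C_ge: "0 \<le> C" "2 * B * real t2 \<le> C" "D / (2 * lg) \<le> C" "Ce \<le> C" "2 * L * R \<le> C" "Ee \<le> C" "noise_const / ls\<^sup>2 \<le> C"
    "ug * (B\<^sup>2 * second_moment / ls\<^sup>2) \<le> C"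
    using parts Ce Ee unfolding C_def by linarith+
  have sum_le: "(\<Sum>t=t2..T. h t) \<le> (\<Sum>t=1..T. h t)" if "\<And>t. 0 \<le> h t" for h :: "nat \<Rightarrow> real" and T
    using that t2 const_pos by (intro sum_mono2) auto
  have inv_sq: "1 / (\<sigma> t)\<^sup>2 \<le> real t powr (2 * s) / ls\<^sup>2" if "t \<ge> t1" for t
  proof -
    have tp: "0 < real t" using that const_pos by auto
    have "(ls / real t powr s)\<^sup>2 \<le> (\<sigma> t)\<^sup>2" using sigma_bounds[OF that] const_pos by (intro power_mono) auto
    then have "1 / (\<sigma> t)\<^sup>2 \<le> 1 / (ls / real t powr s)\<^sup>2"
      using tp const_pos by (intro divide_left_mono) (auto intro!: mult_pos_pos param_pos)
    also have "\<dots> = real t powr (2 * s) / ls\<^sup>2"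
      using tp by (simp add: power_divide power2_eq_square powr_add[symmetric])
    finally show ?thesis .
  qed
  show thesis
  proof (rule that[of C N' Q])
    show "0 \<le> C" by (rule C_ge)
    fix T \<omega> assume T: "T \<ge> t2" and \<omega>: "\<omega> \<in> space M"
    define d where "d t = J i (a t \<omega>) - cost x t \<omega>" for t
    \<comment> \<open>The second summand absorbs the motion of the comparator: moving it changes the squared distance by
      at most \<open>4 * R\<close> times its displacement, which is at most \<open>2 * R * (c t - c (Suc t))\<close>.\<close>
    define \<Psi> where "\<Psi> t = (norm (\<mu> t \<omega> - x' t))\<^sup>2 + 8 * R\<^sup>2 * c t" for t
    let ?\<Delta> = "\<lambda>t. (\<Psi> t - \<Psi> (Suc t)) / (2 * \<gamma> t)"
    have step: "d t \<le> noise (x' t) t \<omega> + Ce / real t powr (2 * s) + 2 * L * R * c t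
        + ?\<Delta> t + \<gamma> t * grad_sq t \<omega> + Ee / real t powr e" if t: "t \<ge> t2" for t
    proof -
      note t' = tpos(3)[OF t]
      have St: "t2 \<le> Suc t" "t1 \<le> Suc t" using t t' by auto
      have "x' t - x = c t *\<^sub>R (x0 - x)" by (simp add: x'_def algebra_simps)
      then have "norm (x' t - x) = c t * norm (x0 - x)" using c(1)[OF t] by simp
      also have "\<dots> \<le> c t * (2 * R)" using xx0 c(1)[OF t] by (intro mult_left_mono) auto
      finally have "L * norm (x' t - x) \<le> L * (c t * (2 * R))" using bounds_nonneg by (intro mult_left_mono) auto
      then have 1: "L * norm (x' t - x) \<le> 2 * L * R * c t" by (simp only: mult_ac)
      have nS: "norm (\<mu> (Suc t) \<omega> - x' t') \<le> 2 * R" if "t' \<ge> t2" for t'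
        by (rule dist_mu_x[OF St(2) x'A[OF that] \<omega>])
      have "x' (Suc t) - x' t = (c t - c (Suc t)) *\<^sub>R (x - x0)" by (simp add: x'_def algebra_simps)
      then have "norm (x' (Suc t) - x' t) = (c t - c (Suc t)) * norm (x - x0)" using c_decr[OF t] by simp
      also have "\<dots> \<le> (c t - c (Suc t)) * (2 * R)"
        using xx0 c_decr[OF t] by (intro mult_left_mono) (auto simp: norm_minus_commute)
      finally have dx: "norm (x' (Suc t) - x' t) \<le> (c t - c (Suc t)) * (2 * R)" .
      define u v where "u = norm (\<mu> (Suc t) \<omega> - x' (Suc t))" and "v = norm (\<mu> (Suc t) \<omega> - x' t)"
      have uv: "u - v \<le> (c t - c (Suc t)) * (2 * R)" "0 \<le> u" "u \<le> 2 * R" "0 \<le> v" "v \<le> 2 * R"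
        using norm_triangle_ineq2[of "\<mu> (Suc t) \<omega> - x' (Suc t)" "\<mu> (Suc t) \<omega> - x' t"] dx nS[OF St(1)] nS[OF t]
        by (auto simp: u_def v_def norm_minus_commute)
      have "u\<^sup>2 - v\<^sup>2 = (u + v) * (u - v)" by (simp add: power2_eq_square algebra_simps)
      also have "\<dots> \<le> (u + v) * ((c t - c (Suc t)) * (2 * R))" using uv by (intro mult_left_mono) auto
      also have "\<dots> \<le> (4 * R) * ((c t - c (Suc t)) * (2 * R))"
        using uv c_decr[OF t] bounds_nonneg by (intro mult_right_mono) auto
      finally have "u\<^sup>2 - v\<^sup>2 \<le> 8 * R\<^sup>2 * (c t - c (Suc t))" by (simp add: power2_eq_square algebra_simps)
      then have "(norm (\<mu> t \<omega> - x' t))\<^sup>2 - v\<^sup>2 \<le> \<Psi> t - \<Psi> (Suc t)"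
        by (simp add: \<Psi>_def u_def algebra_simps)
      then have "((norm (\<mu> t \<omega> - x' t))\<^sup>2 - v\<^sup>2) / (2 * \<gamma> t) \<le> ?\<Delta> t"
        using param_pos(1)[of t] by (intro divide_right_mono) auto
      with one_round_regret[OF \<omega> t' x c(3)[OF t] predicted_le[OF t' x'A[OF t] \<omega> p, folded Ce_def]] 1
      show ?thesis unfolding d_def v_def Ee_def by simp
    qed
    have d2B: "\<bar>d t\<bar> \<le> 2 * B" for t
      using payoff_le_B[OF joint_action[OF \<omega>, of t]] payoff_le_B[OF joint_with_action[OF joint_action[OF \<omega>, of t] x]]
      by (simp add: d_def)
    have tel: "(\<Sum>t=t2..T. ?\<Delta> t) \<le> D / (2 * lg) * real T powr g"
    proof -
      have "(\<Sum>t=t2..T. ?\<Delta> t) \<le> D / (2 * \<gamma> T)"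
      proof (rule telescoping_stepsizes[OF _ param_pos(1) _ T])
        fix t assume t: "t \<ge> t2"
        show "\<gamma> (Suc t) \<le> \<gamma> t" using gamma_decr[OF tpos(3)[OF t]] .
        have "(norm (\<mu> t \<omega> - x' t))\<^sup>2 \<le> (2 * R)\<^sup>2"
          by (intro power_mono dist_mu_x[OF tpos(3)[OF t] x'A[OF t] \<omega>]) simp
        moreover have "8 * R\<^sup>2 * c t \<le> 8 * R\<^sup>2 * 1" using c[OF t] by (intro mult_left_mono) auto
        ultimately show "0 \<le> \<Psi> t \<and> \<Psi> t \<le> D" using c(1)[OF t] by (simp add: \<Psi>_def D_def)
      qed
      also have "\<dots> \<le> D / (2 * (lg / real T powr g))"
        using gamma_bounds[OF tpos(3)[OF T]] param_pos(1)[of T] tpos[OF T] const_pos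
        by (intro divide_left_mono) (auto simp: D_def)
      finally show ?thesis by simp
    qed
    have "run_regret x T \<omega> = (\<Sum>t=1..T. d t)" by (simp add: regret_def d_def sum_subtractf)
    also have "\<dots> = (\<Sum>t=1..<t2. d t) + (\<Sum>t=t2..T. d t)"
    proof -
      have "{1..T} = {1..<t2} \<union> {t2..T}" using T tpos[OF order_refl] by auto
      then show ?thesis by (simp add: sum.union_disjoint ivl_disj_int)
    qed
    also have "(\<Sum>t=1..<t2. d t) \<le> (\<Sum>t=1..<t2. 2 * B)" using d2B by (intro sum_mono) (simp add: abs_le_iff)
    also have "\<dots> = 2 * B * real (t2 - 1)" by (simp add: mult.commute)
    also have "\<dots> \<le> 2 * B * real t2" using bounds_nonneg by (intro mult_left_mono) auto
    also have "(\<Sum>t=t2..T. d t) \<le> (\<Sum>t=t2..T. noise (x' t) t \<omega> + Ce / real t powr (2 * s) + 2 * L * R * c t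
        + ?\<Delta> t + \<gamma> t * grad_sq t \<omega> + Ee / real t powr e)"
      using step by (intro sum_mono) auto
    also have "\<dots> = N' T \<omega> + Ce * (\<Sum>t=t2..T. 1 / real t powr (2 * s)) + (2 * L * R * k) * (\<Sum>t=t2..T. 1 / real t powr r)
        + (\<Sum>t=t2..T. ?\<Delta> t) + Q T \<omega> + Ee * (\<Sum>t=t2..T. 1 / real t powr e)"
      by (simp add: sum.distrib N'_def Q_def c_def sum_distrib_left)
    also have "\<dots> \<le> N' T \<omega> + Ce * (\<Sum>t=1..T. 1 / real t powr (2 * s)) + (2 * L * R * k) * (\<Sum>t=1..T. 1 / real t powr r)
        + D / (2 * lg) * real T powr g + Q T \<omega> + Ee * (\<Sum>t=1..T. 1 / real t powr e)"
      using tel Ce Ee k bounds_nonneg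
      by (intro add_mono mult_left_mono sum_le order_refl) auto
    also have "2 * B * real t2 + \<dots> \<le> C * 1 + (N' T \<omega> + C * (\<Sum>t=1..T. 1 / real t powr (2 * s)) + (C * k) * (\<Sum>t=1..T. 1 / real t powr r)
        + C * real T powr g + Q T \<omega> + C * (\<Sum>t=1..T. 1 / real t powr e))"
      using C_ge k by (intro add_mono mult_right_mono order_refl sum_nonneg) auto
    finally show "run_regret x T \<omega> \<le>
       C * power_sums k T + N' T \<omega> + Q T \<omega>"
      by (simp add: algebra_simps)
  next
    fix T
    show "integrable M (N' T)" unfolding N'_def
      using noise_integrable[OF tpos(3) x'A] by (intro Bochner_Integration.integrable_sum) auto
    show "(\<integral>\<omega>. N' T \<omega> \<partial>M) = 0" unfolding N'_def
      using noise_integrable[OF tpos(3) x'A] noise_mean[OF tpos(3) x'A]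
      by (subst Bochner_Integration.integral_sum) auto
    have orth: "(\<integral>\<omega>. noise (x' t) t \<omega> * noise (x' t') t' \<omega> \<partial>M) = 0" if "t2 \<le> t" "t < t'" for t t'
    proof (rule noise_orthogonal)
      show "noise (x' t) t \<in> borel_measurable (F t')"
        using measurable_F_mono[OF noise_measurable, of t t'] that by simp
      show "integrable M (\<lambda>\<omega>. (noise (x' t) t \<omega>)\<^sup>2)"
        using that by (intro noise_second_moment(1) tpos(3) x'A)
    qed (use that tpos(3)[of t'] x'A[of t'] in auto)
    have sec: "(\<integral>\<omega>. (noise (x' t) t \<omega>)\<^sup>2 \<partial>M) \<le> noise_const / ls\<^sup>2 * real T powr (2 * s)" if "t \<in> {t2..T}" for t
    proof -
      have t: "t \<ge> t2" using that by simp
      have "(\<integral>\<omega>. (noise (x' t) t \<omega>)\<^sup>2 \<partial>M) \<le> noise_const * (1 / (\<sigma> t)\<^sup>2)"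
        using noise_second_moment(2)[OF tpos(3)[OF t] x'A[OF t]] by simp
      also have "\<dots> \<le> noise_const * (real t powr (2 * s) / ls\<^sup>2)"
        using inv_sq[OF tpos(3)[OF t]] noise_const_nonneg by (intro mult_left_mono)
      also have "\<dots> \<le> noise_const * (real T powr (2 * s) / ls\<^sup>2)"
        using that rates noise_const_nonneg by (intro mult_left_mono divide_right_mono powr_mono2) auto
      finally show ?thesis by simp
    qed
    note osm = orthogonal_sum_second_moment[of "{t2..T}" "\<lambda>t. noise (x' t) t" M "\<lambda>t. noise_const / ls\<^sup>2 * real T powr (2 * s)"]
    have pre: "\<And>t. t \<in> {t2..T} \<Longrightarrow> noise (x' t) t \<in> borel_measurable M"
      "\<And>t. t \<in> {t2..T} \<Longrightarrow> integrable M (\<lambda>\<omega>. (noise (x' t) t \<omega>)\<^sup>2)"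
      using noise_second_moment(1)[OF tpos(3) x'A] measurable_F_M[OF noise_measurable] by auto
    show "integrable M (\<lambda>\<omega>. (N' T \<omega>)\<^sup>2)" unfolding N'_def
      by (rule osm(1)) (use pre orth sec in auto)
    have "(\<integral>\<omega>. (N' T \<omega>)\<^sup>2 \<partial>M) \<le> (\<Sum>t=t2..T. noise_const / ls\<^sup>2 * real T powr (2 * s))" unfolding N'_def
      by (rule osm(2)) (use pre orth sec in auto)
    also have "\<dots> = real (card {t2..T}) * (noise_const / ls\<^sup>2 * real T powr (2 * s))" by simp
    also have "\<dots> \<le> real T * (C * real T powr (2 * s))"
      using C_ge noise_const_nonneg tpos[of t2] by (intro mult_mono mult_right_mono mult_nonneg_nonneg) auto
    finally have *: "(\<integral>\<omega>. (N' T \<omega>)\<^sup>2 \<partial>M) \<le> real T * (C * real T powr (2 * s))" .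
    show "(\<integral>\<omega>. (N' T \<omega>)\<^sup>2 \<partial>M) \<le> C * real T powr (1 + 2 * s)"
      using * by (simp add: powr_add mult_ac)
    show "0 \<le> Q T \<omega>" for \<omega> unfolding Q_def using param_pos(1) by (intro sum_nonneg mult_nonneg_nonneg) (auto intro: less_imp_le)
    show "integrable M (Q T)" unfolding Q_def
      using grad_est_second_moment(1) by (intro Bochner_Integration.integrable_sum integrable_mult_right)
    have "(\<integral>\<omega>. Q T \<omega> \<partial>M) = (\<Sum>t=t2..T. \<gamma> t * (\<integral>\<omega>. grad_sq t \<omega> \<partial>M))" unfolding Q_def
      using grad_est_second_moment(1) by (subst Bochner_Integration.integral_sum) auto
    also have "\<dots> \<le> (\<Sum>t=t2..T. C * (1 / real t powr (g - 2 * s)))"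
    proof (rule sum_mono)
      fix t assume "t \<in> {t2..T}"
      then have t: "t \<ge> t2" by simp
      have "\<gamma> t * (\<integral>\<omega>. grad_sq t \<omega> \<partial>M) \<le> (ug / real t powr g) * (B\<^sup>2 * second_moment * (real t powr (2 * s) / ls\<^sup>2))"
      proof (intro mult_mono)
        have "(\<integral>\<omega>. grad_sq t \<omega> \<partial>M) \<le> B\<^sup>2 * second_moment * (1 / (\<sigma> t)\<^sup>2)"
          using grad_est_second_moment(2)[of t] by simp
        also have "\<dots> \<le> B\<^sup>2 * second_moment * (real t powr (2 * s) / ls\<^sup>2)"
          using inv_sq[OF tpos(3)[OF t]] second_moment_nonneg by (intro mult_left_mono) auto
        finally show "(\<integral>\<omega>. grad_sq t \<omega> \<partial>M) \<le> B\<^sup>2 * second_moment * (real t powr (2 * s) / ls\<^sup>2)" .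
      qed (use gamma_bounds[OF tpos(3)[OF t]] const_pos in auto)
      also have "\<dots> = ug * (B\<^sup>2 * second_moment / ls\<^sup>2) * (real t powr (2 * s) / real t powr g)" by (simp add: mult_ac)
      also have "real t powr (2 * s) / real t powr g = 1 / real t powr (g - 2 * s)"
        using tpos[OF t] by (simp add: powr_diff)
      also have "ug * (B\<^sup>2 * second_moment / ls\<^sup>2) * (1 / real t powr (g - 2 * s)) \<le> C * (1 / real t powr (g - 2 * s))"
        using C_ge by (intro mult_right_mono) auto
      finally show "\<gamma> t * (\<integral>\<omega>. grad_sq t \<omega> \<partial>M) \<le> C * (1 / real t powr (g - 2 * s))" .
    qed
    also have "\<dots> \<le> (\<Sum>t=1..T. C * (1 / real t powr (g - 2 * s)))"
      by (rule sum_le) (use C_ge in auto)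
    finally show "(\<integral>\<omega>. Q T \<omega> \<partial>M) \<le> C * (\<Sum>t=1..T. 1 / real t powr (g - 2 * s))"
      by (simp add: sum_distrib_left)
  qed
qed

section \<open>Rates and almost sure convergence of the average regret\<close>

text \<open>
  A point of the interior has a ball around it in the action set and lies in the shrunk set from some
  time on. A point of the frontier is moved towards the centre of a ball of radius \<open>d\<close>; the proportion
  \<open>(ur / d) / t powr r\<close> is enough for the upper bound on \<open>\<rho> t\<close>.
\<close>

lemma comparator_exists:
  assumes x: "x \<in> A i"
  obtains x0 k t2 where "x0 \<in> A i" "0 \<le> k" "x \<notin> frontier (A i) \<Longrightarrow> k = 0" "t2 \<ge> t1"
    "\<And>t. t \<ge> t2 \<Longrightarrow> k / real t powr r \<le> 1 \<and>
      (1 - k / real t powr r) *\<^sub>R x + (k / real t powr r) *\<^sub>R x0 \<in> shrunk (\<rho> t) (A i)"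
proof (cases "x \<in> frontier (A i)")
  case False
  then have "x \<in> interior (A i)" using x closure_subset by (auto simp: frontier_def)
  then obtain d where d: "d > 0" "ball x d \<subseteq> A i" using mem_interior by blast
  from eventually_inverse_powr_le[OF rates(4) d(1), of ur]
  obtain t0 where t0: "\<And>t. t \<ge> t0 \<Longrightarrow> ur / real t powr r \<le> d" unfolding eventually_sequentially by blast
  show thesis
  proof (rule that[of x 0 "max t0 t1"])
    fix t assume "max t0 t1 \<le> t"
    then have "\<rho> t \<le> d" using t0[of t] rho_upper[of t] by auto
    then have "ball x (\<rho> t) \<subseteq> A i" using d(2) subset_ball by blast
    then show "0 / real t powr r \<le> 1 \<and> (1 - 0 / real t powr r) *\<^sub>R x + (0 / real t powr r) *\<^sub>R x \<in> shrunk (\<rho> t) (A i)"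
      using x unfolding shrunk_eq_ball_subset[OF compact_A] by simp
  qed (use x in auto)
next
  case True
  obtain x0 where "x0 \<in> interior (A i)" using game unfolding convex_game_def by blast
  then obtain d where d: "d > 0" "ball x0 d \<subseteq> A i" using mem_interior by blast
  from eventually_inverse_powr_le[OF rates(4) zero_less_one, of "ur / d"]
  obtain t0 where t0: "\<And>t. t \<ge> t0 \<Longrightarrow> ur / d / real t powr r \<le> 1" unfolding eventually_sequentially by blast
  show thesis
  proof (rule that[of x0 "ur / d" "max t0 t1"])
    fix t assume t: "max t0 t1 \<le> t"
    have "\<rho> t \<le> ur / d / real t powr r * d" using rho_upper[of t] t d by simp
    then show "ur / d / real t powr r \<le> 1 \<and>
       (1 - ur / d / real t powr r) *\<^sub>R x + (ur / d / real t powr r) *\<^sub>R x0 \<in> shrunk (\<rho> t) (A i)"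
      using t0[of t] t d const_pos
      by (intro conjI contraction_in_shrunk[OF compact_A convex_A x d(2) d(1)]) auto
  qed (use True d const_pos in auto)
qed

text \<open>
  The part of the final rate that bounds the deterministic contributions.
\<close>

definition rate :: "real ^ 'd \<Rightarrow> nat \<Rightarrow> real" where
  "rate x T = 1 / real T powr (1 - g) + 1 / real T powr (2 * s)
     + 1 / real T powr r * indicator (frontier (A i)) x + 1 / real T powr e"

lemma rate_nonneg: "0 \<le> rate x T"
  by (simp add: rate_def)

lemma rate_tendsto_0: "rate x \<longlonglongrightarrow> 0"
proof -
  have "(\<lambda>T. 1 / real T powr (1 - g) + 1 / real T powr (2 * s)
     + 1 / real T powr r * indicator (frontier (A i)) x + 1 / real T powr e) \<longlonglongrightarrow> 0 + 0 + 0 * indicator (frontier (A i)) x + 0"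
    using rates by (intro tendsto_add tendsto_mult inverse_powr_tendsto_0 tendsto_const) auto
  then show ?thesis by (simp add: rate_def[abs_def])
qed

text \<open>
  The sum of \<open>1 / t powr e\<close> is not of order \<open>T powr (1 - e)\<close> when \<open>e \<ge> 1\<close>. It is therefore estimated
  with the smaller exponent \<open>min e (1 - g)\<close>, and the additional error is covered by \<open>1 / T powr (1 - g)\<close>.
\<close>

lemma average_le_rate:
  assumes k: "0 \<le> k" "x \<notin> frontier (A i) \<Longrightarrow> k = 0"
  obtains C where "0 \<le> C" "\<And>T. T \<ge> 1 \<Longrightarrow>
    power_sums k T \<le> C * (real T * rate x T)"
proof -
  define e' where "e' = min e (1 - g)"
  have e': "0 < e'" "e' < 1" "e' \<le> e" "e' \<le> 1 - g" using rates by (auto simp: e'_def)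
  have small: "2 * s < 1" "r < 1" using rates by linarith+
  define C where "C = 2 + 1 / (1 - 2 * s) + k / (1 - r) + 1 / (1 - e')"
  have C: "2 + 1 / (1 - e') \<le> C" "1 / (1 - 2 * s) \<le> C" "k / (1 - r) \<le> C" "1 / (1 - e') \<le> C" "0 \<le> C"
    using small e' k by (auto simp: C_def)
  show thesis
  proof (rule that[OF C(5)])
    fix T :: nat assume T: "T \<ge> 1"
    have split: "real T powr (1 - q) = real T * (1 / real T powr q)" for q using T by (simp add: powr_diff)
    let ?g = "real T * (1 / real T powr (1 - g))"
    let ?s = "real T * (1 / real T powr (2 * s))"
    let ?r = "real T * (1 / real T powr r * indicator (frontier (A i)) x)"
    let ?e = "real T * (1 / real T powr e)"
    have a: "1 + real T powr g \<le> 2 * ?g"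
    proof -
      have "1 \<le> real T powr g" using T rates by (simp add: ge_one_powr_ge_zero)
      then show ?thesis using split[of "1 - g"] by simp
    qed
    have b: "(\<Sum>t=1..T. 1 / real t powr (2 * s)) \<le> 1 / (1 - 2 * s) * ?s"
      using sum_inverse_powr_le[of "2 * s" T] small rates by (simp add: split mult_ac)
    have c: "k * (\<Sum>t=1..T. 1 / real t powr r) \<le> k / (1 - r) * ?r"
    proof (cases "x \<in> frontier (A i)")
      case True
      have "k * (\<Sum>t=1..T. 1 / real t powr r) \<le> k * (real T powr (1 - r) / (1 - r))"
        using sum_inverse_powr_le[of r T] small rates k by (intro mult_left_mono) auto
      then show ?thesis using True by (simp add: split mult_ac)
    qed (use k in auto)
    have d: "(\<Sum>t=1..T. 1 / real t powr e) \<le> 1 / (1 - e') * (?e + ?g)"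
    proof -
      have "(\<Sum>t=1..T. 1 / real t powr e) \<le> (\<Sum>t=1..T. 1 / real t powr e')"
        using e' by (intro sum_mono divide_left_mono powr_mono) auto
      also have "\<dots> \<le> 1 / (1 - e') * (real T * (1 / real T powr e'))"
        using sum_inverse_powr_le[of e' T] e' by (simp add: split mult_ac)
      also have "\<dots> \<le> 1 / (1 - e') * (?e + ?g)"
        using e'(2) by (intro mult_left_mono) (auto simp: e'_def min_def)
      finally show ?thesis .
    qed
    have "power_sums k T
      \<le> (2 + 1 / (1 - e')) * ?g + 1 / (1 - 2 * s) * ?s
        + k / (1 - r) * ?r + 1 / (1 - e') * ?e"
      using a b c d unfolding distrib_left distrib_right by linarith
    also have "\<dots> \<le> C * ?g + C * ?s
        + C * ?r + C * ?e"
      using C by (intro add_mono mult_right_mono) auto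
    also have "\<dots> = C * (real T * rate x T)" by (simp add: rate_def algebra_simps)
    finally show "power_sums k T \<le> C * (real T * rate x T)" .
  qed
qed

lemma average_regret_decomposition:
  assumes x: "x \<in> A i"
  obtains C t2 and N' Q :: "nat \<Rightarrow> 'w \<Rightarrow> real" where "0 \<le> C" "1 \<le> t2"
    "\<And>T \<omega>. T \<ge> t2 \<Longrightarrow> \<omega> \<in> space M \<Longrightarrow> run_regret x T \<omega> / real T \<le> C * rate x T + N' T \<omega> + Q T \<omega>"
    "\<And>T. integrable M (N' T)" "\<And>T. (\<integral>\<omega>. N' T \<omega> \<partial>M) = 0"
    "\<And>T. integrable M (\<lambda>\<omega>. (N' T \<omega>)\<^sup>2)" "\<And>T. T \<ge> t2 \<Longrightarrow> (\<integral>\<omega>. (N' T \<omega>)\<^sup>2 \<partial>M) \<le> C / real T powr (1 - 2 * s)"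
    "\<And>T \<omega>. 0 \<le> Q T \<omega>" "\<And>T. integrable M (Q T)"
    "\<And>T. T \<ge> t2 \<Longrightarrow> (\<integral>\<omega>. Q T \<omega> \<partial>M) \<le> C / real T powr (g - 2 * s)"
proof -
  obtain x0 k t2 where k: "x0 \<in> A i" "0 \<le> k" "x \<notin> frontier (A i) \<Longrightarrow> k = 0" "t2 \<ge> t1"
    "\<And>t. t \<ge> t2 \<Longrightarrow> k / real t powr r \<le> 1 \<and>
      (1 - k / real t powr r) *\<^sub>R x + (k / real t powr r) *\<^sub>R x0 \<in> shrunk (\<rho> t) (A i)"
    using comparator_exists[OF x] by metis
  obtain C1 N1 Q1 where C1: "0 \<le> C1"
    and reg: "\<And>T \<omega>. T \<ge> t2 \<Longrightarrow> \<omega> \<in> space M \<Longrightarrow> run_regret x T \<omega> \<le>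
       C1 * power_sums k T + N1 T \<omega> + Q1 T \<omega>"
    and N1: "\<And>T. integrable M (N1 T)" "\<And>T. (\<integral>\<omega>. N1 T \<omega> \<partial>M) = 0"
    "\<And>T. integrable M (\<lambda>\<omega>. (N1 T \<omega>)\<^sup>2)" "\<And>T. T \<ge> t2 \<Longrightarrow> (\<integral>\<omega>. (N1 T \<omega>)\<^sup>2 \<partial>M) \<le> C1 * real T powr (1 + 2 * s)"
    and Q1: "\<And>T \<omega>. 0 \<le> Q1 T \<omega>" "\<And>T. integrable M (Q1 T)"
    "\<And>T. (\<integral>\<omega>. Q1 T \<omega> \<partial>M) \<le> C1 * (\<Sum>t=1..T. 1 / real t powr (g - 2 * s))"
    using regret_decomposition[OF x k(1,2,4,5)] by blast
  obtain C2 where C2: "0 \<le> C2" "\<And>T. T \<ge> 1 \<Longrightarrow>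
    power_sums k T \<le> C2 * (real T * rate x T)"
    using average_le_rate[OF k(2,3)] by blast
  define p where "p = g - 2 * s"
  have p: "0 < p" "p < 1" using rates by (auto simp: p_def)
  define C where "C = C1 * C2 + C1 + C1 / (1 - p)"
  have C: "0 \<le> C" "C1 * C2 \<le> C" "C1 \<le> C" "C1 / (1 - p) \<le> C"
    using C1 C2(1) p by (auto simp: C_def)
  have t2: "1 \<le> t2" using k(4) const_pos by simp
  show thesis
  proof (rule that[of C t2 "\<lambda>T \<omega>. N1 T \<omega> / real T" "\<lambda>T \<omega>. Q1 T \<omega> / real T"])
    fix T \<omega> assume T: "T \<ge> t2" and \<omega>: "\<omega> \<in> space M"
    have Tp: "T \<ge> 1" "0 < real T" using T t2 by auto
    have "run_regret x T \<omega> \<le> C1 * (C2 * (real T * rate x T)) + N1 T \<omega> + Q1 T \<omega>"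
      using reg[OF T \<omega>] mult_left_mono[OF C2(2)[OF Tp(1)] C1] by linarith
    also have "C1 * (C2 * (real T * rate x T)) \<le> C * (real T * rate x T)"
      using C(2) rate_nonneg[of x T] by (simp add: mult.assoc[symmetric] mult_right_mono)
    finally have "run_regret x T \<omega> / real T \<le> (C * (real T * rate x T) + N1 T \<omega> + Q1 T \<omega>) / real T"
      using Tp by (intro divide_right_mono) auto
    then show "run_regret x T \<omega> / real T \<le> C * rate x T + N1 T \<omega> / real T + Q1 T \<omega> / real T"
      using Tp by (simp add: add_divide_distrib)
  next
    fix T assume T: "T \<ge> t2"
    have Tp: "T \<ge> 1" "0 < real T" using T t2 by auto
    have "(\<integral>\<omega>. (N1 T \<omega> / real T)\<^sup>2 \<partial>M) = (\<integral>\<omega>. (N1 T \<omega>)\<^sup>2 \<partial>M) / (real T)\<^sup>2"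
      by (simp add: power_divide)
    also have "\<dots> \<le> C1 * real T powr (1 + 2 * s) / (real T)\<^sup>2"
      using N1(4)[OF T] by (intro divide_right_mono) auto
    also have "\<dots> = C1 / real T powr (1 - 2 * s)"
    proof -
      have "real T powr (1 + 2 * s) * real T powr (1 - 2 * s) = real T powr 2"
        by (simp only: powr_add[symmetric]) simp
      also have "\<dots> = (real T)\<^sup>2" using Tp by simp
      finally show ?thesis using Tp by (simp add: field_simps)
    qed
    also have "\<dots> \<le> C / real T powr (1 - 2 * s)" using C(3) by (intro divide_right_mono) auto
    finally show "(\<integral>\<omega>. (N1 T \<omega> / real T)\<^sup>2 \<partial>M) \<le> C / real T powr (1 - 2 * s)" .
    have "(\<integral>\<omega>. Q1 T \<omega> / real T \<partial>M) = (\<integral>\<omega>. Q1 T \<omega> \<partial>M) / real T" by simp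
    also have "\<dots> \<le> C1 * (real T powr (1 - p) / (1 - p)) / real T"
      using order_trans[OF Q1(3)[of T] mult_left_mono[OF sum_inverse_powr_le[OF p, of T, unfolded p_def] C1]] Tp
      by (intro divide_right_mono) (auto simp: p_def)
    also have "\<dots> = (C1 / (1 - p)) / real T powr p" using Tp by (simp add: powr_diff)
    also have "\<dots> \<le> C / real T powr p" using C(4) by (intro divide_right_mono) auto
    finally show "(\<integral>\<omega>. Q1 T \<omega> / real T \<partial>M) \<le> C / real T powr (g - 2 * s)" by (simp add: p_def)
  qed (use C t2 N1 Q1 in \<open>auto simp: power_divide\<close>)
qed

lemma round_regret_bounded:
  assumes "\<omega> \<in> space M" "x \<in> A i"
  shows "\<bar>J i (a t \<omega>) - cost x t \<omega>\<bar> \<le> 2 * B"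
  using payoff_le_B[OF joint_action[OF assms(1), of t]] payoff_le_B[OF joint_with_action[OF joint_action[OF assms(1), of t] assms(2)]]
  by simp

lemma regret_Suc: "regret J i b (Suc T) x = regret J i b T x + (J i (b (Suc T)) - J i (with_action i x (b (Suc T))))"
  by (simp add: regret_def)

lemma regret_integrable:
  assumes x: "x \<in> A i"
  shows "integrable M (\<lambda>\<omega>. run_regret x T \<omega>)"
proof -
  have "integrable M (\<lambda>\<omega>. J i (a t \<omega>) - cost x t \<omega>)" for t
  proof (rule integrable_const_bound[where B="2 * B"])
    have "(\<lambda>\<omega>. cost x t \<omega>) \<in> borel_measurable M"
      by (intro payoff_measurable measurable_F_M[OF opp_meas]) auto
    then show "(\<lambda>\<omega>. J i (a t \<omega>) - cost x t \<omega>) \<in> borel_measurable M"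
      using measurable_F_M[OF realized_payoff_measurable[of t]] by (intro borel_measurable_diff)
  qed (use round_regret_bounded x in auto)
  then show ?thesis unfolding regret_def sum_subtractf[symmetric]
    by (intro Bochner_Integration.integrable_sum)
qed

lemma expected_regret_bound:
  assumes x: "x \<in> A i"
  shows "(\<lambda>T. max 0 (\<integral>\<omega>. run_regret x T \<omega> / real T \<partial>M)) \<in>
      O(\<lambda>T. 1 / real T powr (1 - g) + 1 / real T powr (g - 2 * s) + 1 / real T powr (2 * s)
           + 1 / real T powr r * indicator (frontier (A i)) x + 1 / real T powr e)"
proof -
  obtain C t2 and N' Q :: "nat \<Rightarrow> 'w \<Rightarrow> real" where C: "0 \<le> C" "1 \<le> t2"
    and reg: "\<And>T \<omega>. T \<ge> t2 \<Longrightarrow> \<omega> \<in> space M \<Longrightarrow> run_regret x T \<omega> / real T \<le> C * rate x T + N' T \<omega> + Q T \<omega>"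
    and N': "\<And>T. integrable M (N' T)" "\<And>T. (\<integral>\<omega>. N' T \<omega> \<partial>M) = 0"
    and Q: "\<And>T. integrable M (Q T)" "\<And>T. T \<ge> t2 \<Longrightarrow> (\<integral>\<omega>. Q T \<omega> \<partial>M) \<le> C / real T powr (g - 2 * s)"
    using average_regret_decomposition[OF x] by metis
  show ?thesis
  proof (rule bigoI[where c=C], unfold eventually_sequentially, intro exI[of _ t2] allI impI)
    fix T assume T: "T \<ge> t2"
    have "(\<integral>\<omega>. run_regret x T \<omega> / real T \<partial>M) \<le> (\<integral>\<omega>. C * rate x T + N' T \<omega> + Q T \<omega> \<partial>M)"
      using regret_integrable[OF x] N' Q reg[OF T] by (intro integral_mono) auto
    also have "\<dots> = C * rate x T + (\<integral>\<omega>. Q T \<omega> \<partial>M)"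
      using N' Q by (simp add: prob_space)
    also have "\<dots> \<le> C * (rate x T + 1 / real T powr (g - 2 * s))"
      using Q(2)[OF T] by (simp add: distrib_left)
    finally have "max 0 (\<integral>\<omega>. run_regret x T \<omega> / real T \<partial>M) \<le> C * (rate x T + 1 / real T powr (g - 2 * s))"
      using C rate_nonneg[of x T] by simp
    then show "norm (max 0 (\<integral>\<omega>. run_regret x T \<omega> / real T \<partial>M)) \<le>
      C * norm (1 / real T powr (1 - g) + 1 / real T powr (g - 2 * s) + 1 / real T powr (2 * s)
           + 1 / real T powr r * indicator (frontier (A i)) x + 1 / real T powr e)"
      by (simp add: rate_def algebra_simps)
  qed
qed

text \<open>
  Along a subsequence of powers the random terms vanish almost surely because their means are
  summable; boundedness of the regret per round extends this to all horizons.
\<close>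

lemma AE_sublinear_regret:
  assumes x: "x \<in> A i"
  shows "AE \<omega> in M. \<forall>\<eta>>0. \<forall>\<^sub>F T in sequentially. run_regret x T \<omega> \<le> \<eta> * real T"
proof -
  obtain C t2 and N' Q :: "nat \<Rightarrow> 'w \<Rightarrow> real" where C: "0 \<le> C" "1 \<le> t2"
    and reg: "\<And>T \<omega>. T \<ge> t2 \<Longrightarrow> \<omega> \<in> space M \<Longrightarrow> run_regret x T \<omega> / real T \<le> C * rate x T + N' T \<omega> + Q T \<omega>"
    and N': "\<And>T. integrable M (\<lambda>\<omega>. (N' T \<omega>)\<^sup>2)" "\<And>T. T \<ge> t2 \<Longrightarrow> (\<integral>\<omega>. (N' T \<omega>)\<^sup>2 \<partial>M) \<le> C / real T powr (1 - 2 * s)"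
    and Q: "\<And>T \<omega>. 0 \<le> Q T \<omega>" "\<And>T. integrable M (Q T)" "\<And>T. T \<ge> t2 \<Longrightarrow> (\<integral>\<omega>. Q T \<omega> \<partial>M) \<le> C / real T powr (g - 2 * s)"
    using average_regret_decomposition[OF x] by metis
  define X where "X T \<omega> = (N' T \<omega>)\<^sup>2 + Q T \<omega>" for T \<omega>
  have EX: "(\<integral>\<omega>. X T \<omega> \<partial>M) \<le> (2 * C) / real T powr (g - 2 * s)" if T: "T \<ge> t2" for T
  proof -
    have Tp: "1 \<le> real T" using T C by simp
    have "(\<integral>\<omega>. X T \<omega> \<partial>M) = (\<integral>\<omega>. (N' T \<omega>)\<^sup>2 \<partial>M) + (\<integral>\<omega>. Q T \<omega> \<partial>M)"
      unfolding X_def using N' Q by simp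
    also have "\<dots> \<le> C / real T powr (g - 2 * s) + C / real T powr (g - 2 * s)"
    proof (intro add_mono Q T)
      have "C / real T powr (1 - 2 * s) \<le> C / real T powr (g - 2 * s)"
        using Tp rates C by (intro divide_left_mono powr_mono) auto
      then show "(\<integral>\<omega>. (N' T \<omega>)\<^sup>2 \<partial>M) \<le> C / real T powr (g - 2 * s)" using N'(2)[OF T] by simp
    qed
    finally show ?thesis by simp
  qed
  obtain q :: nat where q: "q \<ge> 1" "AE \<omega> in M. (\<lambda>k. X (k ^ q) \<omega>) \<longlonglongrightarrow> 0"
  proof (rule AE_tendsto_zero_along_powers[where X=X and \<delta>="g - 2 * s" and C="2 * C" and ?t1.0=t2 and M=M])
    show "integrable M (X T)" for T using N' Q unfolding X_def by simp
    show "0 \<le> X T \<omega>" for T \<omega> using Q(1) by (simp add: X_def)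
  qed (use EX rates in auto)
  have pow: "filterlim (\<lambda>k :: nat. k ^ q) at_top sequentially"
  proof (rule filterlim_at_top_mono[OF filterlim_ident])
    show "\<forall>\<^sub>F k in sequentially. k \<le> k ^ q"
      using eventually_ge_at_top[of 1] by eventually_elim (use q in \<open>auto intro: self_le_power\<close>)
  qed
  show ?thesis using q(2) AE_space
  proof eventually_elim
    case (elim \<omega>)
    show ?case
    proof (intro allI impI)
      fix \<eta> :: real assume \<eta>: "0 < \<eta>"
      show "\<forall>\<^sub>F T in sequentially. run_regret x T \<omega> \<le> \<eta> * real T"
      proof (rule linear_bound_from_powers[OF _ q(1) _ \<eta>])
        show "\<bar>run_regret x (Suc n) \<omega> - run_regret x n \<omega>\<bar> \<le> 2 * B" for n
          using round_regret_bounded[OF elim(2) x] by (simp add: regret_Suc)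
        fix h :: real assume h: "0 < h"
        define h' where "h' = min (h / 3) ((h / 3)\<^sup>2)"
        have h': "0 < h'" using h by (simp add: h'_def)
        have "(\<lambda>T. C * rate x T) \<longlonglongrightarrow> C * 0" by (intro tendsto_intros rate_tendsto_0)
        then have "\<forall>\<^sub>F T in sequentially. C * rate x T < h / 3"
          using h by (intro order_tendstoD(2)[of _ "C * 0"]) auto
        then have "\<forall>\<^sub>F k in sequentially. C * rate x (k ^ q) < h / 3"
          using pow by (rule eventually_compose_filterlim)
        moreover have "\<forall>\<^sub>F k in sequentially. X (k ^ q) \<omega> < h'"
          using elim(1) h' by (rule order_tendstoD(2))
        moreover have "\<forall>\<^sub>F k in sequentially. t2 \<le> k ^ q"
          using pow by (simp add: filterlim_at_top)
        ultimately show "\<forall>\<^sub>F k in sequentially. run_regret x (k ^ q) \<omega> \<le> h * real (k ^ q)"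
        proof eventually_elim
          case (elim k)
          define T where "T = k ^ q"
          have "1 \<le> T" using C(2) elim(3) unfolding T_def by (rule order_trans)
          then have Tp: "0 < real T" by simp
          have "(N' T \<omega>)\<^sup>2 + Q T \<omega> < h / 3" "(N' T \<omega>)\<^sup>2 + Q T \<omega> < (h / 3)\<^sup>2"
            using elim(2) by (simp_all only: X_def h'_def T_def min_less_iff_conj)
          then have "(N' T \<omega>)\<^sup>2 < (h / 3)\<^sup>2" "Q T \<omega> < h / 3"
            using Q(1)[of T \<omega>] zero_le_power2[of "N' T \<omega>"] by linarith+
          moreover from this(1) have "N' T \<omega> < h / 3" using h by (intro power2_less_imp_less[of _ "h / 3"]) auto
          ultimately have "run_regret x T \<omega> / real T \<le> h"
            using reg[of T \<omega>] elim(1,3) \<open>\<omega> \<in> space M\<close> unfolding T_def by simp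
          then show ?case using Tp by (simp add: T_def pos_divide_le_eq)
        qed
      qed
    qed
  qed
qed

text \<open>
  The exceptional null set must not depend on the reference point. It is chosen for a countable dense
  set of reference points; the Lipschitz continuity of the cost in the own action covers the others.
\<close>

lemma AE_no_regret: "AE \<omega> in M. no_regret A J i (\<lambda>t. a t \<omega>)"
proof -
  obtain D where D: "countable D" "D \<subseteq> A i" "A i \<subseteq> closure D" using separable by blast
  have "AE \<omega> in M. \<forall>y\<in>D. \<forall>\<eta>>0. \<forall>\<^sub>F T in sequentially. run_regret y T \<omega> \<le> \<eta> * real T"
    using AE_sublinear_regret D by (subst AE_ball_countable) auto
  then show ?thesis using AE_space
  proof eventually_elim
    case (elim \<omega>)
    show ?case unfolding no_regret_def
    proof
      fix x assume x: "x \<in> A i"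
      show "limsup (\<lambda>T. ereal (run_regret x T \<omega> / real T)) \<le> 0"
      proof (rule ereal_le_epsilon2)
        fix \<eta> :: real assume \<eta>: "0 < \<eta>"
        define d where "d = \<eta> / (2 * (L + 1))"
        have d: "0 < d" using \<eta> bounds_nonneg by (simp add: d_def)
        then obtain y where y: "y \<in> D" "dist y x < d" using D(3) x closure_approachable by blast
        have yA: "y \<in> A i" using y D by auto
        have "L * norm (y - x) \<le> (L + 1) * d"
          using y(2) bounds_nonneg by (intro mult_mono) (auto simp: dist_norm)
        also have "\<dots> = \<eta> / 2" using bounds_nonneg by (simp add: d_def field_simps)
        finally have Ly: "L * norm (y - x) \<le> \<eta> / 2" .
        have close: "run_regret x T \<omega> \<le> run_regret y T \<omega> + \<eta> / 2 * real T" for T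
        proof -
          have "run_regret x T \<omega> - run_regret y T \<omega> =
             (\<Sum>t=1..T. cost y t \<omega> - cost x t \<omega>)"
            by (simp add: regret_def sum_subtractf)
          also have "\<dots> \<le> (\<Sum>t=1..T. \<eta> / 2)"
            using payoff_lipschitz[OF joint_action[OF elim(2)] x yA] Ly by (intro sum_mono) (meson order_trans)
          finally show ?thesis by (simp add: mult.commute)
        qed
        have "\<forall>\<^sub>F T in sequentially. run_regret y T \<omega> \<le> \<eta> / 2 * real T"
          using elim(1) y(1) half_gt_zero[OF \<eta>] by blast
        then have "\<forall>\<^sub>F T in sequentially. ereal (run_regret x T \<omega> / real T) \<le> ereal \<eta>"
          using eventually_ge_at_top[of 1]
        proof eventually_elim
          case (elim T)
          have "run_regret x T \<omega> \<le> \<eta> * real T"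
            using close[of T] elim(1) by (simp add: algebra_simps)
          then show ?case using elim(2) by (simp add: pos_divide_le_eq)
        qed
        then show "limsup (\<lambda>T. ereal (run_regret x T \<omega> / real T)) \<le> 0 + ereal \<eta>"
          by (simp add: Limsup_bounded)
      qed
    qed
  qed
qed

end

section \<open>The no-regret theorem\<close>

theorem theorem2:
  fixes A :: "'n :: finite \<Rightarrow> (real ^ 'd :: finite) set"
    and J :: "'n \<Rightarrow> real ^ 'd ^ 'n \<Rightarrow> real"
    and i :: 'n
    and \<gamma> \<sigma> \<epsilon> \<rho> :: "nat \<Rightarrow> real"
    and g s e r :: real
    and M :: "'w measure"
    and F :: "nat \<Rightarrow> 'w measure"
    and \<mu>0 :: "real ^ 'd"
    and \<mu> \<xi> :: "nat \<Rightarrow> 'w \<Rightarrow> real ^ 'd"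
    and a :: "nat \<Rightarrow> 'w \<Rightarrow> real ^ 'd ^ 'n"
  assumes "convex_game A J"
    and "merely_monotone_game A J"
    and "smooth_with_growth J"
    and "admissible_parameters \<gamma> \<sigma> \<epsilon> \<rho> g s e r"
    and "0 < g" "g < 1" "0 < s" "s < 1" "0 < r" "r < 1" "0 < e"
    and "r < s"
    and "g - 2 * s > 0"
    and "prob_space M"
    and "information_flow M F"
    and "arbitrary_opponents M F A i a"
    and "payoff_based_run M F A J i \<gamma> \<sigma> \<epsilon> \<rho> \<mu>0 \<mu> \<xi> a"
  shows "(AE \<omega> in M. no_regret A J i (\<lambda>t. a t \<omega>)) \<and>
    (\<forall>x\<in>A i.
      (\<lambda>T. max 0 (\<integral>\<omega>. regret J i (\<lambda>t. a t \<omega>) T x / real T \<partial>M)) \<in>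
      O(\<lambda>T. 1 / real T powr (1 - g) + 1 / real T powr (g - 2 * s) + 1 / real T powr (2 * s)
           + 1 / real T powr r * indicator (frontier (A i)) x + 1 / real T powr e))"
proof -
  have cd: "continuously_differentiable (pseudo_gradient J)"
    using assms(3) by (simp add: smooth_with_growth_def)
  obtain B L K R where bounds: "0 \<le> B" "0 \<le> L" "0 \<le> K" "0 \<le> R"
    "\<And>x. x \<in> A i \<Longrightarrow> norm x \<le> R"
    "\<And>a. a \<in> joint_actions A \<Longrightarrow> \<bar>J i a\<bar> \<le> B"
    "\<And>a. a \<in> joint_actions A \<Longrightarrow> norm (pseudo_gradient J a $ i) \<le> L"
    "\<And>a x y. a \<in> joint_actions A \<Longrightarrow> x \<in> A i \<Longrightarrow> norm (y - x) \<le> 1 \<Longrightarrow>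
       J i (with_action i y a) \<le> J i (with_action i x a)
         + inner (pseudo_gradient J (with_action i x a) $ i) (y - x) + K * (norm (y - x))\<^sup>2"
    using uniform_payoff_bounds[OF assms(1) cd, of i] by blast
  have adm: "\<And>t. 0 < \<gamma> t" "\<And>t. 0 < \<sigma> t" "\<And>t. 0 \<le> \<rho> t"
    and decr: "\<forall>\<^sub>F t in sequentially. \<gamma> (Suc t) \<le> \<gamma> t"
    and th: "\<gamma> \<in> \<Theta>(\<lambda>t. 1 / real t powr g)" "\<sigma> \<in> \<Theta>(\<lambda>t. 1 / real t powr s)"
      "\<epsilon> \<in> O(\<lambda>t. 1 / real t powr e)" "\<rho> \<in> \<Theta>(\<lambda>t. 1 / real t powr r)"
    using assms(4) unfolding admissible_parameters_def by blast+
  obtain lg ug where G: "0 < lg" "0 < ug" "\<forall>\<^sub>F t in sequentially. lg / real t powr g \<le> \<gamma> t \<and> \<gamma> t \<le> ug / real t powr g"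
    by (rule bigtheta_inverse_powr_bounds[OF th(1) less_imp_le[OF adm(1)]])
  obtain ls us where S: "0 < ls" "0 < us" "\<forall>\<^sub>F t in sequentially. ls / real t powr s \<le> \<sigma> t \<and> \<sigma> t \<le> us / real t powr s"
    by (rule bigtheta_inverse_powr_bounds[OF th(2) less_imp_le[OF adm(2)]])
  obtain lr ur where P: "0 < lr" "0 < ur" "\<forall>\<^sub>F t in sequentially. lr / real t powr r \<le> \<rho> t \<and> \<rho> t \<le> ur / real t powr r"
    by (rule bigtheta_inverse_powr_bounds[OF th(4) adm(3)])
  obtain ue where E: "0 < ue" "\<forall>\<^sub>F t in sequentially. norm (\<epsilon> t) \<le> ue * norm (1 / real t powr e)"
    by (rule landau_o.bigE[OF th(3)])
  obtain x0 where "x0 \<in> interior (A i)" using assms(1) unfolding convex_game_def by blast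
  then obtain d where d: "d > 0" "ball x0 d \<subseteq> A i" using mem_interior by blast
  define adm_at where "adm_at t \<longleftrightarrow> \<gamma> (Suc t) \<le> \<gamma> t \<and> (lg / real t powr g \<le> \<gamma> t \<and> \<gamma> t \<le> ug / real t powr g)
      \<and> (ls / real t powr s \<le> \<sigma> t \<and> \<sigma> t \<le> us / real t powr s) \<and> us / real t powr s \<le> 1
      \<and> norm (\<epsilon> t) \<le> ue * norm (1 / real t powr e)
      \<and> (lr / real t powr r \<le> \<rho> t \<and> \<rho> t \<le> ur / real t powr r) \<and> ur / real t powr r \<le> d" for t
  have "\<forall>\<^sub>F t in sequentially. adm_at t"
    using decr G(3) S(3) eventually_inverse_powr_le[OF assms(7) zero_less_one, of us] E(2) P(3)
      eventually_inverse_powr_le[OF assms(9) d(1), of ur]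
  proof eventually_elim
    case (elim t)
    then show ?case unfolding adm_at_def by blast
  qed
  then obtain t0 where "\<And>t. t \<ge> t0 \<Longrightarrow> adm_at t"
    unfolding eventually_sequentially by blast
  note t0 = this[unfolded adm_at_def]
  have A: "compact (A i)" "convex (A i)" using assms(1) by (auto simp: convex_game_def)
  have shift: "lr / real t powr r \<le> \<rho> (t - 1) \<and> shrunk (\<rho> (t - 1)) (A i) \<noteq> {}" if t: "t \<ge> t0 + 2" for t
  proof
    have t': "t - 1 \<ge> t0" "1 \<le> real (t - 1)" "real (t - 1) \<le> real t" using t by auto
    have "lr / real t powr r \<le> lr / real (t - 1) powr r"
      using t' P(1) assms(9) by (intro divide_left_mono powr_mono2) auto
    then show "lr / real t powr r \<le> \<rho> (t - 1)" using t0[OF t'(1)] order_trans by blast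
    have "\<rho> (t - 1) \<le> d" using t0[OF t'(1)] order_trans by blast
    moreover have "x0 \<in> A i" using d centre_in_ball by blast
    ultimately have "(1 - 1) *\<^sub>R x0 + 1 *\<^sub>R x0 \<in> shrunk (\<rho> (t - 1)) (A i)"
      by (intro contraction_in_shrunk[OF A _ d(2,1)]) simp_all
    then show "shrunk (\<rho> (t - 1)) (A i) \<noteq> {}" by blast
  qed
  interpret prob_space M by fact
  interpret controlled_run M A J i \<gamma> \<sigma> \<epsilon> \<rho> g s e r F \<mu>0 \<mu> \<xi> a B L K R "t0 + 2" lg ug ls us ue lr ur
  proof unfold_locales
    fix t assume t: "t \<ge> t0 + 2"
    then have "t \<ge> t0" by simp
    note t0' = t0[OF this]
    show "\<gamma> (Suc t) \<le> \<gamma> t" "lg / real t powr g \<le> \<gamma> t \<and> \<gamma> t \<le> ug / real t powr g"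
      "\<rho> t \<le> ur / real t powr r"
      using t0' by blast+
    show "ls / real t powr s \<le> \<sigma> t \<and> \<sigma> t \<le> us / real t powr s \<and> \<sigma> t \<le> 1"
      using t0' order_trans by blast
    have "norm (\<epsilon> t) \<le> ue * norm (1 / real t powr e)" using t0' by blast
    then show "\<bar>\<epsilon> t\<bar> \<le> ue / real t powr e" by simp
    show "lr / real t powr r \<le> \<rho> (t - 1) \<and> shrunk (\<rho> (t - 1)) (A i) \<noteq> {}" using shift[OF t] .
  qed (fact assms bounds adm G(1,2) S(1,2) P(1,2) E(1) | simp)+
  show ?thesis by (intro conjI ballI AE_no_regret expected_regret_bound)
qed

end
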